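(* Let $n\ge1$, let $L_1,L_2,N_1,N_2>0$ and $0<\underline b\le\bar b$ be constants, and let $f\in C^1(\mathbb{R}^{3n},\mathbb{R}^n)$, $g\in C^1(\mathbb{R}^{2n},\mathbb{R}^n)$, $d\in C^1(\mathbb{R}^+,\mathbb{R}^n)$, $r\in C^2(\mathbb{R}^+,\mathbb{R}^n)$ satisfy: (A1) for all $x_1,x_2,u\in\mathbb{R}^n$ and $i=1,2$: $\|\partial f/\partial x_i\|\le L_i$, $\|\partial g/\partial x_i\|\le N_i$, and $\underline b I_n\le\partial f/\partial u\le\bar bI_n$; (A2) $\sup_{t\ge0}|\dot r(t)|<\infty$ and $\sup_{t\ge0}|\dot d(t)|<\infty$; (A3) $\sup_{t\ge0}|g(r(t),\dot r(t))|<\infty$; (A4) $\sup_{t\ge0}|\ddot r(t)|<\infty$. Let $k_i,k_p,k_d>0$ satisfy $$k_p^2-2k_ik_d>\bar k_1+k_dN_1^2/\underline b,\qquad k_d^2-k_p/\underline b>\bar k_1+k_dN_2^2/\underline b,$$ where $\bar k_1:=(L_1+L_2)(k_p+k_d)/\underline b$. Let $\omega>0$, let $(x_1(0),x_2(0))\in\mathbb{R}^{2n}$ be an initial state, and let $y^*$ be the solution of $$\ddot y^*=-\omega^2(y^*-r(t))-2\omega(\dot y^*-\dot r(t))+\ddot r(t),\qquad y^*(0)=x_1(0),\ \dot y^*(0)=x_2(0).$$ For $0<\epsilon\le1$ consider the closed-loop stochastic system with this initial state $$\mathrm{d}x_1(t)=x_2(t)\,\mathrm{d}t,\qquad \mathrm{d}x_2(t)=[f(x_1(t),x_2(t),\hat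 u(t))+d(t)]\,\mathrm{d}t+g(x_1(t),x_2(t))\,\mathrm{d}B_t,$$ $$\hat u(t)=\frac{k_p}{\epsilon^2}E(t)+\frac{k_i}{\epsilon^3}\int_0^tE(s)\,\mathrm{d}s+\frac{k_d}{\epsilon}\dot E(t),\qquad E(t)=y^*(t)-x_1(t).$$ Then there is a constant $c>0$, independent of $\epsilon$, such that $$\sup_{t\ge0}\mathbf{E}|E(t)|^2\le c\,\epsilon^3,\qquad \sup_{t\ge0}\mathbf{E}|\dot E(t)|^2\le c\,\epsilon,\qquad\text{for all }0<\epsilon\le1.$$
   Context: $\mathbb{R}^+=[0,\infty)$; $|\cdot|$ is the Euclidean norm of a vector and $\|\cdot\|$ the induced operator norm of a matrix. For symmetric matrices, $S_1\ge S_2$ means $S_1-S_2$ is positive semidefinite (so the inequality on $\partial f/\partial u$ includes that this Jacobian is symmetric). $f=f(x_1,x_2,u)$ and $g=g(x_1,x_2)$ with $x_1,x_2,u\in\mathbb{R}^n$; $\partial f/\partial x_i$, $\partial f/\partial u$, $\partial g/\partial x_i$ are the $n\times n$ Jacobian blocks. $\{B_t\}_{t\ge0}$ is a one-dimensional standard Brownian motion. The stochastic differential equation is in the Itô sense, the initial state is deterministic, and $\dot E(t)=\dot y^*(t)-x_2(t)$. *)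

theory Defs
  imports "HOL-Probability.Probability"
begin

definition C1_map :: "('a::real_normed_vector \<Rightarrow> 'b::real_normed_vector) \<Rightarrow> bool" where
  "C1_map h \<longleftrightarrow> (\<exists>h'. (\<forall>x. (h has_derivative blinfun_apply (h' x)) (at x)) \<and> continuous_on UNIV h')"

definition matrix_opnorm :: "real^'n^'m \<Rightarrow> real" where
  "matrix_opnorm A = onorm (\<lambda>v. A *v v)"

text \<open>Positive semidefiniteness includes symmetry.\<close>

definition psd_matrix :: "real^'n^'n \<Rightarrow> bool" where
  "psd_matrix A \<longleftrightarrow> transpose A = A \<and> (\<forall>v. 0 \<le> v \<bullet> (A *v v))"

definition loewner_le :: "real^'n^'n \<Rightarrow> real^'n^'n \<Rightarrow> bool" where
  "loewner_le A B \<longleftrightarrow> psd_matrix (B - A)"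

text \<open>
  Time is \<open>[0,\<infinity>)\<close>.  The library's filtrations are indexed by a whole type; the indices
  \<open>t < 0\<close> are irrelevant, since every filtration on \<open>[0,\<infinity>)\<close> extends
  by \<open>F t = F 0\<close>.
\<close>

locale brownian_motion = prob_space M + filtration "space M" F
  for M :: "'a measure" and F :: "real \<Rightarrow> 'a measure" +
  fixes B :: "real \<Rightarrow> 'a \<Rightarrow> real"
  assumes sets_F_subset: "\<And>t. sets (F t) \<subseteq> sets M"
    and adapted: "\<And>t. 0 \<le> t \<Longrightarrow> B t \<in> borel_measurable (F t)"
    and start_zero: "AE \<omega> in M. B 0 \<omega> = 0"
    and normal_increments: "\<And>s t. 0 \<le> s \<Longrightarrow> s < t \<Longrightarrow>
      distributed M lborel (\<lambda>\<omega>. B t \<omega> - B s \<omega>) (normal_density 0 (sqrt (t - s)))"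
    and independent_increments: "\<And>s t. 0 \<le> s \<Longrightarrow> s < t \<Longrightarrow>
      indep_set (sets (F s)) (sets (vimage_algebra (space M) (\<lambda>\<omega>. B t \<omega> - B s \<omega>) borel))"
    and continuous_paths: "AE \<omega> in M. continuous_on {0..} (\<lambda>t. B t \<omega>)"

definition progressive ::
  "(real \<Rightarrow> 'a measure) \<Rightarrow> (real \<Rightarrow> 'a \<Rightarrow> 'b::topological_space) \<Rightarrow> bool" where
  "progressive F H \<longleftrightarrow>
    (\<forall>t\<ge>0. (\<lambda>(s, \<omega>). H s \<omega>) \<in> borel_measurable (restrict_space borel {0..t} \<Otimes>\<^sub>M F t))"

text \<open>
  The process \<open>H\<close> is simple, \<open>H = (\<Sum>i<m. \<xi>\<^sub>i 1\<^bsub>(\<tau>\<^sub>i, \<tau>\<^sub>i\<^sub>+\<^sub>1]\<^esub>)\<close> with bounded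
  \<open>F \<tau>\<^sub>i\<close>-measurable \<open>\<xi>\<^sub>i\<close>, and \<open>J\<close> is its elementary stochastic integral over \<open>[0,t]\<close>.
\<close>

definition simple_ito_integral ::
  "'a measure \<Rightarrow> (real \<Rightarrow> 'a measure) \<Rightarrow> (real \<Rightarrow> 'a \<Rightarrow> real) \<Rightarrow> real \<Rightarrow>
    (real \<Rightarrow> 'a \<Rightarrow> 'b::euclidean_space) \<Rightarrow> ('a \<Rightarrow> 'b) \<Rightarrow> bool" where
  "simple_ito_integral M F B t H J \<longleftrightarrow>
    (\<exists>(m::nat) (\<tau> :: nat \<Rightarrow> real) (\<xi> :: nat \<Rightarrow> 'a \<Rightarrow> 'b).
      0 \<le> \<tau> 0 \<and> (\<forall>i<m. \<tau> i \<le> \<tau> (Suc i)) \<and>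
      (\<forall>i<m. \<xi> i \<in> borel_measurable (F (\<tau> i))) \<and>
      (\<forall>i<m. \<exists>C. \<forall>\<omega>\<in>space M. norm (\<xi> i \<omega>) \<le> C) \<and>
      H = (\<lambda>s \<omega>. \<Sum>i<m. indicat_real {\<tau> i<..\<tau> (Suc i)} s *\<^sub>R \<xi> i \<omega>) \<and>
      J = (\<lambda>\<omega>. \<Sum>i<m. (B (min t (\<tau> (Suc i))) \<omega> - B (min t (\<tau> i)) \<omega>) *\<^sub>R \<xi> i \<omega>))"

definition tendsto_in_probability ::
  "'a measure \<Rightarrow> (nat \<Rightarrow> 'a \<Rightarrow> 'b::euclidean_space) \<Rightarrow> ('a \<Rightarrow> 'b) \<Rightarrow> bool" where
  "tendsto_in_probability M X Y \<longleftrightarrow>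
    (\<forall>\<delta>>0. (\<lambda>k. measure M {\<omega>\<in>space M. \<delta> < norm (X k \<omega> - Y \<omega>)}) \<longlonglongrightarrow> 0)"

text \<open>
  \<open>J = \<integral>\<^sub>0\<^sup>t H dB\<close>: the limit in probability of the integrals of simple processes
  \<open>S k\<close> for which \<open>\<integral>\<^sub>0\<^sup>t |S k - H|\<^sup>2 ds\<close> tends to \<open>0\<close> in probability.  Since the \<open>S k\<close> are
  bounded, this forces \<open>\<integral>\<^sub>0\<^sup>t |H|\<^sup>2 ds < \<infinity>\<close> almost surely.  The integral is
  determined up to a null set.
\<close>

definition has_ito_integral ::
  "'a measure \<Rightarrow> (real \<Rightarrow> 'a measure) \<Rightarrow> (real \<Rightarrow> 'a \<Rightarrow> real) \<Rightarrow> real \<Rightarrow>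
    (real \<Rightarrow> 'a \<Rightarrow> 'b::euclidean_space) \<Rightarrow> ('a \<Rightarrow> 'b) \<Rightarrow> bool" where
  "has_ito_integral M F B t H J \<longleftrightarrow>
    progressive F H \<and> J \<in> borel_measurable M \<and>
    (\<exists>S I. (\<forall>k. simple_ito_integral M F B t (S k) (I k)) \<and>
      (\<forall>\<delta>>0. (\<lambda>k. measure M {\<omega>\<in>space M.
          ennreal \<delta> < (\<integral>\<^sup>+ s\<in>{0..t}. ennreal ((norm (S k s \<omega> - H s \<omega>))\<^sup>2) \<partial>lborel)}) \<longlonglongrightarrow> 0) \<and>
      tendsto_in_probability M I J)"

definition pid_control ::
  "real \<Rightarrow> real \<Rightarrow> real \<Rightarrow> real \<Rightarrow> (real \<Rightarrow> 'b) \<Rightarrow> (real \<Rightarrow> 'b) \<Rightarrow> real \<Rightarrow> 'b::euclidean_space" where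
  "pid_control kp ki kd \<epsilon> e e' t =
    (kp / \<epsilon>^2) *\<^sub>R e t + (ki / \<epsilon>^3) *\<^sub>R integral {0..t} e + (kd / \<epsilon>) *\<^sub>R e' t"

text \<open>
  Since the paths are continuous, requiring the integrated equations almost surely at each \<open>t\<close>
  amounts to requiring them almost surely for all \<open>t\<close>, with the continuous version of the Ito
  integral.  The tracked trajectory is \<open>y\<close>, with velocity \<open>y'\<close>.
\<close>

definition closed_loop_solution ::
  "'a measure \<Rightarrow> (real \<Rightarrow> 'a measure) \<Rightarrow> (real \<Rightarrow> 'a \<Rightarrow> real) \<Rightarrow>
    ('b \<times> 'b \<times> 'b \<Rightarrow> 'b) \<Rightarrow> ('b \<times> 'b \<Rightarrow> 'b) \<Rightarrow> (real \<Rightarrow> 'b) \<Rightarrow> (real \<Rightarrow> 'b) \<Rightarrow> (real \<Rightarrow> 'b) \<Rightarrow>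
    real \<Rightarrow> real \<Rightarrow> real \<Rightarrow> real \<Rightarrow> 'b \<Rightarrow> 'b \<Rightarrow>
    (real \<Rightarrow> 'a \<Rightarrow> 'b::euclidean_space) \<Rightarrow> (real \<Rightarrow> 'a \<Rightarrow> 'b) \<Rightarrow> bool" where
  "closed_loop_solution M F B f g d y y' kp ki kd \<epsilon> x10 x20 x1 x2 \<longleftrightarrow>
    (\<forall>t\<ge>0. x1 t \<in> borel_measurable (F t) \<and> x2 t \<in> borel_measurable (F t)) \<and>
    (\<forall>\<omega>\<in>space M. continuous_on {0..} (\<lambda>t. x1 t \<omega>) \<and> continuous_on {0..} (\<lambda>t. x2 t \<omega>)) \<and>
    (\<forall>t\<ge>0. AE \<omega> in M. x1 t \<omega> = x10 + integral {0..t} (\<lambda>s. x2 s \<omega>)) \<and>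
    (\<forall>t\<ge>0. \<exists>J. has_ito_integral M F B t (\<lambda>s \<omega>. g (x1 s \<omega>, x2 s \<omega>)) J \<and>
      (AE \<omega> in M. x2 t \<omega> = x20
        + integral {0..t} (\<lambda>s.
            f (x1 s \<omega>, x2 s \<omega>,
               pid_control kp ki kd \<epsilon> (\<lambda>v. y v - x1 v \<omega>) (\<lambda>v. y' v - x2 v \<omega>) s) + d s)
        + J \<omega>))"

end

theory Submission
  imports Defs
begin

text \<open>
  Let \<open>u\<^sup>*(t)\<close> solve \<open>f (y, y', u\<^sup>*) = -d\<close>; it is Lipschitz in \<open>t\<close>, because \<open>f\<close> is strongly monotone
  in the control and \<open>y'\<close>, \<open>y''\<close>, \<open>d'\<close> are bounded.  Since \<open>y''\<close> is merely bounded, it stays in the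
  drift as a perturbation, and \<open>u\<^sup>*\<close> is replaced by a \<open>C\<^sup>1\<close> curve \<open>v\<close> at bounded distance.
  In the scaled state \<open>X = (\<integral>E / \<epsilon>\<^sup>2 - \<epsilon> v / ki, E / \<epsilon>, E')\<close> one has
  \<open>\<epsilon> (u - v) = ki X\<^sub>0 + kp X\<^sub>1 + kd X\<^sub>2\<close>, and a quadratic form \<open>V\<close> whose last row is \<open>(ki, kp, kd)\<close>
  has drift at most \<open>C - \<alpha> V / \<epsilon>\<close> along the loop.  Hence the mean of \<open>V\<close> is \<open>O(\<epsilon>)\<close>, uniformly in time.

  The passage from the drift inequality to the mean of \<open>V\<close> does not use the Ito formula.  Before the
  exit time from a ball the coefficients are bounded, so the process is the mean square limit of its
  Euler scheme; for the scheme, killed at the exit time, the inequality follows from the first two moments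
  of the Brownian increments, and it is iterated over the grid.  Killing only decreases the mean of \<open>V\<close>,
  and the radius of the ball tends to infinity by monotone convergence.
\<close>

section \<open>Elementary stochastic integrals\<close>

text \<open>The Ito integral is defined by convergence in probability along unspecified simple
  processes, so a value \<open>J\<close> need not have a second moment. What can be estimated in
  mean square is the distance from \<open>J\<close> to an elementary integral on an event where the
  integrand agrees with a bounded left continuous process; behind this lies a truncation of simple
  processes that does not look into the future. The exponents 3 and 1 come from the scaling. The
  reference starts at the initial state of the system, so \<open>E\<close> and its derivative vanish
  at time 0, and the form of the initial scaled state is of order \<epsilon> squared. Noise and
  perturbations feed the form at a bounded rate against a decay rate of order 1 / \<epsilon>, which
  leaves order \<epsilon>. Since \<open>E\<close> is \<epsilon> times the middle component, its
  second moment gains another factor \<epsilon> squared. An input that also compensated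
  \<open>y''\<close> need not be Lipschitz, because \<open>r''\<close> is only continuous. The curve
  \<open>v\<close> has to be differentiable because it is part of the integral coordinate, whose
  drift contains \<open>v'\<close>.\<close>

abbreviation path_moment :: "nat \<Rightarrow> real \<Rightarrow> (real \<Rightarrow> 'b::real_normed_vector) \<Rightarrow> ennreal" where
  "path_moment k t x \<equiv> \<integral>\<^sup>+s\<in>{0..t}. ennreal ((norm (x s))^k) \<partial>lborel"

context brownian_motion
begin

section \<open>Brownian increments: independence of the past and first two moments\<close>

lemma subalgebra_F: "subalgebra M (F t)"
  unfolding subalgebra_def using space_F sets_F_subset by auto

lemma F_imp_M: "X \<in> borel_measurable (F t) \<Longrightarrow> X \<in> borel_measurable M"
  using measurable_from_subalg[OF subalgebra_F] .

lemma F_mono: "X \<in> borel_measurable (F s) \<Longrightarrow> s \<le> t \<Longrightarrow> X \<in> borel_measurable (F t)"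
  by (rule measurable_from_subalg[of "F t" "F s"]) (auto simp: subalgebra_def space_F sets_F_mono)

lemma increment_measurable:
  "0 \<le> s \<Longrightarrow> 0 \<le> t \<Longrightarrow> (\<lambda>x. B t x - B s x) \<in> borel_measurable M"
  using F_imp_M[OF adapted[of s]] F_imp_M[OF adapted[of t]] by simp

text \<open>The hypothesis on the increments speaks of \<sigma>-algebras. The two variables generate
  sub-\<sigma>-algebras of the independent pair, and independence passes to smaller
  families.\<close>

lemma increment_indep:
  assumes "0 \<le> s" "s < t" "X \<in> borel_measurable (F s)"
  shows "indep_var borel X borel (\<lambda>x. B t x - B s x)"
  unfolding indep_var_eq
proof (intro conjI)
  show "random_variable borel X" using assms F_imp_M by auto
  show "random_variable borel (\<lambda>x. B t x - B s x)" using assms increment_measurable[of s t] by simp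
  have *: "indep_sets (case_bool (sets (F s)) (sets (vimage_algebra (space M) (\<lambda>\<omega>. B t \<omega> - B s \<omega>) borel))) UNIV"
    using independent_increments[OF assms(1,2)] unfolding indep_set_def .
  have 1: "sigma_sets (space M) {X -` A \<inter> space M |A. A \<in> sets borel} \<subseteq> sets (F s)"
    using sets.sigma_sets_subset[of "{X -` A \<inter> space M |A. A \<in> sets borel}" "F s"]
      measurable_sets[OF assms(3)] space_F by auto
  have 2: "sigma_sets (space M) {(\<lambda>x. B t x - B s x) -` A \<inter> space M |A. A \<in> sets borel} \<subseteq>
     sets (vimage_algebra (space M) (\<lambda>\<omega>. B t \<omega> - B s \<omega>) borel)"
    by (simp add: sets_vimage_algebra)
  show "indep_set (sigma_sets (space M) {X -` A \<inter> space M |A. A \<in> sets borel})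
     (sigma_sets (space M) {(\<lambda>x. B t x - B s x) -` A \<inter> space M |A. A \<in> sets borel})"
    unfolding indep_set_def
    by (rule indep_sets_mono_sets[OF *]) (use 1 2 in \<open>auto split: bool.split\<close>)
qed

lemma increment_moments:
  assumes "0 \<le> s" "s < t"
  shows "integrable M (\<lambda>x. B t x - B s x)" "expectation (\<lambda>x. B t x - B s x) = 0"
    "integrable M (\<lambda>x. (B t x - B s x)^2)" "expectation (\<lambda>x. (B t x - B s x)^2) = t - s"
proof -
  note D = normal_increments[OF assms]
  have pos: "0 < sqrt (t - s)" using assms by simp
  have i: "integrable lborel (\<lambda>x. normal_density 0 (sqrt (t - s)) x * x ^ k)" for k
    using integrable_normal_moment[OF pos, of 0 k] by simp
  show "integrable M (\<lambda>x. B t x - B s x)"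
    using distributed_integrable[OF D, of "\<lambda>x. x"] i[of 1] by simp
  show "integrable M (\<lambda>x. (B t x - B s x)^2)"
    using distributed_integrable[OF D, of "\<lambda>x. x^2"] i[of 2] by simp
  show "expectation (\<lambda>x. B t x - B s x) = 0"
    using distributed_integral[OF D, of "\<lambda>x. x"] integral_normal_moment_odd[OF pos, of 0 0] by simp
  show "expectation (\<lambda>x. (B t x - B s x)^2) = t - s"
    using distributed_integral[OF D, of "\<lambda>x. x^2"] integral_normal_moment_even[OF pos, of 0 1] assms
    by (simp add: power2_eq_square field_simps)
qed

text \<open>Integrability of the products comes from independence, so \<open>X\<close> itself only
  has to be integrable. In the applications \<open>X\<close> is an inner product of two square
  integrable vectors.\<close>

lemma increment_mult:
  assumes "0 \<le> s" "s \<le> t" "X \<in> borel_measurable (F s)" "integrable M X"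
  shows "integrable M (\<lambda>x. X x * (B t x - B s x))" "expectation (\<lambda>x. X x * (B t x - B s x)) = 0"
    "integrable M (\<lambda>x. X x * (B t x - B s x)^2)"
    "expectation (\<lambda>x. X x * (B t x - B s x)^2) = (t - s) * expectation X"
proof -
  have "integrable M (\<lambda>x. X x * (B t x - B s x)) \<and> expectation (\<lambda>x. X x * (B t x - B s x)) = 0 \<and>
    integrable M (\<lambda>x. X x * (B t x - B s x)^2) \<and>
    expectation (\<lambda>x. X x * (B t x - B s x)^2) = (t - s) * expectation X"
  \<comment> \<open>\<open>normal_increments\<close> covers only \<open>s < t\<close>. The
    degenerate case does occur, since partition points may coincide, and there the increment is
    0.\<close>
  proof (cases "s = t")
    case False
    then have st: "s < t" using assms by simp
    note m = increment_moments[OF assms(1) st]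
    note i1 = increment_indep[OF assms(1) st assms(3)]
    have i2: "indep_var borel X borel (\<lambda>x. (B t x - B s x)^2)"
      using indep_var_compose[OF i1, of "\<lambda>x. x" borel "\<lambda>x. x^2" borel] by (simp add: comp_def)
    show ?thesis
      using indep_var_integrable[OF i1 assms(4) m(1)] indep_var_lebesgue_integral[OF i1 assms(4) m(1)]
        indep_var_integrable[OF i2 assms(4) m(3)] indep_var_lebesgue_integral[OF i2 assms(4) m(3)] m
      by simp
  qed auto
  then show "integrable M (\<lambda>x. X x * (B t x - B s x))" "expectation (\<lambda>x. X x * (B t x - B s x)) = 0"
    "integrable M (\<lambda>x. X x * (B t x - B s x)^2)"
    "expectation (\<lambda>x. X x * (B t x - B s x)^2) = (t - s) * expectation X" by blast+
qed

end

section \<open>Second moments of elementary integrals\<close>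

lemma integrable_inner_square:
  fixes X Y :: "'a \<Rightarrow> 'b::euclidean_space"
  assumes [measurable]: "X \<in> borel_measurable M" "Y \<in> borel_measurable M"
    and "integrable M (\<lambda>x. (norm (X x))^2)" "integrable M (\<lambda>x. (norm (Y x))^2)"
  shows "integrable M (\<lambda>x. X x \<bullet> Y x)"
proof (rule Bochner_Integration.integrable_bound)
  show "integrable M (\<lambda>x. (norm (X x))^2 + (norm (Y x))^2)" using assms by auto
  have "\<bar>X x \<bullet> Y x\<bar> \<le> (norm (X x))^2 + (norm (Y x))^2" for x
  proof -
    have "2 * (norm (X x) * norm (Y x)) \<le> (norm (X x))^2 + (norm (Y x))^2"
      using sum_squares_bound[of "norm (X x)" "norm (Y x)"] by (simp add: mult.assoc)
    moreover have "\<bar>X x \<bullet> Y x\<bar> \<le> norm (X x) * norm (Y x)" by (rule Cauchy_Schwarz_ineq2)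
    moreover have "0 \<le> norm (X x) * norm (Y x)" by simp
    ultimately show ?thesis by linarith
  qed
  then show "AE x in M. norm (X x \<bullet> Y x) \<le> norm ((norm (X x))^2 + (norm (Y x))^2)" by auto
qed measurable

lemma integrable_norm_square_add:
  fixes X Y :: "'a \<Rightarrow> 'b::euclidean_space"
  assumes [measurable]: "X \<in> borel_measurable M" "Y \<in> borel_measurable M"
    and "integrable M (\<lambda>x. (norm (X x))^2)" "integrable M (\<lambda>x. (norm (Y x))^2)"
  shows "integrable M (\<lambda>x. (norm (X x + Y x))^2)"
proof -
  have "(\<lambda>x. (norm (X x + Y x))^2) = (\<lambda>x. (norm (X x))^2 + 2 * (X x \<bullet> Y x) + (norm (Y x))^2)"
    by (auto simp: power2_norm_eq_inner algebra_simps inner_commute)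
  then show ?thesis using integrable_inner_square[OF assms] assms by simp
qed

lemma norm_square_add_scaleR:
  "(norm (x + c *\<^sub>R y))^2 = (norm x)^2 + 2 * ((x \<bullet> y) * c) + (norm y)^2 * c^2" for x y :: "'b::real_inner"
  unfolding power2_norm_eq_inner
  by (simp add: inner_add_left inner_add_right inner_commute[of y x] power2_eq_square algebra_simps)

lemma partition_mono: "i < m \<Longrightarrow> \<forall>i<m. \<tau> i \<le> \<tau> (Suc i) \<Longrightarrow> j \<le> i \<Longrightarrow> (\<tau> j::real) \<le> \<tau> i"
  by (induction i) (auto simp: le_Suc_eq intro: order_trans)

lemma partition_nonneg: "0 \<le> (\<tau> 0 :: real) \<Longrightarrow> \<forall>i<m. \<tau> i \<le> \<tau> (Suc i) \<Longrightarrow> i \<le> m \<Longrightarrow> 0 \<le> \<tau> i"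
proof (induction i)
  case (Suc i) then show ?case by (meson Suc_leD Suc_le_lessD order_trans)
qed

context brownian_motion
begin

text \<open>Induction over the intervals: the cross term is the increment times a variable known at
  its left end, so it has mean 0, and the squared increment has the length of the interval as its
  mean. Measurability of the partial sum at \<open>min t (\<tau> k)\<close> is carried along because
  it is what makes the next increment independent of it.\<close>

lemma simple_isometry:
  fixes \<tau> :: "nat \<Rightarrow> real" and \<xi> :: "nat \<Rightarrow> 'a \<Rightarrow> 'b::euclidean_space"
  assumes "0 \<le> t" "0 \<le> \<tau> 0" "\<forall>i<m. \<tau> i \<le> \<tau> (Suc i)" "\<forall>i<m. \<xi> i \<in> borel_measurable (F (\<tau> i))"
    "\<forall>i<m. \<exists>C. \<forall>\<omega>\<in>space M. norm (\<xi> i \<omega>) \<le> C"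
  defines "J \<equiv> \<lambda>m \<omega>. \<Sum>i<m. (B (min t (\<tau> (Suc i))) \<omega> - B (min t (\<tau> i)) \<omega>) *\<^sub>R \<xi> i \<omega>"
  shows "k \<le> m \<Longrightarrow> J k \<in> borel_measurable (F (min t (\<tau> k))) \<and> integrable M (\<lambda>\<omega>. (norm (J k \<omega>))^2) \<and>
    expectation (\<lambda>\<omega>. (norm (J k \<omega>))^2) =
    expectation (\<lambda>\<omega>. \<Sum>i<k. (min t (\<tau> (Suc i)) - min t (\<tau> i)) * (norm (\<xi> i \<omega>))^2)"
proof (induction k)
  case 0
  then show ?case by (simp add: J_def)
next
  case (Suc k)
  have mono: "i \<le> k \<Longrightarrow> \<tau> i \<le> \<tau> k" for i using partition_mono[of k m \<tau> i] Suc.prems assms(3) by auto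
  define a where "a = min t (\<tau> k)"
  define b where "b = min t (\<tau> (Suc k))"
  have t0: "0 \<le> \<tau> i" if "i \<le> m" for i
    using partition_nonneg[of \<tau> m i] assms that by blast
  have ab: "0 \<le> a" "a \<le> b" using assms(1) spec[OF assms(3), of k] t0[of k] Suc.prems by (auto simp: a_def b_def min_def)
  have IH: "J k \<in> borel_measurable (F a)" "integrable M (\<lambda>\<omega>. (norm (J k \<omega>))^2)"
    "expectation (\<lambda>\<omega>. (norm (J k \<omega>))^2) =
      expectation (\<lambda>\<omega>. \<Sum>i<k. (min t (\<tau> (Suc i)) - min t (\<tau> i)) * (norm (\<xi> i \<omega>))^2)"
    using Suc by (auto simp: a_def)
  have bi: "integrable M (\<lambda>\<omega>. (norm (\<xi> i \<omega>))^2)" "\<xi> i \<in> borel_measurable M" if i: "i < m" for i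
  proof -
    show [measurable]: "\<xi> i \<in> borel_measurable M" using assms(4) i F_imp_M by auto
    obtain C where "\<forall>\<omega>\<in>space M. norm (\<xi> i \<omega>) \<le> C" using assms(5) i by blast
    then show "integrable M (\<lambda>\<omega>. (norm (\<xi> i \<omega>))^2)"
      by (intro integrable_const_bound[where B="C^2"]) (auto intro!: AE_I2 power_mono)
  qed
  have k: "k < m" using Suc.prems by simp
  show ?case
  \<comment> \<open>If \<open>t \<le> \<tau> k\<close>, the clipped interval is empty and nothing
    changes. Otherwise the clipped left end is \<open>\<tau> k\<close> itself, so that
    \<open>\<xi> k\<close> is known there; at an earlier time it need not be.\<close>
  proof (cases "t \<le> \<tau> k")
    case True
    then have "t \<le> \<tau> (Suc k)" using assms(3) k by (meson order_trans)
    then have "J (Suc k) = J k" "min t (\<tau> (Suc k)) = a" using True by (auto simp: J_def a_def)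
    then show ?thesis using IH True \<open>t \<le> \<tau> (Suc k)\<close> by simp
  next
    case False
    then have a: "a = \<tau> k" by (simp add: a_def)
    have xm [measurable]: "\<xi> k \<in> borel_measurable (F a)" using assms(4) k a by auto
    have J: "J (Suc k) = (\<lambda>\<omega>. J k \<omega> + (B b \<omega> - B a \<omega>) *\<^sub>R \<xi> k \<omega>)" by (auto simp: J_def a_def b_def)
    note [measurable] = IH(1)
    have [measurable]: "J k \<in> borel_measurable (F b)" "\<xi> k \<in> borel_measurable (F b)" "B a \<in> borel_measurable (F b)"
      "B b \<in> borel_measurable (F b)"
      using F_mono[OF IH(1)] F_mono[OF xm] F_mono[OF adapted[of a]] adapted[of b] ab by auto
    have 1: "J (Suc k) \<in> borel_measurable (F b)" unfolding J by measurable
    have ip: "integrable M (\<lambda>\<omega>. J k \<omega> \<bullet> \<xi> k \<omega>)"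
      by (rule integrable_inner_square) (use F_imp_M[OF IH(1)] IH bi k in auto)
    note m1 = increment_mult[OF ab, of "\<lambda>\<omega>. J k \<omega> \<bullet> \<xi> k \<omega>", OF _ ip]
    note m2 = increment_mult[OF ab, of "\<lambda>\<omega>. (norm (\<xi> k \<omega>))^2", OF _ bi(1)[OF k]]
    have e: "(\<lambda>\<omega>. (norm (J (Suc k) \<omega>))^2) = (\<lambda>\<omega>. (norm (J k \<omega>))^2 + 2 * ((J k \<omega> \<bullet> \<xi> k \<omega>) * (B b \<omega> - B a \<omega>))
      + (norm (\<xi> k \<omega>))^2 * (B b \<omega> - B a \<omega>)^2)"
      unfolding J norm_square_add_scaleR by auto
    have 2: "integrable M (\<lambda>\<omega>. (norm (J (Suc k) \<omega>))^2)"
      unfolding e using IH(2) m1(1) m2(3) by auto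
    have s: "integrable M (\<lambda>\<omega>. \<Sum>i<k. (min t (\<tau> (Suc i)) - min t (\<tau> i)) * (norm (\<xi> i \<omega>))^2)"
      using bi(1) k by auto
    have "expectation (\<lambda>\<omega>. (norm (J (Suc k) \<omega>))^2) = expectation (\<lambda>\<omega>. (norm (J k \<omega>))^2) + (b - a) * expectation (\<lambda>\<omega>. (norm (\<xi> k \<omega>))^2)"
      unfolding e using IH(2) m1(1,2) m2(3,4) by simp
    also have "\<dots> = expectation (\<lambda>\<omega>. \<Sum>i<Suc k. (min t (\<tau> (Suc i)) - min t (\<tau> i)) * (norm (\<xi> i \<omega>))^2)"
      using s bi(1)[OF k] unfolding IH(3) by (simp add: a_def b_def)
    finally show ?thesis using 1 2 b_def by auto
  qed
qed

end

text \<open>For passing to a common refinement \<open>P\<close> of two partitions: the increment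
  over a coarse interval is a sum over those fine intervals whose left end lies in it. An arbitrary
  \<open>\<Phi>\<close> allows the same identity for indicators and for Brownian paths.\<close>

lemma telescope_sorted:
  fixes \<Phi> :: "real \<Rightarrow> 'b::ab_group_add"
  assumes "finite P" "a \<in> P" "b \<in> P" "a \<le> b"
  defines "p \<equiv> (\<lambda>i. sorted_list_of_set P ! i)"
  shows "\<Phi> b - \<Phi> a = (\<Sum>i<card P - 1. if a \<le> p i \<and> p i < b then \<Phi> (p (Suc i)) - \<Phi> (p i) else 0)"
proof -
  let ?l = "sorted_list_of_set P"
  have len: "length ?l = card P" by simp
  have ls: "sorted_wrt (<) ?l" by (rule strict_sorted_list_of_set)
  have set: "set ?l = P" using assms(1) by simp
  obtain j where j: "j < card P" "p j = a" using assms(2) set len unfolding p_def in_set_conv_nth[symmetric]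
    by (metis in_set_conv_nth)
  obtain k where k: "k < card P" "p k = b" using assms(3) set len unfolding p_def in_set_conv_nth[symmetric]
    by (metis in_set_conv_nth)
  have lt: "p i < p i'" if "i < i'" "i' < card P" for i i'
    using sorted_wrt_nth_less[OF ls that(1)] that len by (simp add: p_def)
  have le: "p i \<le> p i' \<longleftrightarrow> i \<le> i'" if "i < card P" "i' < card P" for i i'
    using lt[of i i'] lt[of i' i] that by (metis leD leI less_or_eq_imp_le order_le_less)
  have jk: "j \<le> k" using le[of j k] j k assms(4) by simp
  have "(\<Sum>i<card P - 1. if a \<le> p i \<and> p i < b then \<Phi> (p (Suc i)) - \<Phi> (p i) else 0)
    = (\<Sum>i<card P - 1. if i \<in> {j..<k} then \<Phi> (p (Suc i)) - \<Phi> (p i) else 0)"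
  proof (rule sum.cong)
    fix i assume "i \<in> {..<card P - 1}"
    then have "i < card P" by auto
    then have "a \<le> p i \<and> p i < b \<longleftrightarrow> i \<in> {j..<k}" using le[of j i] le[of k i] j k by auto
    then show "(if a \<le> p i \<and> p i < b then \<Phi> (p (Suc i)) - \<Phi> (p i) else 0) = (if i \<in> {j..<k} then \<Phi> (p (Suc i)) - \<Phi> (p i) else 0)"
      by auto
  qed simp
  also have "\<dots> = (\<Sum>i\<in>{..<card P - 1} \<inter> {j..<k}. \<Phi> (p (Suc i)) - \<Phi> (p i))"
    by (rule sum.inter_restrict[symmetric]) simp
  also have "{..<card P - 1} \<inter> {j..<k} = {j..<k}" using k by auto
  also have "(\<Sum>i\<in>{j..<k}. \<Phi> (p (Suc i)) - \<Phi> (p i)) = \<Phi> (p k) - \<Phi> (p j)"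
    using sum_Suc_diff'[OF jk, of "\<lambda>i. \<Phi> (p i)"] by simp
  finally show ?thesis using j k by simp
qed

text \<open>The intervals are disjoint, so at each \<open>s\<close> at most one summand survives and
  no cross terms arise.\<close>

lemma norm_step_square:
  fixes \<tau> :: "nat \<Rightarrow> real" and x :: "nat \<Rightarrow> 'b::real_normed_vector"
  assumes "\<forall>i<m. \<tau> i \<le> \<tau> (Suc i)"
  shows "(norm (\<Sum>i<m. indicat_real {\<tau> i<..\<tau> (Suc i)} s *\<^sub>R x i))^2 =
    (\<Sum>i<m. indicat_real {\<tau> i<..\<tau> (Suc i)} s * (norm (x i))^2)"
  using assms
proof (induction m)
  case (Suc m)
  show ?case
  proof (cases "s \<in> {\<tau> m<..\<tau> (Suc m)}")
    case True
    have "indicat_real {\<tau> i<..\<tau> (Suc i)} s = 0" if "i < m" for i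
    proof -
      have "\<tau> (Suc i) \<le> \<tau> m" using partition_mono[of m "Suc m" \<tau> "Suc i"] Suc.prems that by auto
      then show ?thesis using True by auto
    qed
    then show ?thesis using True by simp
  next
    case False
    then show ?thesis using Suc by simp
  qed
qed simp

lemma nn_integral_step_square:
  fixes \<tau> :: "nat \<Rightarrow> real" and x :: "nat \<Rightarrow> 'b::euclidean_space"
  assumes "0 \<le> \<tau> 0" "0 \<le> t" "\<forall>i<m. \<tau> i \<le> \<tau> (Suc i)"
  shows "(path_moment 2 t (\<lambda>s. \<Sum>i<m. indicat_real {\<tau> i<..\<tau> (Suc i)} s *\<^sub>R x i))
    = ennreal (\<Sum>i<m. (min t (\<tau> (Suc i)) - min t (\<tau> i)) * (norm (x i))^2)"
proof -
  have t0: "0 \<le> \<tau> i" if "i \<le> m" for i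
    using partition_nonneg[of \<tau> m i] assms that by blast
  have w: "min t (\<tau> i) \<le> min t (\<tau> (Suc i))" if "i < m" for i using assms(3) that by (auto simp: min_def intro: order_trans)
  have "(path_moment 2 t (\<lambda>s. \<Sum>i<m. indicat_real {\<tau> i<..\<tau> (Suc i)} s *\<^sub>R x i))
    = (\<integral>\<^sup>+s. (\<Sum>i<m. ennreal ((norm (x i))^2) * indicator {min t (\<tau> i)<..min t (\<tau> (Suc i))} s) \<partial>lborel)"
  proof (rule nn_integral_cong)
    fix s :: real
    have *: "ennreal (indicat_real {\<tau> i<..\<tau> (Suc i)} s * (norm (x i))^2) * indicator {0..t} s =
      ennreal ((norm (x i))^2) * indicator {min t (\<tau> i)<..min t (\<tau> (Suc i))} s" if "i < m" for i
    proof -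
      have "s \<in> {\<tau> i<..\<tau> (Suc i)} \<and> s \<in> {0..t} \<longleftrightarrow> s \<in> {min t (\<tau> i)<..min t (\<tau> (Suc i))}"
        using t0[of i] that by auto
      then show ?thesis by (auto simp: indicator_def)
    qed
    have "ennreal ((norm (\<Sum>i<m. indicat_real {\<tau> i<..\<tau> (Suc i)} s *\<^sub>R x i))^2) * indicator {0..t} s
      = (\<Sum>i<m. ennreal (indicat_real {\<tau> i<..\<tau> (Suc i)} s * (norm (x i))^2)) * indicator {0..t} s"
      unfolding norm_step_square[OF assms(3)] by (subst sum_ennreal) auto
    also have "\<dots> = (\<Sum>i<m. ennreal ((norm (x i))^2) * indicator {min t (\<tau> i)<..min t (\<tau> (Suc i))} s)"
      unfolding sum_distrib_right by (rule sum.cong) (use * in auto)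
    finally show "ennreal ((norm (\<Sum>i<m. indicat_real {\<tau> i<..\<tau> (Suc i)} s *\<^sub>R x i))^2) * indicator {0..t} s
      = (\<Sum>i<m. ennreal ((norm (x i))^2) * indicator {min t (\<tau> i)<..min t (\<tau> (Suc i))} s)" .
  qed
  also have "\<dots> = (\<Sum>i<m. ennreal ((norm (x i))^2) * ennreal (min t (\<tau> (Suc i)) - min t (\<tau> i)))"
    by (subst nn_integral_sum) (use w in \<open>auto simp: nn_integral_cmult_indicator intro!: sum.cong\<close>)
  also have "\<dots> = (\<Sum>i<m. ennreal ((min t (\<tau> (Suc i)) - min t (\<tau> i)) * (norm (x i))^2))"
    by (rule sum.cong) (use w in \<open>auto simp: ennreal_mult' mult.commute\<close>)
  also have "\<dots> = ennreal (\<Sum>i<m. (min t (\<tau> (Suc i)) - min t (\<tau> i)) * (norm (x i))^2)"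
    by (rule sum_ennreal) (use w in auto)
  finally show ?thesis .
qed

section \<open>Isometry, tail bound and differences of elementary integrals\<close>

context brownian_motion
begin

lemma simple_ito_isometry:
  fixes R :: "real \<Rightarrow> 'a \<Rightarrow> 'b::euclidean_space"
  assumes "0 \<le> t" "simple_ito_integral M F B t R J"
  shows "J \<in> borel_measurable M" "integrable M (\<lambda>\<omega>. (norm (J \<omega>))^2)"
    "(\<integral>\<^sup>+\<omega>. ennreal ((norm (J \<omega>))^2) \<partial>M) = (\<integral>\<^sup>+\<omega>. (path_moment 2 t (\<lambda>s. R s \<omega>)) \<partial>M)"
proof -
  obtain m :: nat and \<tau> :: "nat \<Rightarrow> real" and \<xi> :: "nat \<Rightarrow> 'a \<Rightarrow> 'b" where
    p: "0 \<le> \<tau> 0" "\<forall>i<m. \<tau> i \<le> \<tau> (Suc i)" "\<forall>i<m. \<xi> i \<in> borel_measurable (F (\<tau> i))"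
      "\<forall>i<m. \<exists>C. \<forall>\<omega>\<in>space M. norm (\<xi> i \<omega>) \<le> C"
    and R: "R = (\<lambda>s \<omega>. \<Sum>i<m. indicat_real {\<tau> i<..\<tau> (Suc i)} s *\<^sub>R \<xi> i \<omega>)"
    and J: "J = (\<lambda>\<omega>. \<Sum>i<m. (B (min t (\<tau> (Suc i))) \<omega> - B (min t (\<tau> i)) \<omega>) *\<^sub>R \<xi> i \<omega>)"
    using assms(2) unfolding simple_ito_integral_def by blast
  note I = simple_isometry[OF assms(1) p order_refl]
  show "J \<in> borel_measurable M" "integrable M (\<lambda>\<omega>. (norm (J \<omega>))^2)" using conjunct1[OF I] conjunct1[OF conjunct2[OF I]] F_imp_M unfolding J by blast+
  have w: "min t (\<tau> i) \<le> min t (\<tau> (Suc i))" if "i < m" for i using p(2) that by (auto simp: min_def intro: order_trans)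
  have i: "integrable M (\<lambda>\<omega>. \<Sum>i<m. (min t (\<tau> (Suc i)) - min t (\<tau> i)) * (norm (\<xi> i \<omega>))^2)"
  proof (intro Bochner_Integration.integrable_sum integrable_mult_right)
    fix i assume i: "i \<in> {..<m}"
    have [measurable]: "\<xi> i \<in> borel_measurable M" using p(3) i F_imp_M by auto
    obtain C where "\<forall>\<omega>\<in>space M. norm (\<xi> i \<omega>) \<le> C" using p(4) i by blast
    then show "integrable M (\<lambda>\<omega>. (norm (\<xi> i \<omega>))^2)"
      by (intro integrable_const_bound[where B="C^2"]) (auto intro!: AE_I2 power_mono)
  qed
  show "(\<integral>\<^sup>+\<omega>. ennreal ((norm (J \<omega>))^2) \<partial>M) = (\<integral>\<^sup>+\<omega>. (path_moment 2 t (\<lambda>s. R s \<omega>)) \<partial>M)"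
    unfolding R nn_integral_step_square[OF p(1) assms(1) p(2)] J
    by (subst nn_integral_eq_integral[OF conjunct1[OF conjunct2[OF I]]], simp, subst nn_integral_eq_integral[OF i])
      (use I w in \<open>auto intro!: AE_I2 sum_nonneg\<close>)
qed

text \<open>Convergence in probability gives no control of the mean of the square integral of
  \<open>R\<close>. Therefore the coefficients are set to 0 as soon as the accumulated square
  integral exceeds \<open>N\<close>. The truncated process is still simple, by the isometry its
  integral has second moment at most \<open>N\<close>, and on the event considered nothing has been
  removed, so Chebyshev applies.\<close>

lemma simple_ito_truncated_Markov:
  fixes R :: "real \<Rightarrow> 'a \<Rightarrow> 'b::euclidean_space"
  assumes "0 \<le> t" "simple_ito_integral M F B t R J" "0 < \<eta>" "0 \<le> N"
  shows "measure M {\<omega>\<in>space M. \<eta> < norm (J \<omega>) \<and> (path_moment 2 t (\<lambda>s. R s \<omega>)) \<le> ennreal N} \<le> N / \<eta>^2"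
proof -
  obtain m :: nat and \<tau> :: "nat \<Rightarrow> real" and \<xi> :: "nat \<Rightarrow> 'a \<Rightarrow> 'b" where
    p: "0 \<le> \<tau> 0" "\<forall>i<m. \<tau> i \<le> \<tau> (Suc i)" "\<forall>i<m. \<xi> i \<in> borel_measurable (F (\<tau> i))"
      "\<forall>i<m. \<exists>C. \<forall>\<omega>\<in>space M. norm (\<xi> i \<omega>) \<le> C"
    and R: "R = (\<lambda>s \<omega>. \<Sum>i<m. indicat_real {\<tau> i<..\<tau> (Suc i)} s *\<^sub>R \<xi> i \<omega>)"
    and J: "J = (\<lambda>\<omega>. \<Sum>i<m. (B (min t (\<tau> (Suc i))) \<omega> - B (min t (\<tau> i)) \<omega>) *\<^sub>R \<xi> i \<omega>)"
    using assms(2) unfolding simple_ito_integral_def by blast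
  define w where "w i = min t (\<tau> (Suc i)) - min t (\<tau> i)" for i
  have w: "0 \<le> w i" if "i < m" for i using p(2) that by (auto simp: w_def min_def intro: order_trans)
  \<comment> \<open>The sum includes the term \<open>i\<close> itself. It is known at time
    \<open>\<tau> i\<close>, so the truncation is adapted, and the bound \<open>N\<close> is never
    overshot by the last term kept.\<close>
  define q where "q i \<omega> \<longleftrightarrow> (\<Sum>j\<le>i. w j * (norm (\<xi> j \<omega>))^2) \<le> N" for i \<omega>
  define \<zeta> where "\<zeta> i \<omega> = (if q i \<omega> then \<xi> i \<omega> else 0)" for i \<omega>
  have z1: "\<forall>i<m. \<zeta> i \<in> borel_measurable (F (\<tau> i))"
  proof (intro allI impI)
    fix i assume i: "i < m"
    have [measurable]: "\<xi> j \<in> borel_measurable (F (\<tau> i))" if "j \<le> i" for j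
      by (rule F_mono[of _ "\<tau> j"]) (use p(3) i that partition_mono[OF i p(2)] in auto)
    show "\<zeta> i \<in> borel_measurable (F (\<tau> i))" unfolding \<zeta>_def q_def by measurable
  qed
  have z2: "\<forall>i<m. \<exists>C. \<forall>\<omega>\<in>space M. norm (\<zeta> i \<omega>) \<le> C"
  proof (intro allI impI)
    fix i assume i: "i < m"
    then obtain C where "\<forall>\<omega>\<in>space M. norm (\<xi> i \<omega>) \<le> C" using p(4) by blast
    then have "\<forall>\<omega>\<in>space M. norm (\<zeta> i \<omega>) \<le> max C 0" by (auto simp: \<zeta>_def)
    then show "\<exists>C. \<forall>\<omega>\<in>space M. norm (\<zeta> i \<omega>) \<le> C" by blast
  qed
  define J' where "J' \<omega> = (\<Sum>i<m. (B (min t (\<tau> (Suc i))) \<omega> - B (min t (\<tau> i)) \<omega>) *\<^sub>R \<zeta> i \<omega>)" for \<omega>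
  \<comment> \<open>If the last term is kept, even the untruncated sum up to it is at most
    \<open>N\<close>; if it is removed, the sum does not grow.\<close>
  have bound: "(\<Sum>i<k. w i * (norm (\<zeta> i \<omega>))^2) \<le> N" if "k \<le> m" for k \<omega>
    using that
  proof (induction k)
    case (Suc k)
    show ?case
    proof (cases "q k \<omega>")
      case True
      have "(\<Sum>i<Suc k. w i * (norm (\<zeta> i \<omega>))^2) \<le> (\<Sum>j\<le>k. w j * (norm (\<xi> j \<omega>))^2)"
        unfolding lessThan_Suc_atMost
        by (rule sum_mono) (use w Suc.prems in \<open>auto simp: \<zeta>_def\<close>)
      then show ?thesis using True by (simp add: q_def)
    next
      case False
      then show ?thesis using Suc by (simp add: \<zeta>_def)
    qed
  qed (use assms in simp)
  note I = simple_isometry[OF assms(1) p(1,2) z1 z2 order_refl]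
  have J'm [measurable]: "J' \<in> borel_measurable M" and J'i: "integrable M (\<lambda>\<omega>. (norm (J' \<omega>))^2)"
    using I F_imp_M unfolding J'_def by blast+
  have E: "expectation (\<lambda>\<omega>. (norm (J' \<omega>))^2) \<le> N"
  proof -
    have "expectation (\<lambda>\<omega>. (norm (J' \<omega>))^2) = expectation (\<lambda>\<omega>. \<Sum>i<m. w i * (norm (\<zeta> i \<omega>))^2)"
      using I unfolding J'_def w_def by blast
    also have "\<dots> \<le> N"
    proof (rule integral_le_const)
      have [measurable]: "\<zeta> i \<in> borel_measurable M" if "i < m" for i using z1 that F_imp_M by auto
      have "norm (\<Sum>i<m. w i * (norm (\<zeta> i \<omega>))^2) \<le> N" for \<omega>
        using bound[of m \<omega>] sum_nonneg[of "{..<m}" "\<lambda>i. w i * (norm (\<zeta> i \<omega>))^2"] w by simp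
      then show "integrable M (\<lambda>\<omega>. \<Sum>i<m. w i * (norm (\<zeta> i \<omega>))^2)"
        by (intro integrable_const_bound[where B=N] AE_I2) auto
      show "AE \<omega> in M. (\<Sum>i<m. w i * (norm (\<zeta> i \<omega>))^2) \<le> N" using bound[of m] by auto
    qed
    finally show ?thesis .
  qed
  have sub: "{\<omega>\<in>space M. \<eta> < norm (J \<omega>) \<and> (path_moment 2 t (\<lambda>s. R s \<omega>)) \<le> ennreal N}
    \<subseteq> {\<omega>\<in>space M. \<eta>^2 \<le> (norm (J' \<omega>))^2}"
  proof safe
    fix \<omega> assume \<omega>: "\<omega> \<in> space M" "\<eta> < norm (J \<omega>)" "(path_moment 2 t (\<lambda>s. R s \<omega>)) \<le> ennreal N"
    have le: "(\<Sum>i<m. w i * (norm (\<xi> i \<omega>))^2) \<le> N"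
      using \<omega>(3) assms(4) unfolding R nn_integral_step_square[OF p(1) assms(1) p(2)] w_def by simp
    have "q i \<omega>" if "i < m" for i
      unfolding q_def by (rule order_trans[OF sum_mono2 le]) (use that w in auto)
    then have "J' \<omega> = J \<omega>" unfolding J'_def J by (intro sum.cong) (auto simp: \<zeta>_def)
    then show "\<eta>^2 \<le> (norm (J' \<omega>))^2" using \<omega>(2) assms(3) by (intro power_mono) auto
  qed
  have "measure M {\<omega>\<in>space M. \<eta> < norm (J \<omega>) \<and> (path_moment 2 t (\<lambda>s. R s \<omega>)) \<le> ennreal N}
    \<le> measure M {\<omega>\<in>space M. \<eta>^2 \<le> (norm (J' \<omega>))^2}"
    by (rule finite_measure_mono[OF sub]) measurable
  also have "\<dots> \<le> expectation (\<lambda>\<omega>. (norm (J' \<omega>))^2) / \<eta>^2"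
    by (rule integral_Markov_inequality_measure[OF J'i, where A="{}"]) (use assms in auto)
  also have "\<dots> \<le> N / \<eta>^2" using E by (intro divide_right_mono) auto
  finally show ?thesis .
qed

text \<open>Both processes are rewritten on the union \<open>P\<close> of their partition points. On
  a fine interval the coefficient is the difference of the two coarse coefficients in force at its
  left end, and these are known there.\<close>

lemma simple_ito_diff:
  fixes R R' :: "real \<Rightarrow> 'a \<Rightarrow> 'b::euclidean_space"
  assumes "0 \<le> t" "simple_ito_integral M F B t R J" "simple_ito_integral M F B t R' J'"
  shows "simple_ito_integral M F B t (\<lambda>s \<omega>. R s \<omega> - R' s \<omega>) (\<lambda>\<omega>. J \<omega> - J' \<omega>)"
proof -
  obtain m :: nat and \<tau> :: "nat \<Rightarrow> real" and \<xi> :: "nat \<Rightarrow> 'a \<Rightarrow> 'b" where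
    p: "0 \<le> \<tau> 0" "\<forall>i<m. \<tau> i \<le> \<tau> (Suc i)" "\<forall>i<m. \<xi> i \<in> borel_measurable (F (\<tau> i))"
      "\<forall>i<m. \<exists>C. \<forall>\<omega>\<in>space M. norm (\<xi> i \<omega>) \<le> C"
    and R: "R = (\<lambda>s \<omega>. \<Sum>i<m. indicat_real {\<tau> i<..\<tau> (Suc i)} s *\<^sub>R \<xi> i \<omega>)"
    and J: "J = (\<lambda>\<omega>. \<Sum>i<m. (B (min t (\<tau> (Suc i))) \<omega> - B (min t (\<tau> i)) \<omega>) *\<^sub>R \<xi> i \<omega>)"
    using assms(2) unfolding simple_ito_integral_def by blast
  obtain m' :: nat and \<tau>' :: "nat \<Rightarrow> real" and \<xi>' :: "nat \<Rightarrow> 'a \<Rightarrow> 'b" where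
    p': "0 \<le> \<tau>' 0" "\<forall>i<m'. \<tau>' i \<le> \<tau>' (Suc i)" "\<forall>i<m'. \<xi>' i \<in> borel_measurable (F (\<tau>' i))"
      "\<forall>i<m'. \<exists>C. \<forall>\<omega>\<in>space M. norm (\<xi>' i \<omega>) \<le> C"
    and R': "R' = (\<lambda>s \<omega>. \<Sum>i<m'. indicat_real {\<tau>' i<..\<tau>' (Suc i)} s *\<^sub>R \<xi>' i \<omega>)"
    and J': "J' = (\<lambda>\<omega>. \<Sum>i<m'. (B (min t (\<tau>' (Suc i))) \<omega> - B (min t (\<tau>' i)) \<omega>) *\<^sub>R \<xi>' i \<omega>)"
    using assms(3) unfolding simple_ito_integral_def by blast
  define P where "P = \<tau> ` {..m} \<union> \<tau>' ` {..m'}"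
  have fP: "finite P" and neP: "P \<noteq> {}" by (auto simp: P_def)
  define p0 where "p0 i = sorted_list_of_set P ! i" for i
  define n where "n = card P - 1"
  have len: "length (sorted_list_of_set P) = card P" by simp
  have n: "n < card P" using fP neP by (simp add: n_def card_gt_0_iff)
  have p0_le: "p0 i \<le> p0 (Suc i)" if "i < n" for i
    using sorted_nth_mono[OF sorted_sorted_list_of_set[of P], of i "Suc i"] that len by (simp add: p0_def n_def)
  have t0: "0 \<le> \<tau> i" if "i \<le> m" for i using partition_nonneg[OF p(1,2) that] .
  have t0': "0 \<le> \<tau>' i" if "i \<le> m'" for i using partition_nonneg[OF p'(1,2) that] .
  have p0_0: "0 \<le> p0 0"
  proof -
    have "p0 0 \<in> P" using nth_mem[of 0 "sorted_list_of_set P"] n fP by (simp add: p0_def)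
    then show ?thesis using t0 t0' by (auto simp: P_def)
  qed
  define \<sigma> where "\<sigma> i j \<longleftrightarrow> \<tau> j \<le> p0 i \<and> p0 i < \<tau> (Suc j)" for i j
  define \<sigma>' where "\<sigma>' i j \<longleftrightarrow> \<tau>' j \<le> p0 i \<and> p0 i < \<tau>' (Suc j)" for i j
  define \<zeta> where "\<zeta> i \<omega> = (\<Sum>j<m. if \<sigma> i j then \<xi> j \<omega> else 0) - (\<Sum>j<m'. if \<sigma>' i j then \<xi>' j \<omega> else 0)" for i \<omega>
  \<comment> \<open>One identity, used twice: \<open>\<Phi> x = of_bool (s \<le> x)\<close> turns
    increments into indicators of left-open intervals and gives the processes at time
    \<open>s\<close>, while \<open>\<Phi> x = B (min t x) \<omega>\<close> gives the
    integrals.\<close>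
  have key: "(\<Sum>j<m. (\<Phi> (\<tau> (Suc j)) - \<Phi> (\<tau> j)) *\<^sub>R \<xi> j \<omega>) - (\<Sum>j<m'. (\<Phi> (\<tau>' (Suc j)) - \<Phi> (\<tau>' j)) *\<^sub>R \<xi>' j \<omega>)
      = (\<Sum>i<n. (\<Phi> (p0 (Suc i)) - \<Phi> (p0 i)) *\<^sub>R \<zeta> i \<omega>)" for \<Phi> :: "real \<Rightarrow> real" and \<omega>
  proof -
    have 1: "(\<Phi> (\<tau> (Suc j)) - \<Phi> (\<tau> j)) = (\<Sum>i<n. if \<sigma> i j then \<Phi> (p0 (Suc i)) - \<Phi> (p0 i) else 0)" if "j < m" for j
      unfolding n_def \<sigma>_def p0_def
      by (rule telescope_sorted[OF fP]) (use that p(2) in \<open>auto simp: P_def\<close>)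
    have 2: "(\<Phi> (\<tau>' (Suc j)) - \<Phi> (\<tau>' j)) = (\<Sum>i<n. if \<sigma>' i j then \<Phi> (p0 (Suc i)) - \<Phi> (p0 i) else 0)" if "j < m'" for j
      unfolding n_def \<sigma>'_def p0_def
      by (rule telescope_sorted[OF fP]) (use that p'(2) in \<open>auto simp: P_def\<close>)
    have 3: "(\<Sum>j<m. (\<Phi> (\<tau> (Suc j)) - \<Phi> (\<tau> j)) *\<^sub>R \<xi> j \<omega>) = (\<Sum>j<m. \<Sum>i<n. (\<Phi> (p0 (Suc i)) - \<Phi> (p0 i)) *\<^sub>R (if \<sigma> i j then \<xi> j \<omega> else 0))"
      by (rule sum.cong) (auto simp: 1 scaleR_sum_left intro!: sum.cong)
    have 4: "(\<Sum>j<m'. (\<Phi> (\<tau>' (Suc j)) - \<Phi> (\<tau>' j)) *\<^sub>R \<xi>' j \<omega>) = (\<Sum>j<m'. \<Sum>i<n. (\<Phi> (p0 (Suc i)) - \<Phi> (p0 i)) *\<^sub>R (if \<sigma>' i j then \<xi>' j \<omega> else 0))"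
      by (rule sum.cong) (auto simp: 2 scaleR_sum_left intro!: sum.cong)
    show ?thesis unfolding 3 4 \<zeta>_def scaleR_diff_right scaleR_sum_right sum_subtractf
      by (subst (1 2) sum.swap) simp
  qed
  have ind: "indicat_real {a<..b} s = of_bool (s \<le> b) - of_bool (s \<le> a)" if "a \<le> b" for a b s :: real
    using that by (auto simp: indicator_def)
  have z1: "\<forall>i<n. \<zeta> i \<in> borel_measurable (F (p0 i))"
  proof (intro allI impI)
    fix i assume i: "i < n"
    have "(\<lambda>\<omega>. if \<sigma> i j then \<xi> j \<omega> else 0) \<in> borel_measurable (F (p0 i))" if "j < m" for j
      using F_mono[of "\<xi> j" "\<tau> j" "p0 i"] p(3) that by (cases "\<sigma> i j") (auto simp: \<sigma>_def)
    moreover have "(\<lambda>\<omega>. if \<sigma>' i j then \<xi>' j \<omega> else 0) \<in> borel_measurable (F (p0 i))" if "j < m'" for j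
      using F_mono[of "\<xi>' j" "\<tau>' j" "p0 i"] p'(3) that by (cases "\<sigma>' i j") (auto simp: \<sigma>'_def)
    ultimately show "\<zeta> i \<in> borel_measurable (F (p0 i))" unfolding \<zeta>_def
      by (intro borel_measurable_diff borel_measurable_sum) auto
  qed
  obtain C where C: "\<And>j \<omega>. j < m \<Longrightarrow> \<omega> \<in> space M \<Longrightarrow> norm (\<xi> j \<omega>) \<le> C j" using p(4) by metis
  obtain C' where C': "\<And>j \<omega>. j < m' \<Longrightarrow> \<omega> \<in> space M \<Longrightarrow> norm (\<xi>' j \<omega>) \<le> C' j" using p'(4) by metis
  have z2: "\<forall>i<n. \<exists>C. \<forall>\<omega>\<in>space M. norm (\<zeta> i \<omega>) \<le> C"
  proof (intro allI impI exI ballI)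
    fix i \<omega> assume "\<omega> \<in> space M"
    then have "norm (\<Sum>j<m. if \<sigma> i j then \<xi> j \<omega> else 0) \<le> (\<Sum>j<m. \<bar>C j\<bar>)"
      "norm (\<Sum>j<m'. if \<sigma>' i j then \<xi>' j \<omega> else 0) \<le> (\<Sum>j<m'. \<bar>C' j\<bar>)"
      by (auto intro!: sum_norm_le order_trans[OF C abs_ge_self] order_trans[OF C' abs_ge_self])
    then show "norm (\<zeta> i \<omega>) \<le> (\<Sum>j<m. \<bar>C j\<bar>) + (\<Sum>j<m'. \<bar>C' j\<bar>)"
      unfolding \<zeta>_def by (intro norm_triangle_le_diff) auto
  qed
  have "(\<lambda>s \<omega>. R s \<omega> - R' s \<omega>) = (\<lambda>s \<omega>. \<Sum>i<n. indicat_real {p0 i<..p0 (Suc i)} s *\<^sub>R \<zeta> i \<omega>)"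
  proof (intro ext)
    fix s \<omega>
    show "R s \<omega> - R' s \<omega> = (\<Sum>i<n. indicat_real {p0 i<..p0 (Suc i)} s *\<^sub>R \<zeta> i \<omega>)"
      using key[of "\<lambda>x. of_bool (s \<le> x)" \<omega>] p(2) p'(2) p0_le by (simp add: R R' ind cong: sum.cong_simp)
  qed
  moreover have "(\<lambda>\<omega>. J \<omega> - J' \<omega>) = (\<lambda>\<omega>. \<Sum>i<n. (B (min t (p0 (Suc i))) \<omega> - B (min t (p0 i)) \<omega>) *\<^sub>R \<zeta> i \<omega>)"
  proof
    fix \<omega> show "J \<omega> - J' \<omega> = (\<Sum>i<n. (B (min t (p0 (Suc i))) \<omega> - B (min t (p0 i)) \<omega>) *\<^sub>R \<zeta> i \<omega>)"
      using key[of "\<lambda>x. B (min t x) \<omega>" \<omega>] by (simp add: J J')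
  qed
  ultimately show ?thesis unfolding simple_ito_integral_def using p0_0 p0_le z1 z2 by blast
qed

end

section \<open>Grid approximation of left continuous processes\<close>

definition grid_point :: "real \<Rightarrow> nat \<Rightarrow> nat \<Rightarrow> real" where
  "grid_point t m i = t * real i / real m"

text \<open>Values from the left end on left-open cells make this a simple process whenever
  \<open>h\<close> is adapted and bounded. The step process is 0 at time 0, even if
  \<open>h 0\<close> is not.\<close>

definition grid_step :: "real \<Rightarrow> nat \<Rightarrow> (real \<Rightarrow> 'a \<Rightarrow> 'b::real_normed_vector) \<Rightarrow> real \<Rightarrow> 'a \<Rightarrow> 'b" where
  "grid_step t m h s \<omega> = (\<Sum>i<m. indicat_real {grid_point t m i<..grid_point t m (Suc i)} s *\<^sub>R h (grid_point t m i) \<omega>)"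

text \<open>Enough for step processes with left end values to converge pointwise on
  \<open>{0<..t}\<close>; continuity would exclude processes that jump to 0 at an exit time.\<close>

definition left_continuous :: "real \<Rightarrow> (real \<Rightarrow> 'b::topological_space) \<Rightarrow> bool" where
  "left_continuous t h \<longleftrightarrow> (\<forall>s\<in>{0<..t}. (h \<longlongrightarrow> h s) (at_left s))"

lemma grid_point_0 [simp]: "grid_point t m 0 = 0"
  by (simp add: grid_point_def)

lemma grid_point_self [simp]: "0 < m \<Longrightarrow> grid_point t m m = t"
  by (simp add: grid_point_def)

lemma grid_point_mono: "0 \<le> t \<Longrightarrow> i \<le> j \<Longrightarrow> grid_point t m i \<le> grid_point t m j"
  by (simp add: grid_point_def divide_right_mono mult_left_mono)

lemma grid_point_nonneg: "0 \<le> t \<Longrightarrow> 0 \<le> grid_point t m i"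
  by (simp add: grid_point_def)

lemma grid_point_le: "0 \<le> t \<Longrightarrow> i \<le> m \<Longrightarrow> grid_point t m i \<le> t"
  by (cases "m = 0") (auto simp: grid_point_def divide_simps intro: mult_left_mono)

lemma grid_point_Suc: "grid_point t m (Suc i) = grid_point t m i + t / m"
  by (simp add: grid_point_def add_divide_distrib algebra_simps)

lemma grid_step_0: "0 \<le> t \<Longrightarrow> s \<le> 0 \<Longrightarrow> grid_step t m h s \<omega> = 0"
  unfolding grid_step_def by (intro sum.neutral) (use grid_point_nonneg[of t m] in \<open>auto simp: indicator_def not_less intro: order_trans\<close>)

lemma grid_step_eq:
  assumes "0 \<le> t" "i < m" "s \<in> {grid_point t m i<..grid_point t m (Suc i)}"
  shows "grid_step t m h s \<omega> = h (grid_point t m i) \<omega>"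
proof -
  have "indicat_real {grid_point t m j<..grid_point t m (Suc j)} s *\<^sub>R h (grid_point t m j) \<omega> = 0" if "j \<noteq> i" for j
  proof -
    have "Suc j \<le> i \<or> Suc i \<le> j" using that by auto
    then have "s \<notin> {grid_point t m j<..grid_point t m (Suc j)}"
      using grid_point_mono[OF assms(1), of "Suc j" i m] grid_point_mono[OF assms(1), of "Suc i" j m] assms(3) by auto
    then show ?thesis by simp
  qed
  then have "grid_step t m h s \<omega> = (\<Sum>j\<in>{i}. indicat_real {grid_point t m j<..grid_point t m (Suc j)} s *\<^sub>R h (grid_point t m j) \<omega>)"
    unfolding grid_step_def using assms(2) by (intro sum.mono_neutral_right) auto
  also have "\<dots> = indicat_real {grid_point t m i<..grid_point t m (Suc i)} s *\<^sub>R h (grid_point t m i) \<omega>"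
  proof -
    have "sum g {i} = g i" for g :: "nat \<Rightarrow> 'c::comm_monoid_add" by simp
    then show ?thesis .
  qed
  finally show ?thesis using assms(3) by simp
qed

lemma grid_locate:
  assumes "0 < s" "s \<le> t" "0 < m"
  obtains i where "i < m" "s \<in> {grid_point t m i<..grid_point t m (Suc i)}"
proof -
  define x where "x = s * m / t"
  have x: "0 < x" "x \<le> m" using assms by (auto simp: x_def divide_simps)
  \<comment> \<open>The ceiling minus 1, not the floor, because the cells are left-open: a grid
    point belongs to the cell on its left.\<close>
  define i where "i = nat (\<lceil>x\<rceil> - 1)"
  have c: "1 \<le> \<lceil>x\<rceil>" "\<lceil>x\<rceil> \<le> int m" using x by (auto simp: ceiling_le_iff)
  have i: "real i = of_int \<lceil>x\<rceil> - 1" using c by (simp add: i_def)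
  have ix: "real i < x" "x \<le> real i + 1" unfolding i by linarith+
  have "i < m" using c assms(3) unfolding i_def by linarith
  moreover have "s = t * x / m" using assms by (simp add: x_def)
  ultimately show ?thesis using ix assms
    by (intro that[of i]) (auto simp: grid_point_def divide_simps mult.commute[of t] intro: mult_strict_right_mono mult_right_mono)
qed

lemma grid_step_norm_le:
  assumes "0 \<le> t" "s \<in> {0..t}" "\<And>r. r \<in> {0..t} \<Longrightarrow> norm (h r \<omega>) \<le> K" "0 \<le> K"
  shows "norm (grid_step t m h s \<omega>) \<le> K"
proof (cases "s = 0 \<or> m = 0")
  case True
  then show ?thesis using grid_step_0[of t s m h \<omega>] assms by (auto simp: grid_step_def)
next
  case False
  then obtain i where i: "i < m" "s \<in> {grid_point t m i<..grid_point t m (Suc i)}"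
    using grid_locate[of s t m] assms by auto
  show ?thesis using grid_step_eq[OF assms(1) i, of h \<omega>] assms(3)[of "grid_point t m i"]
      grid_point_nonneg[OF assms(1), of m i] grid_point_le[OF assms(1), of i m] i(1) by auto
qed

text \<open>The left end of the cell containing \<open>s\<close> lies strictly below
  \<open>s\<close> and within one mesh width, so it tends to \<open>s\<close> along
  \<open>at_left s\<close>.\<close>

lemma grid_step_tendsto:
  assumes "0 \<le> t" "s \<in> {0<..t}" "left_continuous t (\<lambda>r. h r \<omega>)"
  shows "(\<lambda>m. grid_step t (Suc m) h s \<omega>) \<longlonglongrightarrow> h s \<omega>"
proof -
  have "\<forall>m. \<exists>i. i < Suc m \<and> s \<in> {grid_point t (Suc m) i<..grid_point t (Suc m) (Suc i)}"
    using grid_locate[of s t "Suc _"] assms by (metis greaterThanAtMost_iff zero_less_Suc)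
  then obtain i where i: "\<And>m. i m < Suc m" "\<And>m. s \<in> {grid_point t (Suc m) (i m)<..grid_point t (Suc m) (Suc (i m))}"
    by metis
  have eq: "grid_step t (Suc m) h s \<omega> = h (grid_point t (Suc m) (i m)) \<omega>" for m
    by (rule grid_step_eq[OF assms(1) i])
  have lo: "s - t / Suc m \<le> grid_point t (Suc m) (i m)" "grid_point t (Suc m) (i m) < s" for m
    using i(2)[of m] by (auto simp: grid_point_Suc)
  have "(\<lambda>m. t * inverse (real (Suc m))) \<longlonglongrightarrow> t * 0" by (intro tendsto_mult tendsto_const LIMSEQ_inverse_real_of_nat)
  then have "(\<lambda>m. s - t / Suc m) \<longlonglongrightarrow> s - 0" by (intro tendsto_diff tendsto_const) (simp add: divide_inverse)
  then have "(\<lambda>m. grid_point t (Suc m) (i m)) \<longlonglongrightarrow> s"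
    using tendsto_sandwich[of "\<lambda>m. s - t / Suc m" "\<lambda>m. grid_point t (Suc m) (i m)" sequentially "\<lambda>_. s" s]
      lo(1) less_imp_le[OF lo(2)] by simp
  then have "filterlim (\<lambda>m. grid_point t (Suc m) (i m)) (at_left s) sequentially"
    unfolding filterlim_at using lo(2) by (auto intro!: eventuallyI simp: less_imp_neq)
  moreover have "((\<lambda>r. h r \<omega>) \<longlongrightarrow> h s \<omega>) (at_left s)" using assms by (auto simp: left_continuous_def)
  ultimately show ?thesis unfolding eq using filterlim_compose by blast
qed

section \<open>Joint measurability and mean convergence of the step approximation\<close>

lemma grid_step_measurable:
  fixes h :: "real \<Rightarrow> 'a \<Rightarrow> 'b::euclidean_space"
  assumes "0 \<le> t" "\<And>s. s \<in> {0..t} \<Longrightarrow> h s \<in> borel_measurable N"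
  shows "(\<lambda>(\<omega>, s). grid_step t m h s \<omega>) \<in> borel_measurable (N \<Otimes>\<^sub>M lborel)"
proof -
  have [measurable]: "h (grid_point t m i) \<in> borel_measurable N" if "i < m" for i
    using that assms grid_point_nonneg[of t m i] grid_point_le[of t i m] by auto
  show ?thesis unfolding grid_step_def split_beta' by measurable
qed

lemma left_continuous_measurable:
  fixes h :: "real \<Rightarrow> 'a \<Rightarrow> 'b::euclidean_space"
  assumes "0 \<le> t" "\<And>s. s \<in> {0..t} \<Longrightarrow> h s \<in> borel_measurable N"
    "\<And>\<omega>. \<omega> \<in> space N \<Longrightarrow> left_continuous t (\<lambda>s. h s \<omega>)"
  shows "(\<lambda>(\<omega>, s). indicat_real {0..t} s *\<^sub>R h s \<omega>) \<in> borel_measurable (N \<Otimes>\<^sub>M lborel)"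
proof (rule borel_measurable_LIMSEQ_metric)
  fix m
  have [measurable]: "h 0 \<in> borel_measurable N" using assms by auto
  note [measurable] = grid_step_measurable[OF assms(1,2)]
  \<comment> \<open>The second summand restores the value at \<open>s = 0\<close>, where the step
    process is 0, so that the limit holds at every point and not only almost everywhere.\<close>
  show "(\<lambda>(\<omega>, s). indicat_real {0..t} s *\<^sub>R grid_step t (Suc m) h s \<omega> + indicat_real {0} s *\<^sub>R h 0 \<omega>)
    \<in> borel_measurable (N \<Otimes>\<^sub>M lborel)" by measurable
next
  fix x :: "'a \<times> real" assume x: "x \<in> space (N \<Otimes>\<^sub>M lborel)"
  obtain \<omega> s where xs: "x = (\<omega>, s)" by force
  have \<omega>: "\<omega> \<in> space N" using x xs by (auto simp: space_pair_measure)
  consider "s = 0" | "s \<in> {0<..t}" | "s \<notin> {0..t}" by fastforce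
  then show "(\<lambda>m. case x of (\<omega>, s) \<Rightarrow> indicat_real {0..t} s *\<^sub>R grid_step t (Suc m) h s \<omega> + indicat_real {0} s *\<^sub>R h 0 \<omega>)
     \<longlonglongrightarrow> (case x of (\<omega>, s) \<Rightarrow> indicat_real {0..t} s *\<^sub>R h s \<omega>)"
  proof cases
    case 1 then show ?thesis using assms(1) by (simp add: xs grid_step_0)
  next
    case 2 then show ?thesis using grid_step_tendsto[of t s h \<omega>] assms \<omega> by (simp add: xs)
  next
    case 3 then show ?thesis using assms(1) by (auto simp: xs)
  qed
qed

lemma set_nn_integral_measurable:
  fixes f g :: "real \<Rightarrow> 'a \<Rightarrow> 'b::euclidean_space"
  assumes [measurable]: "(\<lambda>(\<omega>, s). indicat_real {0..t} s *\<^sub>R f s \<omega>) \<in> borel_measurable (N \<Otimes>\<^sub>M lborel)"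
  shows "(\<lambda>(\<omega>, s). ennreal ((norm (f s \<omega>))^k) * indicator {0..t} s) \<in> borel_measurable (N \<Otimes>\<^sub>M lborel)"
proof -
  have "(\<lambda>(\<omega>, s). ennreal ((norm (f s \<omega>))^k) * indicator {0..t} s) =
     (\<lambda>(\<omega>, s). ennreal ((norm (indicat_real {0..t} s *\<^sub>R f s \<omega>))^k) * indicator {0..t} s)"
    by (auto simp: indicator_def fun_eq_iff)
  also have "\<dots> \<in> borel_measurable (N \<Otimes>\<^sub>M lborel)" by measurable
  finally show ?thesis .
qed

lemma set_nn_integral_power_measurable:
  fixes f :: "real \<Rightarrow> 'a \<Rightarrow> 'b::euclidean_space"
  assumes "(\<lambda>(\<omega>, s). indicat_real {0..t} s *\<^sub>R f s \<omega>) \<in> borel_measurable (N \<Otimes>\<^sub>M lborel)"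
  shows "(\<lambda>\<omega>. path_moment k t (\<lambda>s. f s \<omega>)) \<in> borel_measurable N"
    "\<omega> \<in> space N \<Longrightarrow> (\<lambda>s. ennreal ((norm (f s \<omega>))^k) * indicator {0..t} s) \<in> borel_measurable lborel"
proof -
  note m [measurable] = set_nn_integral_measurable[OF assms, of k]
  show "(\<lambda>\<omega>. path_moment k t (\<lambda>s. f s \<omega>)) \<in> borel_measurable N"
    by measurable
  show "\<omega> \<in> space N \<Longrightarrow> (\<lambda>s. ennreal ((norm (f s \<omega>))^k) * indicator {0..t} s) \<in> borel_measurable lborel"
    using measurable_Pair2[OF m] by simp
qed

lemma indicator_diff_measurable:
  fixes f g :: "real \<Rightarrow> 'a \<Rightarrow> 'b::euclidean_space"
  assumes [measurable]: "(\<lambda>(\<omega>, s). indicat_real {0..t} s *\<^sub>R f s \<omega>) \<in> borel_measurable (N \<Otimes>\<^sub>M lborel)"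
    "(\<lambda>(\<omega>, s). indicat_real {0..t} s *\<^sub>R g s \<omega>) \<in> borel_measurable (N \<Otimes>\<^sub>M lborel)"
  shows "(\<lambda>(\<omega>, s). indicat_real {0..t} s *\<^sub>R (f s \<omega> - g s \<omega>)) \<in> borel_measurable (N \<Otimes>\<^sub>M lborel)"
proof -
  have "(\<lambda>(\<omega>, s). indicat_real {0..t} s *\<^sub>R (f s \<omega> - g s \<omega>)) =
   (\<lambda>(\<omega>, s). indicat_real {0..t} s *\<^sub>R f s \<omega> - indicat_real {0..t} s *\<^sub>R g s \<omega>)" by (auto simp: scaleR_diff_right)
  also have "\<dots> \<in> borel_measurable (N \<Otimes>\<^sub>M lborel)" by measurable
  finally show ?thesis .
qed

lemma indicator_measurable:
  fixes f :: "real \<Rightarrow> 'a \<Rightarrow> 'b::euclidean_space"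
  assumes [measurable]: "(\<lambda>(\<omega>, s). f s \<omega>) \<in> borel_measurable (N \<Otimes>\<^sub>M lborel)"
  shows "(\<lambda>(\<omega>, s). indicat_real {0..t} s *\<^sub>R f s \<omega>) \<in> borel_measurable (N \<Otimes>\<^sub>M lborel)"
  by measurable

text \<open>Dominated convergence twice, first in \<open>s\<close> and then over the probability
  space, both times with a constant majorant from the uniform bound on \<open>h\<close>. The
  exceptional time 0 is a null set, and \<open>0 < k\<close> makes the \<open>k\<close>-th power of
  the vanishing error vanish.\<close>

lemma (in prob_space) grid_step_error:
  fixes k :: nat and h :: "real \<Rightarrow> 'a \<Rightarrow> 'b::euclidean_space"
  assumes "0 \<le> t" "\<And>s. s \<in> {0..t} \<Longrightarrow> h s \<in> borel_measurable M"
    "\<And>\<omega>. \<omega> \<in> space M \<Longrightarrow> left_continuous t (\<lambda>s. h s \<omega>)"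
    "\<And>s \<omega>. s \<in> {0..t} \<Longrightarrow> \<omega> \<in> space M \<Longrightarrow> norm (h s \<omega>) \<le> K" "0 < k"
  shows "(\<lambda>m. \<integral>\<^sup>+\<omega>. (path_moment k t (\<lambda>s. grid_step t (Suc m) h s \<omega> - h s \<omega>)) \<partial>M) \<longlonglongrightarrow> 0"
proof -
  define K' where "K' = max K 0"
  have jm: "(\<lambda>(\<omega>, s). indicat_real {0..t} s *\<^sub>R (grid_step t m h s \<omega> - h s \<omega>)) \<in> borel_measurable (M \<Otimes>\<^sub>M lborel)" for m
    by (rule indicator_diff_measurable[OF indicator_measurable[OF grid_step_measurable] left_continuous_measurable]) (use assms in auto)
  note M1 = set_nn_integral_power_measurable[OF jm, where k=k]
  have bd: "norm (grid_step t m h s \<omega> - h s \<omega>) \<le> 2 * K'" if "s \<in> {0..t}" "\<omega> \<in> space M" for s \<omega> m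
  proof -
    have "norm (h r \<omega>) \<le> K'" if "r \<in> {0..t}" for r
      using assms(4)[OF that \<open>\<omega> \<in> space M\<close>] by (simp add: K'_def)
    then have "norm (grid_step t m h s \<omega>) \<le> K'" "norm (h s \<omega>) \<le> K'"
      using grid_step_norm_le[of t s h \<omega> K' m] assms(1) that by (auto simp: K'_def)
    then show ?thesis using norm_triangle_ineq4[of "grid_step t m h s \<omega>" "h s \<omega>"] by simp
  qed
  have bd': "ennreal ((norm (grid_step t m h s \<omega> - h s \<omega>))^k) * indicator {0..t} s \<le> ennreal ((2*K')^k) * indicator {0..t} s"
    if "\<omega> \<in> space M" for s \<omega> m
    using power_mono[OF bd[of s \<omega> m], of k] that by (auto simp: indicator_def intro!: ennreal_leI)
  have inner: "(\<lambda>m. path_moment k t (\<lambda>s. grid_step t (Suc m) h s \<omega> - h s \<omega>)) \<longlonglongrightarrow> (\<integral>\<^sup>+(s::real). 0 \<partial>lborel)"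
    if \<omega>: "\<omega> \<in> space M" for \<omega>
  proof (rule nn_integral_dominated_convergence)
    show "(\<integral>\<^sup>+s. ennreal ((2*K')^k) * indicator {0..t} s \<partial>lborel) < \<infinity>"
      using assms(1) by (simp add: nn_integral_cmult_indicator ennreal_mult_less_top)
    have "AE s in lborel. s \<noteq> (0::real)" by (rule AE_lborel_singleton)
    then show "AE s in lborel. (\<lambda>m. ennreal ((norm (grid_step t (Suc m) h s \<omega> - h s \<omega>))^k) * indicator {0..t} s) \<longlonglongrightarrow> 0"
    proof eventually_elim
      fix s :: real assume s: "s \<noteq> 0"
      show "(\<lambda>m. ennreal ((norm (grid_step t (Suc m) h s \<omega> - h s \<omega>))^k) * indicator {0..t} s) \<longlonglongrightarrow> 0"
      proof (cases "s \<in> {0..t}")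
        case True
        then have "(\<lambda>m. grid_step t (Suc m) h s \<omega>) \<longlonglongrightarrow> h s \<omega>" using s assms \<omega> by (intro grid_step_tendsto) auto
        then have "(\<lambda>m. (norm (grid_step t (Suc m) h s \<omega> - h s \<omega>))^k) \<longlonglongrightarrow> (norm (h s \<omega> - h s \<omega>))^k"
          by (intro tendsto_intros)
        then have "(\<lambda>m. ennreal ((norm (grid_step t (Suc m) h s \<omega> - h s \<omega>))^k)) \<longlonglongrightarrow> ennreal 0"
          using assms(5) by (intro tendsto_ennrealI) (auto simp: power_0_left)
        then show ?thesis using True by simp
      qed simp
    qed
  qed (use M1(2)[OF \<omega>] bd'[OF \<omega>] in auto)
  have "(\<lambda>m. \<integral>\<^sup>+\<omega>. (path_moment k t (\<lambda>s. grid_step t (Suc m) h s \<omega> - h s \<omega>)) \<partial>M) \<longlonglongrightarrow> (\<integral>\<^sup>+\<omega>. 0 \<partial>M)"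
  proof (rule nn_integral_dominated_convergence[where w="\<lambda>_. ennreal ((2*K')^k) * ennreal t"])
    show "AE \<omega> in M. (path_moment k t (\<lambda>s. grid_step t (Suc m) h s \<omega> - h s \<omega>)) \<le> ennreal ((2*K')^k) * ennreal t" for m
    proof (rule AE_I2)
      fix \<omega> assume "\<omega> \<in> space M"
      then have "(path_moment k t (\<lambda>s. grid_step t (Suc m) h s \<omega> - h s \<omega>)) \<le> (\<integral>\<^sup>+s. ennreal ((2*K')^k) * indicator {0..t} s \<partial>lborel)"
        by (intro nn_integral_mono bd')
      then show "(path_moment k t (\<lambda>s. grid_step t (Suc m) h s \<omega> - h s \<omega>)) \<le> ennreal ((2*K')^k) * ennreal t"
        using assms(1) by (simp add: nn_integral_cmult_indicator)
    qed
    show "(\<integral>\<^sup>+\<omega>. ennreal ((2*K')^k) * ennreal t \<partial>M) < \<infinity>" by (simp add: emeasure_space_1 ennreal_mult_less_top)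
    show "AE \<omega> in M. (\<lambda>m. path_moment k t (\<lambda>s. grid_step t (Suc m) h s \<omega> - h s \<omega>)) \<longlonglongrightarrow> 0"
      using inner by (intro AE_I2) simp
  qed (use M1(1) in auto)
  then show ?thesis by simp
qed

lemma norm_square_diff_le: "(norm (x - y))^2 \<le> 2 * (norm x)^2 + 2 * (norm y)^2" for x y :: "'b::real_inner"
proof -
  have "0 \<le> (norm (x + y))^2" by simp
  then show ?thesis unfolding power2_norm_eq_inner by (simp add: algebra_simps inner_commute)
qed

section \<open>Comparison of an Ito integral with an elementary integral on an event\<close>

context brownian_motion
begin

lemma simple_ito_measurable:
  fixes R :: "real \<Rightarrow> 'a \<Rightarrow> 'b::euclidean_space"
  assumes "simple_ito_integral M F B t R J"
  shows "(\<lambda>(\<omega>, s). R s \<omega>) \<in> borel_measurable (M \<Otimes>\<^sub>M lborel)"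
proof -
  obtain m :: nat and \<tau> :: "nat \<Rightarrow> real" and \<xi> :: "nat \<Rightarrow> 'a \<Rightarrow> 'b" where
    p: "\<forall>i<m. \<xi> i \<in> borel_measurable (F (\<tau> i))"
    and R: "R = (\<lambda>s \<omega>. \<Sum>i<m. indicat_real {\<tau> i<..\<tau> (Suc i)} s *\<^sub>R \<xi> i \<omega>)"
    using assms unfolding simple_ito_integral_def by blast
  have [measurable]: "\<xi> i \<in> borel_measurable M" if "i < m" for i using p that F_imp_M by auto
  show ?thesis unfolding R split_beta' by measurable
qed

text \<open>The grid divides \<open>{0..t}\<close>, but the integral may end at another time
  \<open>u\<close>. This allows one grid to serve all intermediate grid times.\<close>

lemma grid_step_simple:
  fixes h :: "real \<Rightarrow> 'a \<Rightarrow> 'b::euclidean_space"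
  assumes "0 \<le> t" "\<And>s. s \<in> {0..t} \<Longrightarrow> h s \<in> borel_measurable (F s)"
    "\<And>s \<omega>. s \<in> {0..t} \<Longrightarrow> \<omega> \<in> space M \<Longrightarrow> norm (h s \<omega>) \<le> K"
  shows "simple_ito_integral M F B u (grid_step t m h)
    (\<lambda>\<omega>. \<Sum>i<m. (B (min u (grid_point t m (Suc i))) \<omega> - B (min u (grid_point t m i)) \<omega>) *\<^sub>R h (grid_point t m i) \<omega>)"
proof -
  have "grid_point t m i \<in> {0..t}" if "i < m" for i
    using that assms(1) grid_point_nonneg[of t m i] grid_point_le[of t i m] by auto
  then show ?thesis
    unfolding simple_ito_integral_def
    by (intro exI[of _ m] exI[of _ "grid_point t m"] exI[of _ "\<lambda>i. h (grid_point t m i)"])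
      (use assms grid_point_mono[OF assms(1)] in \<open>auto simp: grid_step_def[abs_def] intro!: exI[of _ K]\<close>)
qed

text \<open>Only an upper bound up to the factor 4 is needed, so the triangle inequality replaces the exact
  isometry throughout.\<close>

lemma ito_integral_localized:
  fixes H h :: "real \<Rightarrow> 'a \<Rightarrow> 'b::euclidean_space"
  assumes t: "0 \<le> t" and ito: "has_ito_integral M F B t H J"
    and H: "\<And>s. s \<in> {0..t} \<Longrightarrow> H s \<in> borel_measurable (F s)" "\<And>\<omega>. \<omega> \<in> space M \<Longrightarrow> left_continuous t (\<lambda>s. H s \<omega>)"
    and h: "\<And>s. s \<in> {0..t} \<Longrightarrow> h s \<in> borel_measurable (F s)" "\<And>\<omega>. \<omega> \<in> space M \<Longrightarrow> left_continuous t (\<lambda>s. h s \<omega>)"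
      "\<And>s \<omega>. s \<in> {0..t} \<Longrightarrow> \<omega> \<in> space M \<Longrightarrow> norm (h s \<omega>) \<le> K"
    and G: "G \<in> sets M" "\<And>s \<omega>. \<omega> \<in> G \<Longrightarrow> s \<in> {0..t} \<Longrightarrow> h s \<omega> = H s \<omega>"
    and S: "simple_ito_integral M F B t S I"
  shows "(\<integral>\<^sup>+\<omega>\<in>G. ennreal ((norm (J \<omega> - I \<omega>))^2) \<partial>M) \<le>
    4 * (\<integral>\<^sup>+\<omega>. (path_moment 2 t (\<lambda>s. S s \<omega> - h s \<omega>)) \<partial>M)"
proof -
  let ?sq = "\<lambda>R \<omega>. path_moment 2 t (\<lambda>s. R s \<omega>)"
  obtain Sk Ik where 1: "(\<forall>k. simple_ito_integral M F B t (Sk k) (Ik k)) \<and>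
      (\<forall>\<delta>>0. (\<lambda>k. measure M {\<omega>\<in>space M. ennreal \<delta> < ?sq (\<lambda>s \<omega>. Sk k s \<omega> - H s \<omega>) \<omega>}) \<longlonglongrightarrow> 0) \<and>
      tendsto_in_probability M Ik J"
    using ito[unfolded has_ito_integral_def, THEN conjunct2, THEN conjunct2] by (elim exE) (rule that)
  have Sk: "simple_ito_integral M F B t (Sk k) (Ik k)" for k using 1 by simp
  have Sk_lim: "(\<lambda>k. measure M {\<omega>\<in>space M. ennreal \<delta> < ?sq (\<lambda>s \<omega>. Sk k s \<omega> - H s \<omega>) \<omega>}) \<longlonglongrightarrow> 0" if "0 < \<delta>" for \<delta>
    using 1 that by simp
  have Ik_lim: "(\<lambda>k. measure M {\<omega>\<in>space M. \<delta> < norm (Ik k \<omega> - J \<omega>)}) \<longlonglongrightarrow> 0" if "0 < \<delta>" for \<delta>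
    using 1 that unfolding tendsto_in_probability_def by simp
  have Jm [measurable]: "J \<in> borel_measurable M" using ito unfolding has_ito_integral_def by simp
  \<comment> \<open>The grid processes of \<open>h\<close> mediate between the approximants
    \<open>Sk\<close> of \<open>H\<close> and the given \<open>S\<close>. Their distance to
    \<open>S\<close> is controlled in mean square by the isometry; their distance to
    \<open>Sk\<close> is controlled only in probability and only where \<open>h\<close> equals
    \<open>H\<close>.\<close>
  define S' where "S' k = grid_step t (Suc k) h" for k
  define I' where "I' k \<omega> = (\<Sum>i<Suc k. (B (min t (grid_point t (Suc k) (Suc i))) \<omega> - B (min t (grid_point t (Suc k) i)) \<omega>)
    *\<^sub>R h (grid_point t (Suc k) i) \<omega>)" for k \<omega>
  have S': "simple_ito_integral M F B t (S' k) (I' k)" for k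
    unfolding S'_def I'_def[abs_def] by (rule grid_step_simple[OF t h(1,3)])
  have HM: "\<And>s. s \<in> {0..t} \<Longrightarrow> H s \<in> borel_measurable M" and hM: "\<And>s. s \<in> {0..t} \<Longrightarrow> h s \<in> borel_measurable M"
    using H(1) h(1) F_imp_M by auto
  note jH = left_continuous_measurable[OF t HM H(2), simplified]
  note jh = left_continuous_measurable[OF t hM h(2), simplified]
  note js = indicator_measurable[OF simple_ito_measurable]
  note [measurable] = simple_ito_isometry(1)[OF t Sk] simple_ito_isometry(1)[OF t S'] simple_ito_isometry(1)[OF t S] G(1)
  note [measurable] = set_nn_integral_power_measurable(1)[OF indicator_diff_measurable[OF js[OF Sk] jH]]
    set_nn_integral_power_measurable(1)[OF indicator_diff_measurable[OF js[OF S'] jh]]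
    set_nn_integral_power_measurable(1)[OF indicator_diff_measurable[OF js[OF S] jh]]
    set_nn_integral_power_measurable(1)[OF js[OF simple_ito_diff[OF t Sk S']]]
    set_nn_integral_power_measurable(1)[OF js[OF simple_ito_diff[OF t S' S]]]
  have sq_triangle: "?sq (\<lambda>s \<omega>. U s \<omega> - V s \<omega>) \<omega> \<le> 2 * ?sq (\<lambda>s \<omega>. U s \<omega> - W s \<omega>) \<omega> + 2 * ?sq (\<lambda>s \<omega>. V s \<omega> - W s \<omega>) \<omega>"
    if m: "(\<lambda>(\<omega>, s). indicat_real {0..t} s *\<^sub>R (U s \<omega> - W s \<omega>)) \<in> borel_measurable (M \<Otimes>\<^sub>M lborel)"
       "(\<lambda>(\<omega>, s). indicat_real {0..t} s *\<^sub>R (V s \<omega> - W s \<omega>)) \<in> borel_measurable (M \<Otimes>\<^sub>M lborel)" and \<omega>: "\<omega> \<in> space M"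
    for U V W :: "real \<Rightarrow> 'a \<Rightarrow> 'b" and \<omega>
  proof -
    note [measurable] = set_nn_integral_power_measurable(2)[OF m(1) \<omega>, of 2] set_nn_integral_power_measurable(2)[OF m(2) \<omega>, of 2]
    have "?sq (\<lambda>s \<omega>. U s \<omega> - V s \<omega>) \<omega> \<le> (\<integral>\<^sup>+s. 2 * (ennreal ((norm (U s \<omega> - W s \<omega>))^2) * indicator {0..t} s)
      + 2 * (ennreal ((norm (V s \<omega> - W s \<omega>))^2) * indicator {0..t} s) \<partial>lborel)"
    proof (rule nn_integral_mono)
      fix s
      have "(norm (U s \<omega> - V s \<omega>))^2 \<le> 2 * (norm (U s \<omega> - W s \<omega>))^2 + 2 * (norm (V s \<omega> - W s \<omega>))^2"
        using norm_square_diff_le[of "U s \<omega> - W s \<omega>" "V s \<omega> - W s \<omega>"] by simp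
      then have "ennreal ((norm (U s \<omega> - V s \<omega>))^2) \<le> 2 * ennreal ((norm (U s \<omega> - W s \<omega>))^2) + 2 * ennreal ((norm (V s \<omega> - W s \<omega>))^2)"
        using ennreal_leI by (fastforce simp: ennreal_plus ennreal_mult' simp flip: ennreal_numeral)
      then show "ennreal ((norm (U s \<omega> - V s \<omega>))^2) * indicator {0..t} s \<le> 2 * (ennreal ((norm (U s \<omega> - W s \<omega>))^2) * indicator {0..t} s)
      + 2 * (ennreal ((norm (V s \<omega> - W s \<omega>))^2) * indicator {0..t} s)"
        by (auto simp: indicator_def)
    qed
    also have "\<dots> = 2 * ?sq (\<lambda>s \<omega>. U s \<omega> - W s \<omega>) \<omega> + 2 * ?sq (\<lambda>s \<omega>. V s \<omega> - W s \<omega>) \<omega>"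
      by (subst nn_integral_add) (auto simp: nn_integral_cmult)
    finally show ?thesis .
  qed
  define e where "e = (\<integral>\<^sup>+\<omega>. ?sq (\<lambda>s \<omega>. S s \<omega> - h s \<omega>) \<omega> \<partial>M)"
  define d where "d k = (\<integral>\<^sup>+\<omega>. ?sq (\<lambda>s \<omega>. S' k s \<omega> - h s \<omega>) \<omega> \<partial>M)" for k
  have d_lim: "d \<longlonglongrightarrow> 0"
    unfolding d_def S'_def by (rule grid_step_error[OF t hM h(2,3)]) auto
  have e1: "(\<integral>\<^sup>+\<omega>. ennreal ((norm (I' k \<omega> - I \<omega>))^2) \<partial>M) \<le> 2 * d k + 2 * e" for k
  proof -
    have "(\<integral>\<^sup>+\<omega>. ennreal ((norm (I' k \<omega> - I \<omega>))^2) \<partial>M) = (\<integral>\<^sup>+\<omega>. ?sq (\<lambda>s \<omega>. S' k s \<omega> - S s \<omega>) \<omega> \<partial>M)"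
      by (rule simple_ito_isometry(3)[OF t simple_ito_diff[OF t S' S]])
    also have "\<dots> \<le> (\<integral>\<^sup>+\<omega>. 2 * ?sq (\<lambda>s \<omega>. S' k s \<omega> - h s \<omega>) \<omega> + 2 * ?sq (\<lambda>s \<omega>. S s \<omega> - h s \<omega>) \<omega> \<partial>M)"
      by (intro nn_integral_mono sq_triangle indicator_diff_measurable js[OF S] js[OF S'] jh)
    also have "\<dots> = 2 * d k + 2 * e"
      unfolding d_def e_def by (subst nn_integral_add) (auto simp: nn_integral_cmult)
    finally show ?thesis .
  qed
  have close: "\<exists>k. d k \<le> ennreal \<theta> \<and> measure M {\<omega>\<in>space M. \<delta> < norm (Ik k \<omega> - J \<omega>)} \<le> \<theta>
      \<and> measure M {\<omega>\<in>space M. ennreal \<delta>' < ?sq (\<lambda>s \<omega>. Sk k s \<omega> - H s \<omega>) \<omega>} \<le> \<theta>"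
    if "0 < \<theta>" "0 < \<delta>" "0 < \<delta>'" for \<theta> \<delta> \<delta>' :: real
  proof -
    have "eventually (\<lambda>k. d k < ennreal \<theta>) sequentially" using d_lim that by (intro order_tendstoD(2)) auto
    moreover have "eventually (\<lambda>k. measure M {\<omega>\<in>space M. \<delta> < norm (Ik k \<omega> - J \<omega>)} < \<theta>) sequentially"
      using Ik_lim that by (intro order_tendstoD(2)) auto
    moreover have "eventually (\<lambda>k. measure M {\<omega>\<in>space M. ennreal \<delta>' < ?sq (\<lambda>s \<omega>. Sk k s \<omega> - H s \<omega>) \<omega>} < \<theta>) sequentially"
      using Sk_lim that by (intro order_tendstoD(2)) auto
    ultimately have "eventually (\<lambda>k. d k < ennreal \<theta> \<and> measure M {\<omega>\<in>space M. \<delta> < norm (Ik k \<omega> - J \<omega>)} < \<theta>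
      \<and> measure M {\<omega>\<in>space M. ennreal \<delta>' < ?sq (\<lambda>s \<omega>. Sk k s \<omega> - H s \<omega>) \<omega>} < \<theta>) sequentially"
      by eventually_elim auto
    then show ?thesis using less_imp_le by (fastforce simp: eventually_sequentially)
  qed
  \<comment> \<open>Capping the norm at \<open>n\<close> makes an exceptional set cost at most
    \<open>n^2\<close> times its probability. The cap and the slack \<open>\<rho>\<close> are
    removed afterwards.\<close>
  have trunc: "(\<integral>\<^sup>+\<omega>\<in>G. ennreal ((min (norm (J \<omega> - I \<omega>)) n)^2) \<partial>M) \<le> 4 * e + ennreal \<rho>"
    if n: "0 < (n::real)" and \<rho>: "0 < \<rho>" for n \<rho>
  proof -
    \<comment> \<open>The constants split the slack \<open>\<rho>\<close>. The value of
      \<open>\<eta>\<close> makes \<open>2 * (2 * \<eta>)^2\<close> equal to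
      \<open>\<rho> / 4\<close>; \<open>N\<close> makes the tail bound \<open>N / \<eta>^2\<close>
      equal to \<open>\<rho> / (8 * n^2)\<close>; the last bound on \<open>\<theta>\<close> gives
      the same value for the Markov estimate of \<open>B4\<close>.\<close>
    define \<eta> where "\<eta> = sqrt (\<rho> / 32)"
    have \<eta>: "0 < \<eta>" "\<eta>^2 = \<rho> / 32" using \<rho> by (auto simp: \<eta>_def)
    define N where "N = \<eta>^2 * \<rho> / (8 * n^2)"
    have N: "0 < N" using \<eta>(1) \<rho> n by (simp add: N_def)
    define \<theta> where "\<theta> = min (\<rho> / 16) (min (\<rho> / (8 * n^2)) (N * \<rho> / (32 * n^2)))"
    have \<theta>: "0 < \<theta>" "\<theta> \<le> \<rho> / 16" "\<theta> \<le> \<rho> / (8 * n^2)" "\<theta> \<le> N * \<rho> / (32 * n^2)" using N \<rho> n by (auto simp: \<theta>_def)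
    obtain k where k: "d k \<le> ennreal \<theta>" "measure M {\<omega>\<in>space M. \<eta> < norm (Ik k \<omega> - J \<omega>)} \<le> \<theta>"
      "measure M {\<omega>\<in>space M. ennreal (N / 4) < ?sq (\<lambda>s \<omega>. Sk k s \<omega> - H s \<omega>) \<omega>} \<le> \<theta>"
      using close[OF \<theta>(1) \<eta>(1), of "N / 4"] N by auto
    \<comment> \<open>The four ways to fail: \<open>Ik k\<close> is far from \<open>J\<close>; the
      integrals \<open>Ik k\<close> and \<open>I' k\<close> differ although their integrands are
      close; either integrand is far from its target. On \<open>G\<close> and off these sets,
      \<open>J\<close> and \<open>I' k\<close> are within \<open>2 * \<eta>\<close>, because there
      \<open>h\<close> and \<open>H\<close> coincide on \<open>{0..t}\<close>.\<close>
    define B1 where "B1 = {\<omega>\<in>space M. \<eta> < norm (Ik k \<omega> - J \<omega>)}"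
    define B2 where "B2 = {\<omega>\<in>space M. \<eta> < norm (Ik k \<omega> - I' k \<omega>) \<and> ?sq (\<lambda>s \<omega>. Sk k s \<omega> - S' k s \<omega>) \<omega> \<le> ennreal N}"
    define B3 where "B3 = {\<omega>\<in>space M. ennreal (N / 4) < ?sq (\<lambda>s \<omega>. Sk k s \<omega> - H s \<omega>) \<omega>}"
    define B4 where "B4 = {\<omega>\<in>space M. ennreal (N / 4) < ?sq (\<lambda>s \<omega>. S' k s \<omega> - h s \<omega>) \<omega>}"
    have [measurable]: "B1 \<in> sets M" "B2 \<in> sets M" "B3 \<in> sets M" "B4 \<in> sets M"
      unfolding B1_def B2_def B3_def B4_def by measurable
    have b1: "measure M B1 \<le> \<rho> / (8 * n^2)" using k(2) \<theta> by (simp add: B1_def)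
    have b2: "measure M B2 \<le> \<rho> / (8 * n^2)"
      using simple_ito_truncated_Markov[OF t simple_ito_diff[OF t Sk[of k] S'[of k]] \<eta>(1), of N] N \<eta>(1)
      by (simp add: B2_def N_def)
    have b3: "measure M B3 \<le> \<rho> / (8 * n^2)" using k(3) \<theta> by (simp add: B3_def)
    have b4: "measure M B4 \<le> \<rho> / (8 * n^2)"
    proof -
      have "ennreal (measure M B4) \<le> emeasure M {\<omega>\<in>space M. 1 \<le> ennreal (4 / N) * ?sq (\<lambda>s \<omega>. S' k s \<omega> - h s \<omega>) \<omega>}"
        unfolding emeasure_eq_measure[symmetric]
      proof (rule emeasure_mono)
        have "1 \<le> ennreal (4 / N) * x" if "ennreal (N / 4) < x" for x
        proof -
          have "1 = ennreal (4 / N) * ennreal (N / 4)" using N by (simp add: ennreal_mult[symmetric])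
          also have "\<dots> \<le> ennreal (4 / N) * x" using that by (intro mult_left_mono) auto
          finally show ?thesis .
        qed
        then show "B4 \<subseteq> {\<omega>\<in>space M. 1 \<le> ennreal (4 / N) * ?sq (\<lambda>s \<omega>. S' k s \<omega> - h s \<omega>) \<omega>}" by (auto simp: B4_def)
      qed measurable
      also have "\<dots> \<le> ennreal (4 / N) * (\<integral>\<^sup>+\<omega>. ?sq (\<lambda>s \<omega>. S' k s \<omega> - h s \<omega>) \<omega> * indicator (space M) \<omega> \<partial>M)"
        by (rule nn_integral_Markov_inequality) measurable
      also have "(\<integral>\<^sup>+\<omega>. ?sq (\<lambda>s \<omega>. S' k s \<omega> - h s \<omega>) \<omega> * indicator (space M) \<omega> \<partial>M) = d k"
        unfolding d_def by (rule nn_integral_cong) simp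
      also have "ennreal (4 / N) * d k \<le> ennreal (4 / N) * ennreal (N * \<rho> / (32 * n^2))"
        using k(1) \<theta>(4) by (intro mult_left_mono) (auto intro: order_trans ennreal_leI)
      also have "\<dots> = ennreal (\<rho> / (8 * n^2))" using N \<rho> n by (simp add: ennreal_mult[symmetric] field_simps)
      finally show ?thesis using \<rho> n by simp
    qed
    have "ennreal ((min (norm (J \<omega> - I \<omega>)) n)^2) * indicator G \<omega> \<le>
      2 * ennreal ((norm (I' k \<omega> - I \<omega>))^2) + ennreal (\<rho> / 4) +
      (ennreal (n^2) * indicator B1 \<omega> + ennreal (n^2) * indicator B2 \<omega> + ennreal (n^2) * indicator B3 \<omega> + ennreal (n^2) * indicator B4 \<omega>)"
      if \<omega>: "\<omega> \<in> space M" for \<omega>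
    proof (cases "\<omega> \<in> G \<and> \<omega> \<notin> B1 \<union> B2 \<union> B3 \<union> B4")
      case True
      have "?sq (\<lambda>s \<omega>. Sk k s \<omega> - h s \<omega>) \<omega> = ?sq (\<lambda>s \<omega>. Sk k s \<omega> - H s \<omega>) \<omega>"
        using G(2) True by (intro nn_integral_cong) (auto simp: indicator_def)
      then have 1: "?sq (\<lambda>s \<omega>. Sk k s \<omega> - h s \<omega>) \<omega> \<le> ennreal (N / 4)" "?sq (\<lambda>s \<omega>. S' k s \<omega> - h s \<omega>) \<omega> \<le> ennreal (N / 4)"
        using True \<omega> by (auto simp: B3_def B4_def not_less)
      have "?sq (\<lambda>s \<omega>. Sk k s \<omega> - S' k s \<omega>) \<omega> \<le> 2 * ?sq (\<lambda>s \<omega>. Sk k s \<omega> - h s \<omega>) \<omega> + 2 * ?sq (\<lambda>s \<omega>. S' k s \<omega> - h s \<omega>) \<omega>"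
        by (intro sq_triangle indicator_diff_measurable js[OF Sk] js[OF S'] jh \<omega>)
      also have "\<dots> \<le> 2 * ennreal (N / 4) + 2 * ennreal (N / 4)" using 1 by (intro add_mono mult_left_mono) auto
      also have "\<dots> = ennreal N" using N by (simp flip: ennreal_numeral ennreal_mult ennreal_plus)
      finally have "norm (Ik k \<omega> - I' k \<omega>) \<le> \<eta>" using True \<omega> by (auto simp: B2_def not_less)
      moreover have "norm (Ik k \<omega> - J \<omega>) \<le> \<eta>" using True \<omega> by (auto simp: B1_def not_less)
      ultimately have "norm (J \<omega> - I' k \<omega>) \<le> 2 * \<eta>"
        using norm_triangle_ineq4[of "Ik k \<omega> - I' k \<omega>" "Ik k \<omega> - J \<omega>"] by simp
      then have "(norm (J \<omega> - I' k \<omega>))^2 \<le> (2 * \<eta>)^2" by (intro power_mono) auto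
      then have 2: "(norm (J \<omega> - I' k \<omega>))^2 \<le> \<rho> / 8" using \<eta>(2) by (simp add: power_mult_distrib)
      have "(min (norm (J \<omega> - I \<omega>)) n)^2 \<le> (norm (J \<omega> - I \<omega>))^2" using n by (intro power_mono) auto
      also have "\<dots> \<le> 2 * (norm (I' k \<omega> - I \<omega>))^2 + \<rho> / 4"
        using norm_square_diff_le[of "J \<omega> - I' k \<omega>" "I \<omega> - I' k \<omega>"] 2 by (simp add: norm_minus_commute)
      finally have "ennreal ((min (norm (J \<omega> - I \<omega>)) n)^2) \<le> ennreal (2 * (norm (I' k \<omega> - I \<omega>))^2 + \<rho> / 4)" by (rule ennreal_leI)
      also have "\<dots> = 2 * ennreal ((norm (I' k \<omega> - I \<omega>))^2) + ennreal (\<rho> / 4)"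
        using \<rho> by (simp add: ennreal_plus ennreal_mult')
      finally show ?thesis using True by simp
    next
      case False
      show ?thesis
      proof (cases "\<omega> \<in> G")
        case True
        have "(min (norm (J \<omega> - I \<omega>)) n)^2 \<le> n^2" using n by (intro power_mono) auto
        then have "ennreal ((min (norm (J \<omega> - I \<omega>)) n)^2) \<le> ennreal (n^2)" by (rule ennreal_leI)
        also have "ennreal (n^2) \<le> ennreal (n^2) * indicator B1 \<omega> + ennreal (n^2) * indicator B2 \<omega> + ennreal (n^2) * indicator B3 \<omega> + ennreal (n^2) * indicator B4 \<omega>"
          using False True by (auto simp: indicator_def)
        also have "\<dots> \<le> 2 * ennreal ((norm (I' k \<omega> - I \<omega>))^2) + ennreal (\<rho> / 4) + \<dots>" by simp
        finally show ?thesis using True by simp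
      qed simp
    qed
    then have "(\<integral>\<^sup>+\<omega>\<in>G. ennreal ((min (norm (J \<omega> - I \<omega>)) n)^2) \<partial>M) \<le>
      (\<integral>\<^sup>+\<omega>. 2 * ennreal ((norm (I' k \<omega> - I \<omega>))^2) + ennreal (\<rho> / 4) +
      (ennreal (n^2) * indicator B1 \<omega> + ennreal (n^2) * indicator B2 \<omega> + ennreal (n^2) * indicator B3 \<omega> + ennreal (n^2) * indicator B4 \<omega>) \<partial>M)"
      by (rule nn_integral_mono)
    also have "\<dots> = 2 * (\<integral>\<^sup>+\<omega>. ennreal ((norm (I' k \<omega> - I \<omega>))^2) \<partial>M) + ennreal (\<rho> / 4) +
      (ennreal (n^2) * emeasure M B1 + ennreal (n^2) * emeasure M B2 + ennreal (n^2) * emeasure M B3 + ennreal (n^2) * emeasure M B4)"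
      by (simp add: nn_integral_add nn_integral_cmult nn_integral_cmult_indicator emeasure_space_1)
    \<comment> \<open>The budget: \<open>\<rho> / 4\<close> from the mean square error of the grid
      process, \<open>\<rho> / 4\<close> from the closeness on the regular part, and
      \<open>\<rho> / 8\<close> from each of the four exceptional sets.\<close>
    also have "\<dots> \<le> 2 * (2 * ennreal (\<rho> / 16) + 2 * e) + ennreal (\<rho> / 4) + (ennreal (\<rho> / 8) + ennreal (\<rho> / 8) + ennreal (\<rho> / 8) + ennreal (\<rho> / 8))"
    proof -
      have "ennreal (n^2) * emeasure M X \<le> ennreal (\<rho> / 8)" if "measure M X \<le> \<rho> / (8 * n^2)" for X
        using that n unfolding emeasure_eq_measure
        by (subst ennreal_mult[symmetric]) (auto intro!: ennreal_leI simp: field_simps)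
      moreover have "(\<integral>\<^sup>+\<omega>. ennreal ((norm (I' k \<omega> - I \<omega>))^2) \<partial>M) \<le> 2 * ennreal (\<rho> / 16) + 2 * e"
        using order_trans[OF k(1) ennreal_leI[OF \<theta>(2)]] by (intro order_trans[OF e1 add_right_mono] mult_left_mono) auto
      ultimately show ?thesis using b1 b2 b3 b4 by (intro add_mono mult_left_mono) auto
    qed
    also have "\<dots> = 4 * e + (2 * (2 * ennreal (\<rho> / 16)) + ennreal (\<rho> / 4) + (ennreal (\<rho> / 8) + ennreal (\<rho> / 8) + ennreal (\<rho> / 8) + ennreal (\<rho> / 8)))"
      by (simp add: distrib_left mult.assoc[symmetric] add_ac)
    also have "2 * (2 * ennreal (\<rho> / 16)) + ennreal (\<rho> / 4) + (ennreal (\<rho> / 8) + ennreal (\<rho> / 8) + ennreal (\<rho> / 8) + ennreal (\<rho> / 8)) = ennreal \<rho>"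
      using \<rho> by (simp flip: ennreal_numeral ennreal_mult ennreal_plus)
    finally show ?thesis .
  qed
  have trunc': "(\<integral>\<^sup>+\<omega>\<in>G. ennreal ((min (norm (J \<omega> - I \<omega>)) (real (Suc n)))^2) \<partial>M) \<le> 4 * e" for n
    by (rule ennreal_le_epsilon) (use trunc in auto)
  have mon: "incseq (\<lambda>n \<omega>. ennreal ((min (norm (J \<omega> - I \<omega>)) (real (Suc n)))^2) * indicator G \<omega>)"
    by (intro monoI le_funI mult_right_mono ennreal_leI power_mono min.mono) auto
  have "(\<integral>\<^sup>+\<omega>\<in>G. ennreal ((norm (J \<omega> - I \<omega>))^2) \<partial>M) =
    (\<integral>\<^sup>+\<omega>. (SUP n. ennreal ((min (norm (J \<omega> - I \<omega>)) (real (Suc n)))^2) * indicator G \<omega>) \<partial>M)"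
  proof (rule nn_integral_cong)
    fix \<omega>
    show "ennreal ((norm (J \<omega> - I \<omega>))^2) * indicator G \<omega> = (SUP n. ennreal ((min (norm (J \<omega> - I \<omega>)) (real (Suc n)))^2) * indicator G \<omega>)"
    proof (rule antisym)
      obtain n where "norm (J \<omega> - I \<omega>) \<le> real n" using real_arch_simple by blast
      then have "norm (J \<omega> - I \<omega>) \<le> real (Suc n)" by simp
      then have "ennreal ((norm (J \<omega> - I \<omega>))^2) * indicator G \<omega> = ennreal ((min (norm (J \<omega> - I \<omega>)) (real (Suc n)))^2) * indicator G \<omega>"
        by (simp add: min_def)
      then show "ennreal ((norm (J \<omega> - I \<omega>))^2) * indicator G \<omega> \<le> (SUP n. ennreal ((min (norm (J \<omega> - I \<omega>)) (real (Suc n)))^2) * indicator G \<omega>)"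
        by (auto intro: SUP_upper2)
      show "(SUP n. ennreal ((min (norm (J \<omega> - I \<omega>)) (real (Suc n)))^2) * indicator G \<omega>) \<le> ennreal ((norm (J \<omega> - I \<omega>))^2) * indicator G \<omega>"
        by (intro SUP_least mult_right_mono ennreal_leI power_mono) auto
    qed
  qed
  also have "\<dots> = (SUP n. \<integral>\<^sup>+\<omega>\<in>G. ennreal ((min (norm (J \<omega> - I \<omega>)) (real (Suc n)))^2) \<partial>M)"
    by (rule nn_integral_monotone_convergence_SUP[OF mon]) measurable
  also have "\<dots> \<le> 4 * e" by (intro SUP_least trunc')
  finally show ?thesis unfolding e_def .
qed

end

section \<open>Second moments of dissipative Ito processes\<close>

lemma continuous_on_imp_at_left:
  fixes f :: "real \<Rightarrow> 'b::topological_space"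
  assumes "continuous_on {0..} f" "0 < s"
  shows "(f \<longlongrightarrow> f s) (at_left s)"
proof -
  have "isCont f s" by (rule continuous_on_interior[OF assms(1)]) (use assms(2) in \<open>simp add: interior_real_atLeast\<close>)
  then show ?thesis unfolding isCont_def by (rule tendsto_within_subset) auto
qed

text \<open>Turns a condition at all times into a countable one, for the measurability of exit
  events. Rationals of the unit interval scaled by \<open>t\<close>, rather than rationals of
  \<open>{0..t}\<close>, also cover \<open>t = 0\<close>.\<close>

lemma Icc_le_iff_rational:
  fixes \<phi> :: "real \<Rightarrow> real"
  assumes "continuous_on {0..} \<phi>" "0 \<le> t"
  shows "(\<forall>s\<in>{0..t}. \<phi> s \<le> n) \<longleftrightarrow> (\<forall>q\<in>{0<..<1} \<inter> \<rat>. \<phi> (q * t) \<le> n)"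
proof
  assume l: "\<forall>s\<in>{0..t}. \<phi> s \<le> n"
  show "\<forall>q\<in>{0<..<1} \<inter> \<rat>. \<phi> (q * t) \<le> n"
    using assms(2) by (auto intro!: l[rule_format] mult_left_le_one_le)
next
  assume r: "\<forall>q\<in>{0<..<1} \<inter> \<rat>. \<phi> (q * t) \<le> n"
  have cl: "closure ({0<..<1} \<inter> \<rat>) = {0..1::real}"
    using closure_open_Int_superset[of "{0<..<1::real}" \<rat>] Rats_closure_real by simp
  have c: "continuous_on {0..1} (\<lambda>q. \<phi> (q * t))"
    by (rule continuous_on_compose2[OF assms(1)]) (use assms(2) in \<open>auto intro!: continuous_intros\<close>)
  show "\<forall>s\<in>{0..t}. \<phi> s \<le> n"
  proof
    fix s assume s: "s \<in> {0..t}"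
    have "s / t \<in> {0..1}" "s / t * t = s" using s by (auto simp: divide_simps)
    moreover have "\<phi> (q * t) \<le> n" if "q \<in> {0..1}" for q
      using continuous_le_on_closure[of "{0<..<1} \<inter> \<rat>" "\<lambda>q. \<phi> (q * t)" q n] cl c r that by auto
    ultimately show "\<phi> s \<le> n" by metis
  qed
qed

lemma Icc_le_left_open:
  fixes \<phi> :: "real \<Rightarrow> real"
  assumes "continuous_on {0..} \<phi>" "0 < s" "\<forall>r\<in>{0..<s}. \<phi> r \<le> n"
  shows "\<phi> s \<le> n"
proof (rule tendsto_upperbound[OF continuous_on_imp_at_left[OF assms(1,2)]])
  show "\<forall>\<^sub>F r in at_left s. \<phi> r \<le> n"
    using eventually_at_left_real[OF assms(2)] by eventually_elim (use assms(3) in auto)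
qed simp

text \<open>Trades a first power for a square: the errors of the scheme are known in mean square,
  but they enter a quadratic form linearly. With a mean square error of \<open>\<theta>^2\<close>
  the right side averages to at most \<open>2 * \<theta>\<close>.\<close>

lemma le_add_square_divide:
  fixes x \<theta> :: real
  assumes "0 < \<theta>" "0 \<le> x"
  shows "x \<le> \<theta> + x^2 / \<theta>"
proof (cases "x \<le> \<theta>")
  case True
  have "0 \<le> x^2 / \<theta>" using assms by simp
  then show ?thesis using True by linarith
next
  case False
  then have "x * \<theta> \<le> x * x" using assms by (intro mult_left_mono) auto
  then have "x \<le> x^2 / \<theta>" using assms by (simp add: power2_eq_square pos_le_divide_eq)
  then show ?thesis using assms by linarith
qed

lemma lborel_integral_step:
  "a \<le> b \<Longrightarrow> (LINT s|lborel. indicat_real {a<..b} s *\<^sub>R c) = (b - a) *\<^sub>R c"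
  for c :: "'b::euclidean_space"
  by (subst integral_scaleR_left) auto

text \<open>The drift \<open>A\<close> and the noise coefficient \<open>H\<close> are arbitrary
  adapted continuous processes, not functions of \<open>z\<close>; \<open>L\<close> embeds the noise
  into the larger state space. The left side of \<open>dissipative\<close> is the drift that the Ito
  formula assigns to \<open>z \<bullet> P z\<close>.\<close>

locale dissipative_ito_process = brownian_motion M F B
  for M :: "'a measure" and F :: "real \<Rightarrow> 'a measure" and B :: "real \<Rightarrow> 'a \<Rightarrow> real" +
  fixes z A :: "real \<Rightarrow> 'a \<Rightarrow> 'v::euclidean_space" and H :: "real \<Rightarrow> 'a \<Rightarrow> 'b::euclidean_space"
    and L :: "'b \<Rightarrow> 'v" and P :: "'v \<Rightarrow> 'v" and z0 :: 'v and \<alpha> C :: real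
  assumes z_adapted: "0 \<le> t \<Longrightarrow> z t \<in> borel_measurable (F t)"
    and A_adapted: "0 \<le> t \<Longrightarrow> A t \<in> borel_measurable (F t)"
    and H_adapted: "0 \<le> t \<Longrightarrow> H t \<in> borel_measurable (F t)"
    and z_cont: "\<omega> \<in> space M \<Longrightarrow> continuous_on {0..} (\<lambda>t. z t \<omega>)"
    and A_cont: "\<omega> \<in> space M \<Longrightarrow> continuous_on {0..} (\<lambda>t. A t \<omega>)"
    and H_cont: "\<omega> \<in> space M \<Longrightarrow> continuous_on {0..} (\<lambda>t. H t \<omega>)"
    and L: "bounded_linear L" and P: "bounded_linear P"
    and P_sym: "P x \<bullet> y = x \<bullet> P y" and P_psd: "0 \<le> x \<bullet> P x"
    and ito_process: "0 \<le> t \<Longrightarrow> \<exists>J. has_ito_integral M F B t H J \<and>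
      (AE \<omega> in M. z t \<omega> = z0 + integral {0..t} (\<lambda>s. A s \<omega>) + L (J \<omega>))"
    and \<alpha>_pos: "0 < \<alpha>" and C_nonneg: "0 \<le> C"
    and dissipative: "0 \<le> t \<Longrightarrow> \<omega> \<in> space M \<Longrightarrow>
      2 * (z t \<omega> \<bullet> P (A t \<omega>)) + L (H t \<omega>) \<bullet> P (L (H t \<omega>)) \<le> C - \<alpha> * (z t \<omega> \<bullet> P (z t \<omega>))"
begin

text \<open>The bounds are not strict, so that \<open>good\<close> passes to left limits and killing keeps a continuous
  process left continuous.\<close>

definition good :: "real \<Rightarrow> real \<Rightarrow> 'a \<Rightarrow> bool" where
  "good n t \<omega> \<longleftrightarrow> (\<forall>s\<in>{0..t}. norm (z s \<omega>) \<le> n \<and> norm (A s \<omega>) \<le> n \<and> norm (H s \<omega>) \<le> n)"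

definition killed :: "real \<Rightarrow> (real \<Rightarrow> 'a \<Rightarrow> 'c::zero) \<Rightarrow> real \<Rightarrow> 'a \<Rightarrow> 'c" where
  "killed n X s \<omega> = (if good n s \<omega> then X s \<omega> else 0)"

lemma good_antimono: "good n t \<omega> \<Longrightarrow> s \<le> t \<Longrightarrow> good n s \<omega>"
  unfolding good_def by auto

lemma good_sets: assumes "0 \<le> t" shows "{\<omega>\<in>space M. good n t \<omega>} \<in> sets (F t)"
proof -
  let ?D = "{0<..<1::real} \<inter> \<rat>"
  have "{\<omega>\<in>space M. good n t \<omega>} =
    {\<omega>\<in>space (F t). \<forall>q\<in>?D. norm (z (q * t) \<omega>) \<le> n \<and> norm (A (q * t) \<omega>) \<le> n \<and> norm (H (q * t) \<omega>) \<le> n}"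
    unfolding space_F
  proof (intro Collect_cong conj_cong refl)
    fix \<omega> assume \<omega>: "\<omega> \<in> space M"
    show "good n t \<omega> \<longleftrightarrow> (\<forall>q\<in>?D. norm (z (q * t) \<omega>) \<le> n \<and> norm (A (q * t) \<omega>) \<le> n \<and> norm (H (q * t) \<omega>) \<le> n)"
      using Icc_le_iff_rational[OF continuous_on_norm[OF z_cont[OF \<omega>]] assms, of n]
        Icc_le_iff_rational[OF continuous_on_norm[OF A_cont[OF \<omega>]] assms, of n]
        Icc_le_iff_rational[OF continuous_on_norm[OF H_cont[OF \<omega>]] assms, of n]
      unfolding good_def by blast
  qed
  also have "\<dots> \<in> sets (F t)"
  proof (rule sets.sets_Collect_countable_All')
    fix q assume q: "q \<in> ?D"
    have [measurable]: "z (q * t) \<in> borel_measurable (F t)" "A (q * t) \<in> borel_measurable (F t)" "H (q * t) \<in> borel_measurable (F t)"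
      using q assms by (auto intro!: F_mono[OF z_adapted, of "q * t"] F_mono[OF A_adapted, of "q * t"] F_mono[OF H_adapted, of "q * t"]
          mult_left_le_one_le)
    show "{\<omega>\<in>space (F t). norm (z (q * t) \<omega>) \<le> n \<and> norm (A (q * t) \<omega>) \<le> n \<and> norm (H (q * t) \<omega>) \<le> n} \<in> sets (F t)"
      by measurable
  next
    show "countable ?D" by (simp add: countable_Int2 countable_rat)
  qed
  finally show ?thesis .
qed

lemma good_sets_M: "0 \<le> t \<Longrightarrow> {\<omega>\<in>space M. good n t \<omega>} \<in> sets M"
  using good_sets sets_F_subset by blast

lemma killed_adapted:
  fixes X :: "real \<Rightarrow> 'a \<Rightarrow> 'c::euclidean_space"
  assumes "0 \<le> t" "X t \<in> borel_measurable (F t)"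
  shows "killed n X t \<in> borel_measurable (F t)"
  unfolding killed_def[abs_def]
  by (rule measurable_If) (use assms good_sets[OF assms(1)] in \<open>auto simp: space_F\<close>)

lemma killed_left_continuous:
  fixes X :: "real \<Rightarrow> 'a \<Rightarrow> 'c::euclidean_space"
  assumes "continuous_on {0..} (\<lambda>s. X s \<omega>)" "\<omega> \<in> space M"
  shows "left_continuous t (\<lambda>s. killed n X s \<omega>)"
  unfolding left_continuous_def
proof
  fix s assume "s \<in> {0<..t}"
  then have s: "0 < s" by simp
  show "((\<lambda>s. killed n X s \<omega>) \<longlongrightarrow> killed n X s \<omega>) (at_left s)"
  proof (cases "good n s \<omega>")
    case True
    have "\<forall>\<^sub>F r in at_left s. X r \<omega> = killed n X r \<omega>"
      using eventually_at_left_real[OF s] by eventually_elim (use good_antimono[OF True] in \<open>auto simp: killed_def\<close>)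
    then show ?thesis
      using tendsto_cong continuous_on_imp_at_left[OF assms(1) s] True by (fastforce simp: killed_def)
  next
    case False
    \<comment> \<open>Bounds valid at all times before \<open>s\<close> would pass to
      \<open>s\<close> by continuity. So the path has failed strictly earlier, and the killed
      process is constantly 0 just before \<open>s\<close>.\<close>
    have "\<exists>r\<in>{0..<s}. \<not> good n r \<omega>"
    proof (rule ccontr)
      assume "\<not> ?thesis"
      then have *: "\<forall>r\<in>{0..<s}. norm (z r \<omega>) \<le> n \<and> norm (A r \<omega>) \<le> n \<and> norm (H r \<omega>) \<le> n" by (auto simp: good_def)
      have "norm (z s \<omega>) \<le> n" "norm (A s \<omega>) \<le> n" "norm (H s \<omega>) \<le> n"
        using Icc_le_left_open[OF continuous_on_norm[OF z_cont[OF assms(2)]] s, of n]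
          Icc_le_left_open[OF continuous_on_norm[OF A_cont[OF assms(2)]] s, of n]
          Icc_le_left_open[OF continuous_on_norm[OF H_cont[OF assms(2)]] s, of n] * by auto
      then have "good n s \<omega>" using * unfolding good_def by (metis atLeastAtMost_iff atLeastLessThan_iff order_le_less)
      then show False using False by simp
    qed
    then obtain r where r: "r \<in> {0..<s}" "\<not> good n r \<omega>" by blast
    then have rs: "r < s" by simp
    have "0 = killed n X u \<omega>" if "r < u" for u
      using good_antimono[of n u \<omega> r] r that by (auto simp: killed_def)
    then have "\<forall>\<^sub>F u in at_left s. 0 = killed n X u \<omega>"
      using eventually_at_left_real[OF rs] by (auto elim: eventually_mono)
    then show ?thesis using False by (auto simp: killed_def[of n X s] intro: tendsto_eventually elim: eventually_mono)
  qed
qed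

section \<open>The Euler scheme of the killed coefficients and its mean square error\<close>

lemma killed_norm_le:
  assumes "0 \<le> n" "0 \<le> s"
  shows "norm (killed n A s \<omega>) \<le> n" "norm (killed n H s \<omega>) \<le> n"
  using assms by (auto simp: killed_def good_def)

text \<open>The coefficients are sampled along the given process and not along the scheme: this
  discretizes the integrals rather than an equation. Once a sampled grid time is no longer good,
  both coefficients are 0 and the scheme stays where it is.\<close>

definition euler :: "real \<Rightarrow> real \<Rightarrow> nat \<Rightarrow> nat \<Rightarrow> 'a \<Rightarrow> 'v" where
  "euler n t m i \<omega> = z0 + (\<Sum>j<i. (t / m) *\<^sub>R killed n A (grid_point t m j) \<omega> +
     L ((B (grid_point t m (Suc j)) \<omega> - B (grid_point t m j) \<omega>) *\<^sub>R killed n H (grid_point t m j) \<omega>))"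

text \<open>The first power in time suffices for the drift: its square is estimated by its maximum,
  at most \<open>2 * n * t\<close>, times this quantity.\<close>

definition drift_error :: "real \<Rightarrow> real \<Rightarrow> nat \<Rightarrow> ennreal" where
  "drift_error n t m = (\<integral>\<^sup>+\<omega>. (path_moment 1 t (\<lambda>s. grid_step t m (killed n A) s \<omega> - killed n A s \<omega>)) \<partial>M)"

definition noise_error :: "real \<Rightarrow> real \<Rightarrow> nat \<Rightarrow> ennreal" where
  "noise_error n t m = (\<integral>\<^sup>+\<omega>. (path_moment 2 t (\<lambda>s. grid_step t m (killed n H) s \<omega> - killed n H s \<omega>)) \<partial>M)"

lemma drift_error_tendsto: "0 \<le> t \<Longrightarrow> 0 \<le> n \<Longrightarrow> (\<lambda>m. drift_error n t (Suc m)) \<longlonglongrightarrow> 0"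
  unfolding drift_error_def
  by (rule grid_step_error[where K=n])
    (auto intro!: F_imp_M[OF killed_adapted] A_adapted killed_left_continuous A_cont killed_norm_le)

lemma noise_error_tendsto: "0 \<le> t \<Longrightarrow> 0 \<le> n \<Longrightarrow> (\<lambda>m. noise_error n t (Suc m)) \<longlonglongrightarrow> 0"
  unfolding noise_error_def
  by (rule grid_step_error[where K=n])
    (auto intro!: F_imp_M[OF killed_adapted] H_adapted killed_left_continuous H_cont killed_norm_le)

lemma euler_square_integrable:
  assumes "0 \<le> t" "0 \<le> n"
  shows "euler n t m i \<in> borel_measurable (F (grid_point t m i)) \<and> integrable M (\<lambda>\<omega>. (norm (euler n t m i \<omega>))^2)"
proof (induction i)
  case 0
  then show ?case by (simp add: euler_def)
next
  case (Suc i)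
  let ?u = "grid_point t m i" and ?v = "grid_point t m (Suc i)"
  have uv: "0 \<le> ?u" "?u \<le> ?v" using assms grid_point_nonneg grid_point_mono by auto
  define a where "a = killed n A ?u"
  define h where "h = killed n H ?u"
  have a: "a \<in> borel_measurable (F ?u)" and h: "h \<in> borel_measurable (F ?u)"
    unfolding a_def h_def using uv by (auto intro!: killed_adapted A_adapted H_adapted)
  have [measurable]: "a \<in> borel_measurable (F ?v)" "h \<in> borel_measurable (F ?v)" "euler n t m i \<in> borel_measurable (F ?v)"
    "B ?u \<in> borel_measurable (F ?v)" "B ?v \<in> borel_measurable (F ?v)"
    using F_mono[OF a uv(2)] F_mono[OF h uv(2)] F_mono[OF _ uv(2)] Suc F_mono[OF adapted uv(2)] adapted uv by auto
  have [measurable]: "L \<in> borel_measurable borel"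
    using L by (intro borel_measurable_continuous_onI linear_continuous_on)
  have e: "euler n t m (Suc i) = (\<lambda>\<omega>. euler n t m i \<omega> + ((t / m) *\<^sub>R a \<omega> + L ((B ?v \<omega> - B ?u \<omega>) *\<^sub>R h \<omega>)))"
    by (auto simp: euler_def a_def h_def add.assoc)
  have ab: "norm (a \<omega>) \<le> n" "norm (h \<omega>) \<le> n" for \<omega> unfolding a_def h_def using killed_norm_le assms uv by auto
  have [measurable]: "a \<in> borel_measurable M" "h \<in> borel_measurable M" "euler n t m i \<in> borel_measurable M"
    "B ?u \<in> borel_measurable M" "B ?v \<in> borel_measurable M"
    using F_imp_M a h Suc adapted uv by (auto intro: F_imp_M[OF adapted])
  have ia: "integrable M (\<lambda>\<omega>. (norm ((t / m) *\<^sub>R a \<omega>))^2)"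
    by (rule integrable_const_bound[where B="(t / m * n)^2"])
      (use ab assms in \<open>auto intro!: AE_I2 power_mono divide_right_mono mult_left_mono\<close>)
  have ih: "integrable M (\<lambda>\<omega>. (norm (L ((B ?v \<omega> - B ?u \<omega>) *\<^sub>R h \<omega>)))^2)"
  proof (rule Bochner_Integration.integrable_bound)
    have i: "integrable M (\<lambda>\<omega>. (norm (h \<omega>))^2)"
      by (rule integrable_const_bound[where B="n^2"]) (use ab in \<open>auto intro!: AE_I2 power_mono\<close>)
    have hm: "(\<lambda>\<omega>. (norm (h \<omega>))^2) \<in> borel_measurable (F ?u)" using h by measurable
    show "integrable M (\<lambda>\<omega>. (onorm L)^2 * ((norm (h \<omega>))^2 * (B ?v \<omega> - B ?u \<omega>)^2))"
      using increment_mult(3)[OF uv hm i] by simp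
    show "AE \<omega> in M. norm ((norm (L ((B ?v \<omega> - B ?u \<omega>) *\<^sub>R h \<omega>)))^2) \<le> norm ((onorm L)^2 * ((norm (h \<omega>))^2 * (B ?v \<omega> - B ?u \<omega>)^2))"
    proof (rule AE_I2)
      fix \<omega>
      have "norm (L ((B ?v \<omega> - B ?u \<omega>) *\<^sub>R h \<omega>)) \<le> onorm L * norm ((B ?v \<omega> - B ?u \<omega>) *\<^sub>R h \<omega>)" by (rule onorm[OF L])
      then have "(norm (L ((B ?v \<omega> - B ?u \<omega>) *\<^sub>R h \<omega>)))^2 \<le> (onorm L * norm ((B ?v \<omega> - B ?u \<omega>) *\<^sub>R h \<omega>))^2" by (intro power_mono) auto
      then show "norm ((norm (L ((B ?v \<omega> - B ?u \<omega>) *\<^sub>R h \<omega>)))^2) \<le> norm ((onorm L)^2 * ((norm (h \<omega>))^2 * (B ?v \<omega> - B ?u \<omega>)^2))"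
        by (simp add: power_mult_distrib mult_ac)
    qed
  qed measurable
  have "integrable M (\<lambda>\<omega>. (norm (euler n t m (Suc i) \<omega>))^2)"
    unfolding e by (intro integrable_norm_square_add ia ih) (use Suc in auto)
  moreover have "euler n t m (Suc i) \<in> borel_measurable (F ?v)" unfolding e by measurable
  ultimately show ?case by simp
qed

text \<open>While the path is good, \<open>killed n A\<close> equals \<open>A\<close>, so
  \<open>D\<close> is the integral of the error of the step process up to the grid time. Its norm
  has two bounds, the first path moment of that error and the constant \<open>2 * n * t\<close>; the
  product of the two bounds the square.\<close>

lemma drift_pathwise:
  assumes "0 \<le> t" "0 \<le> n" "i \<le> m" "0 < m" "\<omega> \<in> space M" "good n (grid_point t m i) \<omega>"
  defines "D \<equiv> (\<Sum>j<i. (t / m) *\<^sub>R killed n A (grid_point t m j) \<omega>) - integral {0..grid_point t m i} (\<lambda>s. A s \<omega>)"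
  shows "ennreal ((norm D)^2) \<le> ennreal (2 * n * t) * (path_moment 1 t (\<lambda>s. grid_step t m (killed n A) s \<omega> - killed n A s \<omega>))"
proof -
  define u where "u = grid_point t m i"
  let ?a = "killed n A"
  have u: "0 \<le> u" "u \<le> t" using grid_point_nonneg grid_point_le assms by (auto simp: u_def)
  have aA: "?a s \<omega> = A s \<omega>" if "s \<in> {0..u}" for s
    using good_antimono[OF assms(6), of s] that by (simp add: killed_def u_def)
  have "continuous_on {0..u} (\<lambda>s. A s \<omega>)" by (rule continuous_on_subset[OF A_cont[OF assms(5)]]) auto
  then have iA: "set_integrable lborel {0..u} (\<lambda>s. A s \<omega>)"
    by (rule borel_integrable_atLeastAtMost')
  then have I: "integrable lborel (\<lambda>s. indicat_real {0..u} s *\<^sub>R A s \<omega>)"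
    "integral {0..u} (\<lambda>s. A s \<omega>) = (LINT s|lborel. indicat_real {0..u} s *\<^sub>R A s \<omega>)"
    using set_borel_integral_eq_integral(2)[OF iA] by (auto simp: set_integrable_def set_lebesgue_integral_def)
  define G where "G s = (\<Sum>j<i. indicat_real {grid_point t m j<..grid_point t m (Suc j)} s *\<^sub>R ?a (grid_point t m j) \<omega>)" for s
  have iG1: "integrable lborel (\<lambda>s. indicat_real {grid_point t m j<..grid_point t m (Suc j)} s *\<^sub>R ?a (grid_point t m j) \<omega>)" for j
    by (intro integrable_scaleR_left) (use grid_point_mono[OF assms(1), of j "Suc j" m] in auto)
  have iG2: "(LINT s|lborel. indicat_real {grid_point t m j<..grid_point t m (Suc j)} s *\<^sub>R ?a (grid_point t m j) \<omega>) =
    (t / m) *\<^sub>R ?a (grid_point t m j) \<omega>" for j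
    using lborel_integral_step[OF grid_point_mono[OF assms(1), of j "Suc j" m]] by (simp add: grid_point_Suc)
  have iG: "integrable lborel G" unfolding G_def by (intro Bochner_Integration.integrable_sum iG1)
  have "(LINT s|lborel. G s) = (\<Sum>j<i. (t / m) *\<^sub>R ?a (grid_point t m j) \<omega>)"
    unfolding G_def by (subst Bochner_Integration.integral_sum[OF iG1]) (simp add: iG2)
  then have D: "D = (LINT s|lborel. G s - indicat_real {0..u} s *\<^sub>R A s \<omega>)"
    using I iG by (simp add: D_def u_def[symmetric])
  have G: "G s - indicat_real {0..u} s *\<^sub>R A s \<omega> = indicat_real {0..u} s *\<^sub>R (grid_step t m ?a s \<omega> - ?a s \<omega>)" for s
  proof -
    have "G s = indicat_real {0..u} s *\<^sub>R grid_step t m ?a s \<omega>"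
    proof (cases "s \<in> {0..u}")
      case True
      have "grid_step t m ?a s \<omega> = G s" unfolding grid_step_def G_def
      proof (rule sum.mono_neutral_right)
        show "\<forall>j\<in>{..<m} - {..<i}. indicat_real {grid_point t m j<..grid_point t m (Suc j)} s *\<^sub>R ?a (grid_point t m j) \<omega> = 0"
        proof
          fix j assume "j \<in> {..<m} - {..<i}"
          then have "u \<le> grid_point t m j" unfolding u_def by (intro grid_point_mono[OF assms(1)]) auto
          then show "indicat_real {grid_point t m j<..grid_point t m (Suc j)} s *\<^sub>R ?a (grid_point t m j) \<omega> = 0" using True by auto
        qed
      qed (use assms in auto)
      then show ?thesis using True by simp
    next
      case False
      have "indicat_real {grid_point t m j<..grid_point t m (Suc j)} s *\<^sub>R ?a (grid_point t m j) \<omega> = 0" if "j < i" for j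
      proof -
        have "0 \<le> grid_point t m j" "grid_point t m (Suc j) \<le> u"
          using grid_point_nonneg[OF assms(1)] grid_point_mono[OF assms(1), of "Suc j" i m] that by (auto simp: u_def)
        then have "s \<notin> {grid_point t m j<..grid_point t m (Suc j)}" using False by auto
        then show ?thesis by simp
      qed
      then have "G s = 0" unfolding G_def by (intro sum.neutral) auto
      then show ?thesis using False by simp
    qed
    then show ?thesis using aA[of s] by (auto simp: indicator_def)
  qed
  have n1: "ennreal (norm D) \<le> (\<integral>\<^sup>+s. ennreal (norm (G s - indicat_real {0..u} s *\<^sub>R A s \<omega>)) \<partial>lborel)"
    unfolding D by (rule integral_norm_bound_ennreal) (use iG I in auto)
  also have "\<dots> \<le> (path_moment 1 t (\<lambda>s. grid_step t m ?a s \<omega> - ?a s \<omega>))"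
    unfolding G by (rule nn_integral_mono) (use u in \<open>auto simp: indicator_def\<close>)
  finally have n2: "ennreal (norm D) \<le> (path_moment 1 t (\<lambda>s. grid_step t m ?a s \<omega> - ?a s \<omega>))" .
  have "\<dots> \<le> (\<integral>\<^sup>+s. ennreal (2 * n) * indicator {0..t} s \<partial>lborel)"
  proof (rule nn_integral_mono)
    fix s :: real
    show "ennreal ((norm (grid_step t m ?a s \<omega> - ?a s \<omega>))^1) * indicator {0..t} s \<le> ennreal (2 * n) * indicator {0..t} s"
    proof (cases "s \<in> {0..t}")
      case True
      have "norm (grid_step t m ?a s \<omega>) \<le> n" "norm (?a s \<omega>) \<le> n"
        using grid_step_norm_le[of t s ?a \<omega> n m] killed_norm_le(1)[OF assms(2)] True assms by auto
      then show ?thesis using norm_triangle_ineq4[of "grid_step t m ?a s \<omega>" "?a s \<omega>"] True by (auto intro!: ennreal_leI)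
    qed simp
  qed
  also have "\<dots> = ennreal (2 * n * t)" using assms by (simp add: nn_integral_cmult_indicator ennreal_mult')
  finally have "ennreal (norm D) \<le> ennreal (2 * n * t)" using n2 by (rule order_trans[rotated])
  then have "ennreal (norm D) * ennreal (norm D) \<le> ennreal (2 * n * t) * (path_moment 1 t (\<lambda>s. grid_step t m ?a s \<omega> - ?a s \<omega>))"
    using n2 by (intro mult_mono) auto
  then show ?thesis by (simp add: power2_eq_square ennreal_mult)
qed

text \<open>The drift part is bounded path by path, the noise part by
  \<open>ito_integral_localized\<close> with the killed noise coefficient on the good event.
  Splitting the square into the two parts doubles both, hence \<open>4 * n * t\<close> from
  \<open>2 * n * t\<close> and 8 from 4.\<close>

lemma euler_error:
  assumes "0 \<le> t" "0 \<le> n" "i \<le> m" "0 < m"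
  shows "(\<integral>\<^sup>+\<omega>\<in>{\<omega>\<in>space M. good n (grid_point t m i) \<omega>}. ennreal ((norm (euler n t m i \<omega> - z (grid_point t m i) \<omega>))^2) \<partial>M)
    \<le> ennreal (4 * n * t) * drift_error n t m + ennreal (8 * (onorm L)^2) * noise_error n t m"
proof -
  define u where "u = grid_point t m i"
  have u: "0 \<le> u" "u \<le> t" using grid_point_nonneg grid_point_le assms by (auto simp: u_def)
  obtain J where J: "has_ito_integral M F B u H J" "AE \<omega> in M. z u \<omega> = z0 + integral {0..u} (\<lambda>s. A s \<omega>) + L (J \<omega>)"
    using ito_process[OF u(1)] by blast
  define G where "G = {\<omega>\<in>space M. good n u \<omega>}"
  have G [measurable]: "G \<in> sets M" unfolding G_def by (rule good_sets_M[OF u(1)])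
  have HG: "killed n H s \<omega> = H s \<omega>" if "\<omega> \<in> G" "s \<in> {0..u}" for s \<omega>
    using good_antimono[of n u \<omega> s] that by (auto simp: G_def killed_def)
  define I where "I \<omega> = (\<Sum>j<m. (B (min u (grid_point t m (Suc j))) \<omega> - B (min u (grid_point t m j)) \<omega>) *\<^sub>R killed n H (grid_point t m j) \<omega>)" for \<omega>
  have S: "simple_ito_integral M F B u (grid_step t m (killed n H)) I"
    unfolding I_def[abs_def] by (rule grid_step_simple[where K=n]) (use assms in \<open>auto intro!: killed_adapted H_adapted killed_norm_le\<close>)
  \<comment> \<open>Since \<open>u\<close> is the \<open>i\<close>-th grid point, clipping at
    \<open>u\<close> leaves the first \<open>i\<close> increments unchanged and turns the others
    into 0.\<close>
  have I: "I \<omega> = (\<Sum>j<i. (B (grid_point t m (Suc j)) \<omega> - B (grid_point t m j) \<omega>) *\<^sub>R killed n H (grid_point t m j) \<omega>)" for \<omega>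
  proof -
    have "I \<omega> = (\<Sum>j<i. (B (min u (grid_point t m (Suc j))) \<omega> - B (min u (grid_point t m j)) \<omega>) *\<^sub>R killed n H (grid_point t m j) \<omega>)"
      unfolding I_def
    proof (rule sum.mono_neutral_right)
      show "\<forall>j\<in>{..<m} - {..<i}. (B (min u (grid_point t m (Suc j))) \<omega> - B (min u (grid_point t m j)) \<omega>) *\<^sub>R killed n H (grid_point t m j) \<omega> = 0"
      proof
        fix j assume "j \<in> {..<m} - {..<i}"
        then have "u \<le> grid_point t m j" "u \<le> grid_point t m (Suc j)" unfolding u_def by (auto intro!: grid_point_mono[OF assms(1)])
        then show "(B (min u (grid_point t m (Suc j))) \<omega> - B (min u (grid_point t m j)) \<omega>) *\<^sub>R killed n H (grid_point t m j) \<omega> = 0" by (simp add: min_absorb1)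
      qed
    qed (use assms in auto)
    also have "\<dots> = (\<Sum>j<i. (B (grid_point t m (Suc j)) \<omega> - B (grid_point t m j) \<omega>) *\<^sub>R killed n H (grid_point t m j) \<omega>)"
    proof (rule sum.cong)
      fix j assume "j \<in> {..<i}"
      then have "grid_point t m j \<le> u" "grid_point t m (Suc j) \<le> u" unfolding u_def by (auto intro!: grid_point_mono[OF assms(1)])
      then show "(B (min u (grid_point t m (Suc j))) \<omega> - B (min u (grid_point t m j)) \<omega>) *\<^sub>R killed n H (grid_point t m j) \<omega> =
        (B (grid_point t m (Suc j)) \<omega> - B (grid_point t m j) \<omega>) *\<^sub>R killed n H (grid_point t m j) \<omega>" by (simp add: min_absorb2)
    qed simp
    finally show ?thesis .
  qed
  have [measurable]: "I \<in> borel_measurable M" by (rule simple_ito_isometry(1)[OF u(1) S])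
  have [measurable]: "J \<in> borel_measurable M" using J(1) by (simp add: has_ito_integral_def)
  have noise: "(\<integral>\<^sup>+\<omega>\<in>G. ennreal ((norm (J \<omega> - I \<omega>))^2) \<partial>M) \<le> 4 * noise_error n t m"
  proof -
    have "(\<integral>\<^sup>+\<omega>\<in>G. ennreal ((norm (J \<omega> - I \<omega>))^2) \<partial>M) \<le>
      4 * (\<integral>\<^sup>+\<omega>. (path_moment 2 u (\<lambda>s. grid_step t m (killed n H) s \<omega> - killed n H s \<omega>)) \<partial>M)"
    proof (rule ito_integral_localized[OF u(1) J(1) _ _ _ _ _ G HG S, where K=n])
      fix \<omega> assume "\<omega> \<in> space M" then show "left_continuous u (\<lambda>s. H s \<omega>)"
        unfolding left_continuous_def using continuous_on_imp_at_left[OF H_cont] by auto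
    qed (use assms in \<open>auto intro!: killed_adapted H_adapted killed_norm_le killed_left_continuous H_cont\<close>)
    also have "\<dots> \<le> 4 * noise_error n t m"
      unfolding noise_error_def by (intro mult_left_mono nn_integral_mono) (use u in \<open>auto simp: indicator_def\<close>)
    finally show ?thesis .
  qed
  let ?d = "\<lambda>\<omega>. path_moment 1 t (\<lambda>s. grid_step t m (killed n A) s \<omega> - killed n A s \<omega>)"
  define dq where "dq \<omega> = ?d \<omega>" for \<omega>
  have [measurable]: "dq \<in> borel_measurable M"
    unfolding dq_def[abs_def]
    by (rule set_nn_integral_power_measurable(1)[OF indicator_diff_measurable[OF indicator_measurable[OF grid_step_measurable] left_continuous_measurable]])
      (use assms in \<open>auto intro!: F_imp_M[OF killed_adapted] A_adapted killed_left_continuous A_cont\<close>)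
  have de: "drift_error n t m = (\<integral>\<^sup>+\<omega>. dq \<omega> \<partial>M)" by (simp only: drift_error_def dq_def)
  have "AE \<omega> in M. ennreal ((norm (euler n t m i \<omega> - z u \<omega>))^2) * indicator G \<omega> \<le>
    ennreal (4 * n * t) * dq \<omega> + ennreal (2 * (onorm L)^2) * (ennreal ((norm (J \<omega> - I \<omega>))^2) * indicator G \<omega>)"
    using J(2) AE_space
  proof eventually_elim
    fix \<omega> assume z: "z u \<omega> = z0 + integral {0..u} (\<lambda>s. A s \<omega>) + L (J \<omega>)" and \<omega>: "\<omega> \<in> space M"
    show "ennreal ((norm (euler n t m i \<omega> - z u \<omega>))^2) * indicator G \<omega> \<le>
      ennreal (4 * n * t) * dq \<omega> + ennreal (2 * (onorm L)^2) * (ennreal ((norm (J \<omega> - I \<omega>))^2) * indicator G \<omega>)"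
    proof (cases "\<omega> \<in> G")
      case True
      define D where "D = (\<Sum>j<i. (t / m) *\<^sub>R killed n A (grid_point t m j) \<omega>) - integral {0..u} (\<lambda>s. A s \<omega>)"
      have LI: "L (I \<omega>) = (\<Sum>j<i. L ((B (grid_point t m (Suc j)) \<omega> - B (grid_point t m j) \<omega>) *\<^sub>R killed n H (grid_point t m j) \<omega>))"
        unfolding I by (rule linear_sum[OF bounded_linear.linear[OF L]])
      have "euler n t m i \<omega> - z u \<omega> = D - L (J \<omega> - I \<omega>)"
        unfolding z euler_def D_def linear_diff[OF bounded_linear.linear[OF L]] LI by (simp add: sum.distrib)
      then have "(norm (euler n t m i \<omega> - z u \<omega>))^2 \<le> 2 * (norm D)^2 + 2 * (norm (L (J \<omega> - I \<omega>)))^2"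
        using norm_square_diff_le by simp
      also have "\<dots> \<le> 2 * (norm D)^2 + 2 * (onorm L)^2 * (norm (J \<omega> - I \<omega>))^2"
        using power_mono[OF onorm[OF L, of "J \<omega> - I \<omega>"], of 2] by (simp add: power_mult_distrib)
      finally have "ennreal ((norm (euler n t m i \<omega> - z u \<omega>))^2) \<le> ennreal (2 * (norm D)^2 + 2 * (onorm L)^2 * (norm (J \<omega> - I \<omega>))^2)"
        by (rule ennreal_leI)
      also have "\<dots> = 2 * ennreal ((norm D)^2) + ennreal (2 * (onorm L)^2) * ennreal ((norm (J \<omega> - I \<omega>))^2)"
        by (simp add: ennreal_plus ennreal_mult')
      also have "\<dots> \<le> 2 * (ennreal (2 * n * t) * dq \<omega>) + ennreal (2 * (onorm L)^2) * ennreal ((norm (J \<omega> - I \<omega>))^2)"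
        using drift_pathwise[OF assms \<omega>] True unfolding D_def u_def G_def dq_def by (intro add_right_mono mult_left_mono) auto
      also have "2 * (ennreal (2 * n * t) * dq \<omega>) = ennreal (4 * n * t) * dq \<omega>"
        using assms by (simp add: mult.assoc[symmetric] flip: ennreal_numeral ennreal_mult)
      finally show ?thesis using True by simp
    qed simp
  qed
  then have "(\<integral>\<^sup>+\<omega>\<in>G. ennreal ((norm (euler n t m i \<omega> - z u \<omega>))^2) \<partial>M) \<le>
    (\<integral>\<^sup>+\<omega>. ennreal (4 * n * t) * dq \<omega> + ennreal (2 * (onorm L)^2) * (ennreal ((norm (J \<omega> - I \<omega>))^2) * indicator G \<omega>) \<partial>M)"
    by (rule nn_integral_mono_AE)
  also have "\<dots> = ennreal (4 * n * t) * drift_error n t m + ennreal (2 * (onorm L)^2) * (\<integral>\<^sup>+\<omega>\<in>G. ennreal ((norm (J \<omega> - I \<omega>))^2) \<partial>M)"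
    unfolding de by (subst nn_integral_add) (auto simp: nn_integral_cmult)
  also have "\<dots> \<le> ennreal (4 * n * t) * drift_error n t m + ennreal (2 * (onorm L)^2) * (4 * noise_error n t m)"
    by (intro add_left_mono mult_left_mono noise) auto
  also have "ennreal (2 * (onorm L)^2) * (4 * noise_error n t m) = ennreal (8 * (onorm L)^2) * noise_error n t m"
    by (simp add: mult.assoc[symmetric] flip: ennreal_numeral ennreal_mult)
  finally show ?thesis unfolding G_def u_def .
qed

section \<open>The quadratic form along the scheme\<close>

lemma P_quadratic:
  shows "\<bar>x \<bullet> P y\<bar> \<le> onorm P * norm x * norm y"
    "\<bar>x \<bullet> P x - y \<bullet> P y\<bar> \<le> onorm P * norm (x - y) * (norm (x - y) + 2 * norm y)"
    "(x + c *\<^sub>R y) \<bullet> P (x + c *\<^sub>R y) = x \<bullet> P x + 2 * c * (x \<bullet> P y) + c^2 * (y \<bullet> P y)"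
proof -
  have PL: "linear P" by (rule bounded_linear.linear[OF P])
  show 1: "\<bar>x \<bullet> P y\<bar> \<le> onorm P * norm x * norm y" for x y
  proof -
    have "\<bar>x \<bullet> P y\<bar> \<le> norm x * norm (P y)" by (rule Cauchy_Schwarz_ineq2)
    also have "\<dots> \<le> norm x * (onorm P * norm y)" by (intro mult_left_mono onorm[OF P]) auto
    finally show ?thesis by (simp add: mult_ac)
  qed
  have "x \<bullet> P x - y \<bullet> P y = (x - y) \<bullet> P (x + y)"
    using P_sym[of y x] by (simp add: linear_add[OF PL] inner_diff_left inner_add_right inner_commute[of "P y" x])
  then have "\<bar>x \<bullet> P x - y \<bullet> P y\<bar> \<le> onorm P * norm (x - y) * norm (x + y)" using 1 by simp
  also have "\<dots> \<le> onorm P * norm (x - y) * (norm (x - y) + 2 * norm y)"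
  proof (intro mult_left_mono)
    show "norm (x + y) \<le> norm (x - y) + 2 * norm y"
      using norm_triangle_ineq[of "x - y" "y + y"] norm_triangle_ineq[of y y] by simp
  qed (use onorm_pos_le[OF P] in auto)
  finally show "\<bar>x \<bullet> P x - y \<bullet> P y\<bar> \<le> onorm P * norm (x - y) * (norm (x - y) + 2 * norm y)" .
  show "(x + c *\<^sub>R y) \<bullet> P (x + c *\<^sub>R y) = x \<bullet> P x + 2 * c * (x \<bullet> P y) + c^2 * (y \<bullet> P y)"
    using P_sym[of y x]
    by (simp add: linear_add[OF PL] linear_scale[OF PL] inner_add_left inner_add_right power2_eq_square inner_commute[of "P y" x] algebra_simps)
qed

lemma integrable_P:
  fixes X Y :: "'a \<Rightarrow> 'v"
  assumes [measurable]: "X \<in> borel_measurable M" "Y \<in> borel_measurable M"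
    and "integrable M (\<lambda>x. (norm (X x))^2)" "integrable M (\<lambda>x. (norm (Y x))^2)"
  shows "integrable M (\<lambda>x. X x \<bullet> P (Y x))"
proof (rule integrable_inner_square)
  have [measurable]: "P \<in> borel_measurable borel"
    using P by (intro borel_measurable_continuous_onI linear_continuous_on)
  show "(\<lambda>x. P (Y x)) \<in> borel_measurable M" by measurable
  show "integrable M (\<lambda>x. (norm (P (Y x)))^2)"
  proof (rule Bochner_Integration.integrable_bound)
    show "integrable M (\<lambda>x. (onorm P)^2 * (norm (Y x))^2)" using assms by auto
    have "(norm (P (Y x)))^2 \<le> (onorm P)^2 * (norm (Y x))^2" for x
      using power_mono[OF onorm[OF P, of "Y x"], of 2] by (simp add: power_mult_distrib)
    then show "AE x in M. norm ((norm (P (Y x)))^2) \<le> norm ((onorm P)^2 * (norm (Y x))^2)" by simp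
  qed measurable
qed (use assms in auto)

definition energy :: "real \<Rightarrow> real \<Rightarrow> nat \<Rightarrow> nat \<Rightarrow> real" where
  "energy n t m i = expectation (\<lambda>\<omega>. indicat_real {\<omega>\<in>space M. good n (grid_point t m i) \<omega>} \<omega> * (euler n t m i \<omega> \<bullet> P (euler n t m i \<omega>)))"

text \<open>The left side is what remains of the form after one Euler step from \<open>y\<close>
  when the noise increment is averaged out. Dissipation is known at the state
  \<open>z t \<omega>\<close> only; moving it to \<open>y\<close> costs terms in
  \<open>norm (y - z t \<omega>)\<close>, and \<open>\<theta>\<close> converts the linear one into a
  square.\<close>

lemma one_step_pathwise:
  assumes t: "0 \<le> t" and n: "0 \<le> n" and g: "good n t \<omega>" and \<omega>: "\<omega> \<in> space M" and d: "0 \<le> \<delta>" and \<theta>: "0 < \<theta>"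
  shows "(y + \<delta> *\<^sub>R A t \<omega>) \<bullet> P (y + \<delta> *\<^sub>R A t \<omega>) + \<delta> * (L (H t \<omega>) \<bullet> P (L (H t \<omega>))) \<le>
    (1 - \<alpha> * \<delta>) * (y \<bullet> P y) + \<delta> * (C + onorm P * (2 * n + 2 * \<alpha> * n) * (\<theta> + (norm (y - z t \<omega>))^2 / \<theta>)
      + \<alpha> * onorm P * (norm (y - z t \<omega>))^2 + \<delta> * (onorm P * n^2))"
proof -
  let ?z = "z t \<omega>" and ?A = "A t \<omega>" and ?H = "L (H t \<omega>)"
  define x where "x = norm (y - ?z)"
  have b: "norm ?z \<le> n" "norm ?A \<le> n" using g t by (auto simp: good_def)
  have p: "0 \<le> onorm P" by (rule onorm_pos_le[OF P])
  have e: "(y + \<delta> *\<^sub>R ?A) \<bullet> P (y + \<delta> *\<^sub>R ?A) = y \<bullet> P y + 2 * \<delta> * (y \<bullet> P ?A) + \<delta>^2 * (?A \<bullet> P ?A)" by (rule P_quadratic)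
  have 1: "y \<bullet> P ?A \<le> ?z \<bullet> P ?A + onorm P * n * x"
  proof -
    have "y \<bullet> P ?A = ?z \<bullet> P ?A + (y - ?z) \<bullet> P ?A" by (simp add: inner_diff_left)
    also have "(y - ?z) \<bullet> P ?A \<le> onorm P * norm (y - ?z) * norm ?A" using P_quadratic(1)[of "y - ?z" ?A] by simp
    also have "\<dots> \<le> onorm P * x * n" unfolding x_def by (intro mult_left_mono b) (use p in auto)
    finally show ?thesis by (simp add: mult_ac)
  qed
  have 2: "?A \<bullet> P ?A \<le> onorm P * n^2"
  proof -
    have "?A \<bullet> P ?A \<le> onorm P * (norm ?A * norm ?A)" using P_quadratic(1)[of ?A ?A] by (simp add: mult.assoc)
    also have "\<dots> \<le> onorm P * (n * n)" by (intro mult_left_mono mult_mono b p) (use n in auto)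
    finally show ?thesis by (simp add: power2_eq_square)
  qed
  have 3: "y \<bullet> P y - ?z \<bullet> P ?z \<le> onorm P * x * (x + 2 * n)"
  proof -
    have "y \<bullet> P y - ?z \<bullet> P ?z \<le> onorm P * x * (x + 2 * norm ?z)" using P_quadratic(2)[of y ?z] by (simp add: x_def)
    also have "\<dots> \<le> onorm P * x * (x + 2 * n)" by (intro mult_left_mono add_mono b) (use p in \<open>auto simp: x_def b\<close>)
    finally show ?thesis .
  qed
  have 4: "2 * (?z \<bullet> P ?A) + ?H \<bullet> P ?H \<le> C - \<alpha> * (?z \<bullet> P ?z)" by (rule dissipative[OF t \<omega>])
  have 5: "- \<alpha> * (?z \<bullet> P ?z) \<le> - \<alpha> * (y \<bullet> P y) + \<alpha> * (onorm P * x * (x + 2 * n))"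
    using mult_left_mono[OF 3, of \<alpha>] \<alpha>_pos by (simp add: algebra_simps)
  have 6: "x \<le> \<theta> + x^2 / \<theta>" by (rule le_add_square_divide[OF \<theta>]) (simp add: x_def)
  have 7: "onorm P * (2 * n + 2 * \<alpha> * n) * x \<le> onorm P * (2 * n + 2 * \<alpha> * n) * (\<theta> + x^2 / \<theta>)"
    by (intro mult_left_mono 6) (use p n \<alpha>_pos in auto)
  have "2 * (y \<bullet> P ?A) + \<delta> * (?A \<bullet> P ?A) + ?H \<bullet> P ?H \<le>
    - \<alpha> * (y \<bullet> P y) + (C + onorm P * (2 * n + 2 * \<alpha> * n) * (\<theta> + x^2 / \<theta>) + \<alpha> * onorm P * x^2 + \<delta> * (onorm P * n^2))"
    using 1 4 5 7 mult_left_mono[OF 2 d] by (simp add: algebra_simps power2_eq_square)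
  from mult_left_mono[OF this d] show ?thesis unfolding e x_def[symmetric]
    by (simp add: algebra_simps power2_eq_square)
qed

text \<open>First the event for the next grid time is enlarged to \<open>G\<close>, the event for
  the present one, which is allowed because the form is nonnegative. \<open>G\<close> is known
  before the increment, so the cross term averages to 0 and the squared increment to
  \<open>\<delta>\<close>; then \<open>one_step_pathwise\<close> applies on
  \<open>G\<close>.\<close>

lemma energy_step:
  assumes "0 \<le> t" "0 \<le> n" "i < m" "0 < \<theta>" "0 \<le> \<epsilon>"
    and err: "(\<integral>\<^sup>+\<omega>\<in>{\<omega>\<in>space M. good n (grid_point t m i) \<omega>}. ennreal ((norm (euler n t m i \<omega> - z (grid_point t m i) \<omega>))^2) \<partial>M) \<le> ennreal \<epsilon>"
  shows "energy n t m (Suc i) \<le> (1 - \<alpha> * (t / m)) * energy n t m i + (t / m) * (C +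
    onorm P * (2 * n + 2 * \<alpha> * n) * (\<theta> + \<epsilon> / \<theta>) + \<alpha> * onorm P * \<epsilon> + (t / m) * (onorm P * n^2))"
proof -
  define \<delta> where "\<delta> = t / m"
  define u where "u = grid_point t m i"
  define v where "v = grid_point t m (Suc i)"
  have uv: "0 \<le> u" "u \<le> v" "v - u = \<delta>" using assms grid_point_nonneg grid_point_mono[of t i "Suc i" m] by (auto simp: u_def v_def \<delta>_def grid_point_Suc)
  have d: "0 \<le> \<delta>" using assms by (simp add: \<delta>_def)
  have p: "0 \<le> onorm P" by (rule onorm_pos_le[OF P])
  define G where "G = {\<omega>\<in>space M. good n u \<omega>}"
  have GF [measurable]: "G \<in> sets (F u)" and G [measurable]: "G \<in> sets M" unfolding G_def using good_sets good_sets_M uv by auto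
  define Y where "Y = euler n t m i"
  define a where "a = killed n A u"
  define h where "h = killed n H u"
  have YF [measurable]: "Y \<in> borel_measurable (F u)" and Yi: "integrable M (\<lambda>\<omega>. (norm (Y \<omega>))^2)"
    using euler_square_integrable[OF assms(1,2)] by (auto simp: Y_def u_def)
  have aF [measurable]: "a \<in> borel_measurable (F u)" and hF [measurable]: "h \<in> borel_measurable (F u)"
    unfolding a_def h_def using uv by (auto intro!: killed_adapted A_adapted H_adapted)
  have [measurable]: "L \<in> borel_measurable borel" "P \<in> borel_measurable borel"
    using L P by (auto intro!: borel_measurable_continuous_onI linear_continuous_on)
  have [measurable]: "Y \<in> borel_measurable M" "a \<in> borel_measurable M" "h \<in> borel_measurable M" "z u \<in> borel_measurable M"
    using F_imp_M[OF YF] F_imp_M[OF aF] F_imp_M[OF hF] F_imp_M[OF z_adapted[OF uv(1)]] by auto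
  have ab: "norm (a \<omega>) \<le> n" "norm (h \<omega>) \<le> n" for \<omega> unfolding a_def h_def using killed_norm_le assms uv by auto
  have ia: "integrable M (\<lambda>\<omega>. (norm (\<delta> *\<^sub>R a \<omega>))^2)"
    by (rule integrable_const_bound[where B="(\<delta> * n)^2"])
      (use ab d in \<open>auto intro!: AE_I2 power_mono mult_mono simp: power_mult_distrib\<close>)
  have ih: "integrable M (\<lambda>\<omega>. (norm (L (h \<omega>)))^2)"
  proof (rule integrable_const_bound[where B="(onorm L * n)^2"])
    have "norm (L (h \<omega>)) \<le> onorm L * n" for \<omega>
      using order_trans[OF onorm[OF L] mult_left_mono[OF ab(2) onorm_pos_le[OF L]]] .
    then show "AE \<omega> in M. norm ((norm (L (h \<omega>)))^2) \<le> (onorm L * n)^2" by (intro AE_I2) (simp add: power_mono)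
  qed measurable
  define W where "W \<omega> = Y \<omega> + \<delta> *\<^sub>R a \<omega>" for \<omega>
  have WF [measurable]: "W \<in> borel_measurable (F u)" and W [measurable]: "W \<in> borel_measurable M" unfolding W_def by measurable
  have iW: "integrable M (\<lambda>\<omega>. (norm (W \<omega>))^2)" unfolding W_def by (rule integrable_norm_square_add[OF _ _ Yi ia]) measurable
  have Y': "euler n t m (Suc i) = (\<lambda>\<omega>. W \<omega> + (B v \<omega> - B u \<omega>) *\<^sub>R L (h \<omega>))"
    by (auto simp: euler_def W_def Y_def a_def h_def u_def v_def \<delta>_def add.assoc linear_scale[OF bounded_linear.linear[OF L]])
  let ?X1 = "\<lambda>\<omega>. indicat_real G \<omega> * (W \<omega> \<bullet> P (L (h \<omega>)))"
  let ?X2 = "\<lambda>\<omega>. indicat_real G \<omega> * (L (h \<omega>) \<bullet> P (L (h \<omega>)))"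
  let ?X0 = "\<lambda>\<omega>. indicat_real G \<omega> * (W \<omega> \<bullet> P (W \<omega>))"
  have i0: "integrable M ?X0" and i1: "integrable M ?X1" and i2: "integrable M ?X2" and iY: "integrable M (\<lambda>\<omega>. indicat_real G \<omega> * (Y \<omega> \<bullet> P (Y \<omega>)))"
    by (intro integrable_real_mult_indicator[OF G, unfolded mult.commute[of _ "indicat_real G _"]] integrable_P iW ih Yi; measurable)+
  have m1: "?X1 \<in> borel_measurable (F u)" "?X2 \<in> borel_measurable (F u)" by measurable
  note n1 = increment_mult[OF uv(1,2) m1(1) i1] and n2 = increment_mult[OF uv(1,2) m1(2) i2]
  have iY': "integrable M (\<lambda>\<omega>. (norm (euler n t m (Suc i) \<omega>))^2)" "euler n t m (Suc i) \<in> borel_measurable M"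
    using euler_square_integrable[OF assms(1,2), of m "Suc i"] F_imp_M by blast+
  have e: "indicat_real G \<omega> * (euler n t m (Suc i) \<omega> \<bullet> P (euler n t m (Suc i) \<omega>)) =
    ?X0 \<omega> + 2 * (?X1 \<omega> * (B v \<omega> - B u \<omega>)) + ?X2 \<omega> * (B v \<omega> - B u \<omega>)^2" for \<omega>
    unfolding Y' P_quadratic(3) by (simp add: algebra_simps)
  have iG': "integrable M (\<lambda>\<omega>. indicat_real G \<omega> * (euler n t m (Suc i) \<omega> \<bullet> P (euler n t m (Suc i) \<omega>)))"
    unfolding e using i0 n1(1) n2(3) by auto
  have "energy n t m (Suc i) \<le> expectation (\<lambda>\<omega>. indicat_real G \<omega> * (euler n t m (Suc i) \<omega> \<bullet> P (euler n t m (Suc i) \<omega>)))"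
    unfolding energy_def
  proof (rule integral_mono)
    have "{\<omega>\<in>space M. good n v \<omega>} \<in> sets M" using good_sets_M uv by auto
    then show "integrable M (\<lambda>\<omega>. indicat_real {\<omega>\<in>space M. good n (grid_point t m (Suc i)) \<omega>} \<omega> * (euler n t m (Suc i) \<omega> \<bullet> P (euler n t m (Suc i) \<omega>)))"
      unfolding v_def
      by (rule integrable_real_mult_indicator[unfolded mult.commute[of _ "indicat_real _ _"]]) (intro integrable_P iY')
    show "integrable M (\<lambda>\<omega>. indicat_real G \<omega> * (euler n t m (Suc i) \<omega> \<bullet> P (euler n t m (Suc i) \<omega>)))" by (rule iG')
    fix \<omega> assume "\<omega> \<in> space M"
    have "indicat_real {\<omega>\<in>space M. good n v \<omega>} \<omega> \<le> indicat_real G \<omega>"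
      using good_antimono[of n v \<omega> u] uv by (auto simp: indicator_def G_def)
    then show "indicat_real {\<omega>\<in>space M. good n (grid_point t m (Suc i)) \<omega>} \<omega> * (euler n t m (Suc i) \<omega> \<bullet> P (euler n t m (Suc i) \<omega>))
      \<le> indicat_real G \<omega> * (euler n t m (Suc i) \<omega> \<bullet> P (euler n t m (Suc i) \<omega>))"
      unfolding v_def by (rule mult_right_mono) (rule P_psd)
  qed
  also have "\<dots> = expectation (\<lambda>\<omega>. ?X0 \<omega> + \<delta> * ?X2 \<omega>)"
    unfolding e using i0 i2 n1 n2 uv by simp
  also have "\<dots> \<le> expectation (\<lambda>\<omega>. (1 - \<alpha> * \<delta>) * (indicat_real G \<omega> * (Y \<omega> \<bullet> P (Y \<omega>))) + (\<delta> * (C + onorm P * (2 * n + 2 * \<alpha> * n) * \<theta> + \<delta> * (onorm P * n^2))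
    + \<delta> * (onorm P * (2 * n + 2 * \<alpha> * n) / \<theta> + \<alpha> * onorm P) * (indicat_real G \<omega> * (norm (Y \<omega> - z u \<omega>))^2)))"
    (is "_ \<le> expectation ?R")
  proof (rule integral_mono)
    show "integrable M (\<lambda>\<omega>. ?X0 \<omega> + \<delta> * ?X2 \<omega>)" using i0 i2 by auto
    have iE: "integrable M (\<lambda>\<omega>. indicat_real G \<omega> * (norm (Y \<omega> - z u \<omega>))^2)"
    proof (rule integrableI_bounded)
      have "(\<integral>\<^sup>+\<omega>. ennreal (norm (indicat_real G \<omega> * (norm (Y \<omega> - z u \<omega>))^2)) \<partial>M) \<le> ennreal \<epsilon>"
        using err unfolding G_def[symmetric] u_def[symmetric] Y_def[symmetric]
        by (simp add: ennreal_mult' ennreal_indicator[symmetric] mult.commute)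
      then show "(\<integral>\<^sup>+\<omega>. ennreal (norm (indicat_real G \<omega> * (norm (Y \<omega> - z u \<omega>))^2)) \<partial>M) < \<infinity>"
        by (rule order.strict_trans1) simp
    qed measurable
    then show "integrable M ?R" using iY by auto
    fix \<omega> assume \<omega>: "\<omega> \<in> space M"
    show "?X0 \<omega> + \<delta> * ?X2 \<omega> \<le> ?R \<omega>"
    proof (cases "\<omega> \<in> G")
      case True
      then have g: "good n u \<omega>" by (simp add: G_def)
      then have "a \<omega> = A u \<omega>" "h \<omega> = H u \<omega>" by (auto simp: a_def h_def killed_def)
      then show ?thesis
        using one_step_pathwise[OF uv(1) assms(2) g \<omega> d assms(4), of "Y \<omega>"] True
        by (simp add: W_def algebra_simps add_divide_distrib)
    next
      \<comment> \<open>Off \<open>G\<close> all terms carrying the indicator vanish, and the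
        constant part, which has none, is nonnegative.\<close>
      case False
      have "0 \<le> \<delta> * (C + onorm P * (2 * n + 2 * \<alpha> * n) * \<theta> + \<delta> * (onorm P * n^2))"
        using d C_nonneg p assms \<alpha>_pos by simp
      then show ?thesis using False by simp
    qed
  qed
  also have "\<dots> \<le> (1 - \<alpha> * \<delta>) * energy n t m i + (\<delta> * (C + onorm P * (2 * n + 2 * \<alpha> * n) * \<theta> + \<delta> * (onorm P * n^2))
    + \<delta> * (onorm P * (2 * n + 2 * \<alpha> * n) / \<theta> + \<alpha> * onorm P) * \<epsilon>)"
  proof -
    have iE: "integrable M (\<lambda>\<omega>. indicat_real G \<omega> * (norm (Y \<omega> - z u \<omega>))^2)" and
      E: "expectation (\<lambda>\<omega>. indicat_real G \<omega> * (norm (Y \<omega> - z u \<omega>))^2) \<le> \<epsilon>"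
    proof -
      have *: "(\<integral>\<^sup>+\<omega>. ennreal (norm (indicat_real G \<omega> * (norm (Y \<omega> - z u \<omega>))^2)) \<partial>M) \<le> ennreal \<epsilon>"
        using err unfolding G_def[symmetric] u_def[symmetric] Y_def[symmetric]
        by (simp add: ennreal_mult' ennreal_indicator[symmetric] mult.commute)
      show i: "integrable M (\<lambda>\<omega>. indicat_real G \<omega> * (norm (Y \<omega> - z u \<omega>))^2)"
        by (rule integrableI_bounded) (use * in \<open>auto intro: order.strict_trans1\<close>)
      have "ennreal (expectation (\<lambda>\<omega>. indicat_real G \<omega> * (norm (Y \<omega> - z u \<omega>))^2)) \<le> ennreal \<epsilon>"
        using * by (subst nn_integral_eq_integral[OF i, symmetric]) auto
      then show "expectation (\<lambda>\<omega>. indicat_real G \<omega> * (norm (Y \<omega> - z u \<omega>))^2) \<le> \<epsilon>" using assms(5) by simp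
    qed
    have "0 \<le> \<delta> * (onorm P * (2 * n + 2 * \<alpha> * n) / \<theta> + \<alpha> * onorm P)"
      using d p assms \<alpha>_pos by simp
    from mult_left_mono[OF E this] show ?thesis
      using iY iE by (simp add: prob_space energy_def Y_def G_def u_def)
  qed
  finally show ?thesis unfolding \<delta>_def[symmetric] by (simp add: algebra_simps add_divide_distrib)
qed

text \<open>Only an inequality, since a path may violate the bounds of \<open>good\<close> already
  at time 0 and then contributes nothing.\<close>

lemma energy_0: "energy n t m 0 \<le> z0 \<bullet> P z0"
proof -
  have "energy n t m 0 \<le> expectation (\<lambda>\<omega>. z0 \<bullet> P z0)"
    unfolding energy_def
  proof (rule integral_mono)
    have [measurable]: "{\<omega>\<in>space M. good n 0 \<omega>} \<in> sets M" by (rule good_sets_M) simp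
    then show "integrable M (\<lambda>\<omega>. indicat_real {\<omega>\<in>space M. good n (grid_point t m 0) \<omega>} \<omega> * (euler n t m 0 \<omega> \<bullet> P (euler n t m 0 \<omega>)))"
      by (intro integrable_const_bound[where B="z0 \<bullet> P z0"]) (auto simp: euler_def indicator_def P_psd)
  qed (auto simp: euler_def indicator_def P_psd)
  then show ?thesis by (simp add: prob_space)
qed

text \<open>The energies satisfy
  \<open>x' \<le> (1 - \<alpha> * \<delta>) * x + \<delta> * K\<close>, whose fixed point is
  \<open>K / \<alpha>\<close>. As the mesh shrinks, \<open>K\<close> tends to \<open>C\<close> and
  the scheme tends to \<open>z\<close> in mean square on the good event.\<close>

lemma good_moment:
  assumes t: "0 \<le> t" and n: "0 \<le> n"
  shows "(\<integral>\<^sup>+\<omega>\<in>{\<omega>\<in>space M. good n t \<omega>}. ennreal (z t \<omega> \<bullet> P (z t \<omega>)) \<partial>M) \<le> ennreal (z0 \<bullet> P z0 + C / \<alpha>)"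
proof (rule ennreal_le_epsilon)
  fix \<rho> :: real assume \<rho>: "0 < \<rho>"
  have p: "0 \<le> onorm P" by (rule onorm_pos_le[OF P])
  define c1 where "c1 = onorm P * (2 * n + 2 * \<alpha> * n)"
  have c1: "0 \<le> c1" using p n \<alpha>_pos by (simp add: c1_def)
  \<comment> \<open>All errors of the proof are at most \<open>Q * \<theta>\<close>: the quotient by
    \<open>\<alpha>\<close> is the excess of \<open>K\<close> over \<open>C\<close> after iteration,
    and the last summand is the cost of returning from the scheme to \<open>z t\<close> at the
    end.\<close>
  define Q where "Q = (2 * c1 + \<alpha> * onorm P + onorm P * n^2) / \<alpha> + onorm P * (4 * n + 1)"
  have Q: "0 \<le> Q" using c1 p n \<alpha>_pos by (simp add: Q_def)
  define \<theta> where "\<theta> = min 1 (\<rho> / (Q + 1))"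
  have \<theta>: "0 < \<theta>" "\<theta> \<le> 1" "Q * \<theta> \<le> \<rho>"
  proof -
    show "0 < \<theta>" "\<theta> \<le> 1" using Q \<rho> by (auto simp: \<theta>_def)
    have "Q * \<theta> \<le> Q * (\<rho> / (Q + 1))" using Q by (intro mult_left_mono) (auto simp: \<theta>_def)
    also have "\<dots> \<le> \<rho>" using Q \<rho> by (simp add: divide_simps)
    finally show "Q * \<theta> \<le> \<rho>" .
  qed
  \<comment> \<open>A mesh for which the mean square error is at most \<open>\<theta>^2\<close>, so
    that dividing it by \<open>\<theta>\<close> leaves order \<open>\<theta>\<close>, and for which
    \<open>1 - \<alpha> * \<delta>\<close> is nonnegative, so that the recursion may be
    iterated.\<close>
  have "\<exists>m. ennreal (4 * n * t) * drift_error n t (Suc m) + ennreal (8 * (onorm L)^2) * noise_error n t (Suc m) \<le> ennreal (\<theta>^2)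
    \<and> t / Suc m \<le> \<theta> \<and> \<alpha> * (t / Suc m) \<le> 1"
  proof -
    have "(\<lambda>m. ennreal (4 * n * t) * drift_error n t (Suc m) + ennreal (8 * (onorm L)^2) * noise_error n t (Suc m)) \<longlonglongrightarrow>
      ennreal (4 * n * t) * 0 + ennreal (8 * (onorm L)^2) * 0"
      by (intro tendsto_add ennreal_tendsto_cmult drift_error_tendsto[OF t n] noise_error_tendsto[OF t n]) auto
    then have 1: "\<forall>\<^sub>F m in sequentially. ennreal (4 * n * t) * drift_error n t (Suc m) + ennreal (8 * (onorm L)^2) * noise_error n t (Suc m) < ennreal (\<theta>^2)"
      by (rule order_tendstoD(2)) (use \<theta> in simp)
    have "(\<lambda>m. t * inverse (real (Suc m))) \<longlonglongrightarrow> t * 0" by (intro tendsto_mult tendsto_const LIMSEQ_inverse_real_of_nat)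
    then have "(\<lambda>m. t / Suc m) \<longlonglongrightarrow> 0" by (simp add: divide_inverse)
    then have 2: "\<forall>\<^sub>F m in sequentially. t / Suc m < min \<theta> (1 / \<alpha>)" by (rule order_tendstoD(2)) (use \<theta> \<alpha>_pos in simp)
    have "\<forall>\<^sub>F m in sequentially. ennreal (4 * n * t) * drift_error n t (Suc m) + ennreal (8 * (onorm L)^2) * noise_error n t (Suc m) \<le> ennreal (\<theta>^2)
      \<and> t / Suc m \<le> \<theta> \<and> \<alpha> * (t / Suc m) \<le> 1"
      using 1 2
    proof eventually_elim
      case (elim m)
      then have "\<alpha> * (t / Suc m) \<le> \<alpha> * (1 / \<alpha>)" using \<alpha>_pos by (intro mult_left_mono) auto
      then show ?case using elim \<alpha>_pos by simp
    qed
    then show ?thesis by (rule eventually_happens'[OF sequentially_bot])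
  qed
  then obtain m' where m': "ennreal (4 * n * t) * drift_error n t (Suc m') + ennreal (8 * (onorm L)^2) * noise_error n t (Suc m') \<le> ennreal (\<theta>^2)"
    "t / Suc m' \<le> \<theta>" "\<alpha> * (t / Suc m') \<le> 1" by blast
  define m where "m = Suc m'"
  define \<delta> where "\<delta> = t / m"
  have m: "0 < m" "0 \<le> \<delta>" "\<delta> \<le> \<theta>" "\<alpha> * \<delta> \<le> 1" using m' t by (auto simp: m_def \<delta>_def)
  have err: "(\<integral>\<^sup>+\<omega>\<in>{\<omega>\<in>space M. good n (grid_point t m i) \<omega>}. ennreal ((norm (euler n t m i \<omega> - z (grid_point t m i) \<omega>))^2) \<partial>M) \<le> ennreal (\<theta>^2)"
    if "i \<le> m" for i
    using order_trans[OF euler_error[OF t n that m(1)]] m'(1) by (simp add: m_def)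
  define K where "K = C + (2 * c1 + \<alpha> * onorm P + onorm P * n^2) * \<theta>"
  have K: "0 \<le> K" using C_nonneg c1 p \<theta> \<alpha>_pos by (simp add: K_def)
  have Kle: "C + c1 * (\<theta> + \<theta>^2 / \<theta>) + \<alpha> * onorm P * \<theta>^2 + \<delta> * (onorm P * n^2) \<le> K"
  proof -
    have "\<alpha> * onorm P * \<theta>^2 \<le> \<alpha> * onorm P * \<theta>"
      using \<theta> p \<alpha>_pos by (intro mult_left_mono) (auto simp: power2_eq_square mult_left_le)
    moreover have "\<delta> * (onorm P * n^2) \<le> \<theta> * (onorm P * n^2)" using m p by (intro mult_right_mono) auto
    ultimately show ?thesis using \<theta> by (simp add: K_def algebra_simps power2_eq_square)
  qed
  \<comment> \<open>The bound is preserved by the recursion: it exceeds the fixed point by the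
    nonnegative \<open>z0 \<bullet> P z0\<close>, and this excess shrinks at each step.\<close>
  have U: "energy n t m i \<le> z0 \<bullet> P z0 + K / \<alpha>" if "i \<le> m" for i
    using that
  proof (induction i)
    case 0
    have "0 \<le> K / \<alpha>" using K \<alpha>_pos by simp
    then show ?case using energy_0[of n t m] by linarith
  next
    case (Suc i)
    have "energy n t m (Suc i) \<le> (1 - \<alpha> * \<delta>) * energy n t m i + \<delta> * (C + c1 * (\<theta> + \<theta>^2 / \<theta>) + \<alpha> * onorm P * \<theta>^2 + \<delta> * (onorm P * n^2))"
      using energy_step[OF t n _ \<theta>(1) _ err, of i] Suc.prems unfolding \<delta>_def c1_def by simp
    also have "\<dots> \<le> (1 - \<alpha> * \<delta>) * (z0 \<bullet> P z0 + K / \<alpha>) + \<delta> * K"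
      using Suc Kle m by (intro add_mono mult_left_mono) auto
    also have "\<dots> = z0 \<bullet> P z0 + K / \<alpha> - \<alpha> * \<delta> * (z0 \<bullet> P z0)" using \<alpha>_pos by (simp add: field_simps)
    also have "\<dots> \<le> z0 \<bullet> P z0 + K / \<alpha>" using \<alpha>_pos m P_psd[of z0] by simp
    finally show ?case .
  qed
  define G where "G = {\<omega>\<in>space M. good n t \<omega>}"
  have G [measurable]: "G \<in> sets M" unfolding G_def by (rule good_sets_M[OF t])
  define Y where "Y = euler n t m m"
  have YF: "Y \<in> borel_measurable (F t)" and Yi: "integrable M (\<lambda>\<omega>. (norm (Y \<omega>))^2)"
    using euler_square_integrable[OF t n, of m m] m by (auto simp: Y_def)
  have [measurable]: "P \<in> borel_measurable borel"
    using P by (auto intro!: borel_measurable_continuous_onI linear_continuous_on)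
  have [measurable]: "Y \<in> borel_measurable M" "z t \<in> borel_measurable M" using F_imp_M YF z_adapted[OF t] by auto
  have iY: "integrable M (\<lambda>\<omega>. indicat_real G \<omega> * (Y \<omega> \<bullet> P (Y \<omega>)))"
    by (intro integrable_real_mult_indicator[OF G, unfolded mult.commute[of _ "indicat_real G _"]] integrable_P Yi) measurable
  have e: "(\<integral>\<^sup>+\<omega>\<in>G. ennreal ((norm (Y \<omega> - z t \<omega>))^2) \<partial>M) \<le> ennreal (\<theta>^2)" using err[of m] m by (simp add: Y_def G_def)
  define q where "q = onorm P * (1 + 2 * n / \<theta>)"
  have q: "0 \<le> q" using p n \<theta> by (simp add: q_def)
  have pw: "ennreal (z t \<omega> \<bullet> P (z t \<omega>)) * indicator G \<omega> \<le> ennreal (indicat_real G \<omega> * (Y \<omega> \<bullet> P (Y \<omega>))) +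
    (ennreal (onorm P * 2 * n * \<theta>) + ennreal q * (ennreal ((norm (Y \<omega> - z t \<omega>))^2) * indicator G \<omega>))" for \<omega>
  proof (cases "\<omega> \<in> G")
    case True
    then have zn: "norm (z t \<omega>) \<le> n" using t by (auto simp: G_def good_def)
    define x where "x = norm (Y \<omega> - z t \<omega>)"
    have x: "0 \<le> x" "x \<le> \<theta> + x^2 / \<theta>" using le_add_square_divide[OF \<theta>(1)] by (auto simp: x_def)
    have "z t \<omega> \<bullet> P (z t \<omega>) \<le> Y \<omega> \<bullet> P (Y \<omega>) + onorm P * x * (x + 2 * norm (z t \<omega>))"
      using P_quadratic(2)[of "Y \<omega>" "z t \<omega>"] by (simp add: x_def)
    also have "onorm P * x * (x + 2 * norm (z t \<omega>)) \<le> onorm P * x * (x + 2 * n)"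
      by (intro mult_left_mono add_mono zn) (use p x in auto)
    also have "onorm P * x * (x + 2 * n) = onorm P * x^2 + onorm P * 2 * n * x" by (simp add: algebra_simps power2_eq_square)
    also have "onorm P * 2 * n * x \<le> onorm P * 2 * n * (\<theta> + x^2 / \<theta>)" by (intro mult_left_mono x) (use p n in auto)
    finally have "z t \<omega> \<bullet> P (z t \<omega>) \<le> Y \<omega> \<bullet> P (Y \<omega>) + (onorm P * 2 * n * \<theta> + q * x^2)" by (simp add: q_def algebra_simps)
    then have "ennreal (z t \<omega> \<bullet> P (z t \<omega>)) \<le> ennreal (Y \<omega> \<bullet> P (Y \<omega>) + (onorm P * 2 * n * \<theta> + q * x^2))" by (rule ennreal_leI)
    also have "\<dots> = ennreal (Y \<omega> \<bullet> P (Y \<omega>)) + (ennreal (onorm P * 2 * n * \<theta>) + ennreal q * ennreal (x^2))"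
      using p n \<theta> q P_psd by (simp add: ennreal_plus ennreal_mult')
    finally show ?thesis using True by (simp add: x_def)
  qed simp
  have "(\<integral>\<^sup>+\<omega>\<in>G. ennreal (z t \<omega> \<bullet> P (z t \<omega>)) \<partial>M) \<le> (\<integral>\<^sup>+\<omega>. ennreal (indicat_real G \<omega> * (Y \<omega> \<bullet> P (Y \<omega>))) +
    (ennreal (onorm P * 2 * n * \<theta>) + ennreal q * (ennreal ((norm (Y \<omega> - z t \<omega>))^2) * indicator G \<omega>)) \<partial>M)"
    by (rule nn_integral_mono) (rule pw)
  also have "\<dots> = (\<integral>\<^sup>+\<omega>. ennreal (indicat_real G \<omega> * (Y \<omega> \<bullet> P (Y \<omega>))) \<partial>M) +
    (ennreal (onorm P * 2 * n * \<theta>) + ennreal q * (\<integral>\<^sup>+\<omega>\<in>G. ennreal ((norm (Y \<omega> - z t \<omega>))^2) \<partial>M))"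
    by (simp add: nn_integral_add nn_integral_cmult emeasure_space_1)
  also have "(\<integral>\<^sup>+\<omega>. ennreal (indicat_real G \<omega> * (Y \<omega> \<bullet> P (Y \<omega>))) \<partial>M) = ennreal (energy n t m m)"
    using m by (subst nn_integral_eq_integral[OF iY]) (auto simp: energy_def G_def Y_def P_psd)
  also have "ennreal (energy n t m m) + (ennreal (onorm P * 2 * n * \<theta>) + ennreal q * (\<integral>\<^sup>+\<omega>\<in>G. ennreal ((norm (Y \<omega> - z t \<omega>))^2) \<partial>M))
    \<le> ennreal (z0 \<bullet> P z0 + K / \<alpha>) + (ennreal (onorm P * 2 * n * \<theta>) + ennreal q * ennreal (\<theta>^2))"
    using U[of m] e p n by (intro add_mono mult_left_mono ennreal_leI) auto
  also have "\<dots> = ennreal (z0 \<bullet> P z0 + K / \<alpha> + (onorm P * 2 * n * \<theta> + q * \<theta>^2))"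
    using p n \<theta> q P_psd[of z0] K \<alpha>_pos by (simp add: ennreal_plus ennreal_mult')
  also have "\<dots> \<le> ennreal (z0 \<bullet> P z0 + C / \<alpha> + \<rho>)"
  proof (rule ennreal_leI)
    have "q * \<theta>^2 = onorm P * \<theta>^2 + onorm P * 2 * n * \<theta>" using \<theta> by (simp add: q_def field_simps power2_eq_square)
    moreover have "onorm P * \<theta>^2 \<le> onorm P * \<theta>" using \<theta> p by (intro mult_left_mono) (auto simp: power2_eq_square mult_left_le)
    moreover have "K / \<alpha> = C / \<alpha> + (2 * c1 + \<alpha> * onorm P + onorm P * n^2) / \<alpha> * \<theta>" using \<alpha>_pos by (simp add: K_def field_simps)
    ultimately have "z0 \<bullet> P z0 + K / \<alpha> + (onorm P * 2 * n * \<theta> + q * \<theta>^2) \<le> z0 \<bullet> P z0 + C / \<alpha> + Q * \<theta>"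
      by (simp add: Q_def algebra_simps)
    then show "z0 \<bullet> P z0 + K / \<alpha> + (onorm P * 2 * n * \<theta> + q * \<theta>^2) \<le> z0 \<bullet> P z0 + C / \<alpha> + \<rho>" using \<theta>(3) by linarith
  qed
  also have "\<dots> = ennreal (z0 \<bullet> P z0 + C / \<alpha>) + ennreal \<rho>" using \<rho> P_psd[of z0] C_nonneg \<alpha>_pos by (simp add: ennreal_plus)
  finally show "(\<integral>\<^sup>+\<omega>\<in>{\<omega>\<in>space M. good n t \<omega>}. ennreal (z t \<omega> \<bullet> P (z t \<omega>)) \<partial>M) \<le> ennreal (z0 \<bullet> P z0 + C / \<alpha>) + ennreal \<rho>"
    unfolding G_def .
qed

section \<open>Removal of the killing\<close>

theorem lyapunov_moment_bound:
  assumes t: "0 \<le> t"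
  shows "(\<integral>\<^sup>+\<omega>. ennreal (z t \<omega> \<bullet> P (z t \<omega>)) \<partial>M) \<le> ennreal (z0 \<bullet> P z0 + C / \<alpha>)"
proof -
  define G where "G n = {\<omega>\<in>space M. good (real n) t \<omega>}" for n
  have G [measurable]: "G n \<in> sets M" for n unfolding G_def by (rule good_sets_M[OF t])
  have [measurable]: "P \<in> borel_measurable borel"
    using P by (auto intro!: borel_measurable_continuous_onI linear_continuous_on)
  have [measurable]: "z t \<in> borel_measurable M" using F_imp_M z_adapted[OF t] by auto
  have mono: "incseq (\<lambda>n \<omega>. ennreal (z t \<omega> \<bullet> P (z t \<omega>)) * indicator (G n) \<omega>)"
  proof (intro incseq_SucI le_funI mult_left_mono)
    fix n \<omega>
    have "good (real n) t \<omega> \<Longrightarrow> good (real (Suc n)) t \<omega>" by (fastforce simp: good_def)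
    then show "(indicator (G n) \<omega> :: ennreal) \<le> indicator (G (Suc n)) \<omega>" by (auto simp: indicator_def G_def)
  qed simp
  have ex: "\<exists>n. \<omega> \<in> G n" if \<omega>: "\<omega> \<in> space M" for \<omega>
  proof -
    have b: "\<exists>b. \<forall>s\<in>{0..t}. norm (f s) \<le> b" if "continuous_on {0..} f" for f :: "real \<Rightarrow> 'x::real_normed_vector"
    proof -
      have "bounded (f ` {0..t})" by (intro compact_imp_bounded compact_continuous_image continuous_on_subset[OF that]) auto
      then show ?thesis by (auto simp: bounded_iff)
    qed
    obtain b1 where "\<forall>s\<in>{0..t}. norm (z s \<omega>) \<le> b1" using b[OF z_cont[OF \<omega>]] by blast
    moreover obtain b2 where "\<forall>s\<in>{0..t}. norm (A s \<omega>) \<le> b2" using b[OF A_cont[OF \<omega>]] by blast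
    moreover obtain b3 where "\<forall>s\<in>{0..t}. norm (H s \<omega>) \<le> b3" using b[OF H_cont[OF \<omega>]] by blast
    moreover obtain n where "max b1 (max b2 b3) \<le> real n" using real_arch_simple by blast
    ultimately have "good (real n) t \<omega>" unfolding good_def by fastforce
    then show ?thesis using \<omega> by (auto simp: G_def)
  qed
  have "(\<integral>\<^sup>+\<omega>. ennreal (z t \<omega> \<bullet> P (z t \<omega>)) \<partial>M) \<le> (\<integral>\<^sup>+\<omega>. (SUP n. ennreal (z t \<omega> \<bullet> P (z t \<omega>)) * indicator (G n) \<omega>) \<partial>M)"
  proof (rule nn_integral_mono)
    fix \<omega> assume "\<omega> \<in> space M"
    then obtain n where "\<omega> \<in> G n" using ex by blast
    then show "ennreal (z t \<omega> \<bullet> P (z t \<omega>)) \<le> (SUP n. ennreal (z t \<omega> \<bullet> P (z t \<omega>)) * indicator (G n) \<omega>)"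
      by (intro SUP_upper2[of n]) auto
  qed
  also have "\<dots> = (SUP n. \<integral>\<^sup>+\<omega>\<in>G n. ennreal (z t \<omega> \<bullet> P (z t \<omega>)) \<partial>M)"
    by (rule nn_integral_monotone_convergence_SUP[OF mono]) measurable
  also have "\<dots> \<le> ennreal (z0 \<bullet> P z0 + C / \<alpha>)"
    unfolding G_def by (intro SUP_least good_moment[OF t]) simp
  finally show ?thesis .
qed

end

section \<open>Strongly monotone maps and the reference trajectory\<close>

lemma C1_map_differentiable:
  "C1_map h \<Longrightarrow> h differentiable (at x)"
  unfolding C1_map_def differentiable_def by blast

lemma C1_map_continuous_on: "C1_map h \<Longrightarrow> continuous_on S h"
  by (intro continuous_at_imp_continuous_on ballI differentiable_imp_continuous_within C1_map_differentiable)

lemma jacobian_lipschitz: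
  fixes \<phi> :: "real^'n \<Rightarrow> real^'m"
  assumes "\<And>x. \<phi> differentiable (at x)" "\<And>x. matrix_opnorm (jacobian \<phi> (at x)) \<le> K"
  shows "norm (\<phi> x - \<phi> y) \<le> K * norm (x - y)"
proof (rule differentiable_bound)
  show "(\<phi> has_derivative (\<lambda>h. jacobian \<phi> (at x) *v h)) (at x within UNIV)" for x
    using jacobian_works[of \<phi> "at x"] assms(1) by simp
  show "onorm (\<lambda>h. jacobian \<phi> (at x) *v h) \<le> K" for x
    using assms(2)[of x] by (simp add: matrix_opnorm_def)
qed auto

lemma loewner_le_quadratic:
  "loewner_le (b *\<^sub>R mat 1) J \<Longrightarrow> b * (v \<bullet> v) \<le> v \<bullet> (J *v v)"
  "loewner_le J (b *\<^sub>R mat 1) \<Longrightarrow> v \<bullet> (J *v v) \<le> b * (v \<bullet> v)"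
  for J :: "real^'n^'n"
  unfolding loewner_le_def psd_matrix_def
  by (auto simp: matrix_vector_mult_diff_rdistrib scaleR_matrix_vector_assoc[symmetric] inner_diff_right
      dest!: spec[of _ v])

lemma loewner_le_symmetric:
  fixes J :: "real^'n^'n"
  assumes "loewner_le (b *\<^sub>R mat 1) J"
  shows "v \<bullet> (J *v w) = (J *v v) \<bullet> w"
proof -
  have "transpose (J - b *\<^sub>R mat 1) = J - b *\<^sub>R mat 1"
    using assms by (simp add: loewner_le_def psd_matrix_def)
  then have *: "transpose (J - b *\<^sub>R mat 1) $ i $ j = (J - b *\<^sub>R mat 1) $ i $ j" for i j
    by simp
  have "transpose J $ i $ j = J $ i $ j" for i j
    using *[of i j] by (cases "i = j") (auto simp: transpose_def mat_def)
  then have "transpose J = J" by (simp add: vec_eq_iff)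
  then have "J *v v = v v* J" using transpose_matrix_vector[of J v] by simp
  then show ?thesis by (simp add: dot_lmul_matrix)
qed

text \<open>Cauchy-Schwarz for the form of a positive semidefinite matrix, at \<open>v - Jv / b\<close>.\<close>

lemma loewner_opnorm_le:
  fixes J :: "real^'n^'n"
  assumes "0 < a" "loewner_le (a *\<^sub>R mat 1) J" "loewner_le J (b *\<^sub>R mat 1)" "0 < b"
  shows "matrix_opnorm J \<le> b"
  unfolding matrix_opnorm_def
proof (rule onorm_bound)
  fix v :: "real^'n"
  define w where "w = J *v v"
  define x where "x = v - (1 / b) *\<^sub>R w"
  have "0 \<le> a * (x \<bullet> x)" using assms by simp
  also have "\<dots> \<le> x \<bullet> (J *v x)" by (rule loewner_le_quadratic(1)[OF assms(2)])
  also have "\<dots> = v \<bullet> (J *v v) - 2 * (w \<bullet> w) / b + (w \<bullet> (J *v w)) / b^2"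
    using loewner_le_symmetric[OF assms(2), of v w]
    unfolding x_def by (simp add: matrix_vector_mult_diff_distrib matrix_vector_mult_scaleR inner_diff_left inner_diff_right
        w_def[symmetric] power2_eq_square algebra_simps)
  also have "\<dots> \<le> b * (v \<bullet> v) - 2 * (w \<bullet> w) / b + b * (w \<bullet> w) / b^2"
    by (intro add_mono diff_mono divide_right_mono loewner_le_quadratic(2)[OF assms(3)]) (use assms(4) in auto)
  also have "\<dots> = (b^2 * (v \<bullet> v) - w \<bullet> w) / b" using assms(4) by (simp add: field_simps power2_eq_square)
  finally have "w \<bullet> w \<le> b^2 * (v \<bullet> v)" using assms(4) by (simp add: zero_le_divide_iff)
  then have "(norm w)^2 \<le> (b * norm v)^2" by (simp add: power2_norm_eq_inner power_mult_distrib)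
  then show "norm (J *v v) \<le> b * norm v" unfolding w_def by (rule power2_le_imp_le) (use assms(4) in simp)
qed (use assms in simp)

text \<open>Vector valued maps satisfy no mean value equality, but their component along
  \<open>x - y\<close>, followed over the segment from \<open>y\<close> to \<open>x\<close>, is a
  real function.\<close>

lemma jacobian_monotone:
  fixes \<phi> :: "real^'n \<Rightarrow> real^'n"
  assumes "\<And>x. \<phi> differentiable (at x)" "\<And>x. loewner_le (b *\<^sub>R mat 1) (jacobian \<phi> (at x))"
  shows "b * (norm (x - y))^2 \<le> (x - y) \<bullet> (\<phi> x - \<phi> y)"
proof -
  define \<psi> where "\<psi> s = (x - y) \<bullet> \<phi> (y + s *\<^sub>R (x - y))" for s :: real
  define \<psi>' where "\<psi>' s = (x - y) \<bullet> (jacobian \<phi> (at (y + s *\<^sub>R (x - y))) *v (x - y))" for s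
  have "(\<psi> has_real_derivative \<psi>' s) (at s)" for s
  proof -
    have 1: "((\<lambda>s. y + s *\<^sub>R (x - y)) has_derivative (\<lambda>h. h *\<^sub>R (x - y))) (at s)"
      by (auto intro!: derivative_eq_intros)
    have 2: "(\<phi> has_derivative (\<lambda>h. jacobian \<phi> (at (y + s *\<^sub>R (x - y))) *v h)) (at (y + s *\<^sub>R (x - y)))"
      using jacobian_works[of \<phi> "at (y + s *\<^sub>R (x - y))"] assms(1) by simp
    have "(\<psi> has_derivative (\<lambda>h. (x - y) \<bullet> (jacobian \<phi> (at (y + s *\<^sub>R (x - y))) *v (h *\<^sub>R (x - y))))) (at s)"
      unfolding \<psi>_def by (intro has_derivative_inner_right has_derivative_compose[OF 1 2])
    then show ?thesis
      unfolding has_field_derivative_def \<psi>'_def by (simp add: matrix_vector_mult_scaleR mult.commute[of _ "_ \<bullet> _"])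
  qed
  then obtain s where "0 < s" "s < 1" "\<psi> 1 - \<psi> 0 = (1 - 0) * \<psi>' s" using MVT2[of 0 1 \<psi> \<psi>'] by auto
  moreover have "b * ((x - y) \<bullet> (x - y)) \<le> \<psi>' s" unfolding \<psi>'_def by (rule loewner_le_quadratic(1)[OF assms(2)])
  ultimately show ?thesis by (simp add: \<psi>_def inner_diff_right power2_norm_eq_inner)
qed

text \<open>A solution is a fixed point of \<open>x - l (\<phi> x - w)\<close>. The squared
  Lipschitz constant of this map is at most \<open>1 - 2 * l * b + l^2 * K^2\<close>, which is
  smallest at \<open>l = b / K^2\<close>, with value \<open>1 - b^2 / K^2\<close>.\<close>

lemma strongly_monotone_surj:
  fixes \<phi> :: "'b::euclidean_space \<Rightarrow> 'b"
  assumes "0 < b" "b \<le> K" "\<And>x y. b * (norm (x - y))^2 \<le> (x - y) \<bullet> (\<phi> x - \<phi> y)"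
    "\<And>x y. norm (\<phi> x - \<phi> y) \<le> K * norm (x - y)"
  shows "\<exists>x. \<phi> x = w"
proof -
  define l where "l = b / K^2"
  define c where "c = sqrt (1 - b^2 / K^2)"
  have K: "0 < K" using assms by linarith
  have q: "0 < b^2 / K^2" "b^2 / K^2 \<le> 1" using K assms(1,2) by (auto simp: divide_simps power_mono)
  have l: "0 < l" using K assms(1) by (simp add: l_def)
  have "\<exists>!x. x - l *\<^sub>R (\<phi> x - w) = x"
  proof (rule banach_fix_type)
    show "0 \<le> c" "c < 1" using q by (auto simp: c_def)
    show "\<forall>x y. dist (x - l *\<^sub>R (\<phi> x - w)) (y - l *\<^sub>R (\<phi> y - w)) \<le> c * dist x y"
    proof (intro allI)
      fix x y
      define p where "p = \<phi> x - \<phi> y"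
      have "(norm ((x - y) - l *\<^sub>R p))^2 = (norm (x - y))^2 - 2 * l * ((x - y) \<bullet> p) + l^2 * (norm p)^2"
        using norm_square_add_scaleR[of "x - y" "- l" p] by simp
      also have "\<dots> \<le> (norm (x - y))^2 - 2 * l * (b * (norm (x - y))^2) + l^2 * (K * norm (x - y))^2"
        using assms(3)[of x y] power_mono[OF assms(4)[of x y], of 2] l unfolding p_def
        by (intro add_mono diff_mono mult_left_mono) auto
      also have "\<dots> = (1 - b^2 / K^2) * (norm (x - y))^2"
        using K unfolding l_def by (simp add: field_simps power2_eq_square)
      also have "\<dots> = (c * norm (x - y))^2" using q by (simp add: c_def power_mult_distrib)
      finally have "norm ((x - y) - l *\<^sub>R p) \<le> c * norm (x - y)"
        by (rule power2_le_imp_le) (use q in \<open>simp add: c_def\<close>)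
      then show "dist (x - l *\<^sub>R (\<phi> x - w)) (y - l *\<^sub>R (\<phi> y - w)) \<le> c * dist x y"
        by (simp add: dist_norm p_def algebra_simps)
    qed
  qed
  then show ?thesis using l by auto
qed

section \<open>Curves on the half line: smoothing and boundedness\<close>

lemma integral_has_vector_derivative_atLeast:
  fixes u :: "real \<Rightarrow> 'b::euclidean_space"
  assumes "continuous_on {0..} u" "0 \<le> t"
  shows "((\<lambda>t. integral {0..t} u) has_vector_derivative u t) (at t within {0..})"
proof -
  have "((\<lambda>t. integral {0..t} u) has_vector_derivative u t) (at t within {0..t+1})"
    by (rule integral_has_vector_derivative) (use assms in \<open>auto intro: continuous_on_subset\<close>)
  moreover have "at t within {0..t+1} = at t within {0..}"
    by (rule at_within_nhd[of _ "{..<t+1}"]) auto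
  ultimately show ?thesis by simp
qed

lemma vector_derivative_zero_constant:
  fixes \<phi> :: "real \<Rightarrow> 'b::euclidean_space"
  assumes "\<And>t. 0 \<le> t \<Longrightarrow> (\<phi> has_vector_derivative 0) (at t within {0..})" "0 \<le> t"
  shows "\<phi> t = \<phi> 0"
proof -
  obtain c where "\<And>x. x \<in> {0..} \<Longrightarrow> \<phi> x = c"
    using has_derivative_zero_constant[of "{0..}" \<phi>] assms(1) by (auto simp: has_vector_derivative_def)
  then show ?thesis using assms(2) by auto
qed

text \<open>A Lipschitz curve is replaced by its moving average, which is continuously differentiable.\<close>

lemma lipschitz_smoothing:
  fixes u :: "real \<Rightarrow> 'b::euclidean_space"
  assumes "\<And>s t. 0 \<le> s \<Longrightarrow> 0 \<le> t \<Longrightarrow> norm (u t - u s) \<le> \<Lambda> * \<bar>t - s\<bar>"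
  obtains v v' where "\<And>t. 0 \<le> t \<Longrightarrow> (v has_vector_derivative v' t) (at t within {0..})" "continuous_on {0..} v'"
    "\<And>t. 0 \<le> t \<Longrightarrow> norm (v' t) \<le> \<Lambda>" "\<And>t. 0 \<le> t \<Longrightarrow> norm (v t - u t) \<le> \<Lambda>"
proof -
  have \<Lambda>: "0 \<le> \<Lambda>" using order_trans[OF norm_ge_zero assms[of 0 1]] by simp
  have "\<Lambda>-lipschitz_on {0..} u"
    by (rule lipschitz_onI) (use assms \<Lambda> in \<open>auto simp: dist_norm\<close>)
  then have cu: "continuous_on {0..} u" by (rule lipschitz_on_continuous_on)
  define U where "U t = integral {0..t} u" for t
  have U: "(U has_vector_derivative u t) (at t within {0..})" if "0 \<le> t" for t
    unfolding U_def[abs_def] by (rule integral_has_vector_derivative_atLeast[OF cu that])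
  \<comment> \<open>The average over the window \<open>{t..t+1}\<close>. It looks ahead so that it
    stays in the half line; its unit length bounds both the distance to \<open>u\<close> and the
    derivative by \<Lambda>.\<close>
  define v where "v t = U (t + 1) - U t" for t
  define v' where "v' t = u (t + 1) - u t" for t
  show ?thesis
  proof (rule that[of v v'])
    fix t :: real assume t: "0 \<le> t"
    have "((\<lambda>t. t + 1) has_vector_derivative 1) (at t within {0..})"
      by (auto intro!: derivative_eq_intros simp: has_vector_derivative_def)
    moreover have "(U has_vector_derivative u (t + 1)) (at (t + 1) within (\<lambda>t. t + 1) ` {0..})"
      by (rule has_vector_derivative_within_subset[OF U]) (use t in auto)
    ultimately have "((U \<circ> (\<lambda>t. t + 1)) has_vector_derivative 1 *\<^sub>R u (t + 1)) (at t within {0..})"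
      by (rule vector_diff_chain_within)
    then show "(v has_vector_derivative v' t) (at t within {0..})"
      unfolding v_def[abs_def] v'_def using U[OF t] by (auto intro!: has_vector_derivative_diff simp: comp_def)
    show "norm (v' t) \<le> \<Lambda>" using assms[of t "t + 1"] t by (simp add: v'_def)
    have iu: "u integrable_on {a..b}" if "0 \<le> a" for a b
      by (rule integrable_continuous_real) (rule continuous_on_subset[OF cu], use that in auto)
    have "v t = integral {t..t+1} u"
      using Henstock_Kurzweil_Integration.integral_combine[of 0 t "t + 1" u, symmetric] t iu[of 0 "t + 1"] by (simp add: v_def U_def)
    also have "\<dots> - u t = integral {t..t+1} (\<lambda>s. u s - u t)"
      using t iu[of t "t + 1"] by (subst Henstock_Kurzweil_Integration.integral_diff) auto
    finally have "norm (v t - u t) = norm (integral {t..t+1} (\<lambda>s. u s - u t))" by simp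
    also have "\<dots> \<le> \<Lambda> * (t + 1 - t)"
    proof (rule integral_bound)
      show "continuous_on {t..t+1} (\<lambda>s. u s - u t)"
        by (intro continuous_intros continuous_on_subset[OF cu]) (use t in auto)
      fix s assume s: "s \<in> {t..t+1}"
      have "norm (u s - u t) \<le> \<Lambda> * \<bar>s - t\<bar>" using assms[of t s] s t by auto
      also have "\<dots> \<le> \<Lambda> * 1" using s \<Lambda> by (intro mult_left_mono) auto
      finally show "norm (u s - u t) \<le> \<Lambda>" by simp
    qed simp
    finally show "norm (v t - u t) \<le> \<Lambda>" by simp
  next
    show "continuous_on {0..} v'"
      unfolding v'_def by (intro continuous_intros continuous_on_compose2[OF cu]) auto
  qed
qed

lemma lipschitz_of_bounded_derivative:
  fixes h :: "real \<Rightarrow> 'b::euclidean_space"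
  assumes "\<And>t. 0 \<le> t \<Longrightarrow> (h has_vector_derivative h' t) (at t within {0..})" "\<And>t. 0 \<le> t \<Longrightarrow> norm (h' t) \<le> K"
    "0 \<le> s" "0 \<le> t"
  shows "norm (h t - h s) \<le> K * \<bar>t - s\<bar>"
proof -
  have "norm (h t - h s) \<le> K * norm (t - s)"
  proof (rule differentiable_bound[of "{0..}"])
    fix x :: real assume x: "x \<in> {0..}"
    show "(h has_derivative (\<lambda>c. c *\<^sub>R h' x)) (at x within {0..})"
      using assms(1)[of x] x by (simp add: has_vector_derivative_def)
    show "onorm (\<lambda>c. c *\<^sub>R h' x) \<le> K"
    proof (rule onorm_bound)
      fix c show "norm (c *\<^sub>R h' x) \<le> K * norm c"
        using mult_right_mono[OF assms(2)[of x], of "\<bar>c\<bar>"] x by (simp add: mult.commute)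
    qed (use order_trans[OF norm_ge_zero assms(2)[of x]] x in simp)
  qed (use assms in auto)
  then show ?thesis by simp
qed

text \<open>The characteristic polynomial is \<open>(\<lambda> + \<omega>)\<^sup>2\<close>, so \<open>exp (\<omega> t) z\<close> is affine in \<open>t\<close>.\<close>

lemma critically_damped_bounded:
  fixes z z' :: "real \<Rightarrow> 'b::euclidean_space"
  assumes \<omega>: "0 < \<omega>" and z: "\<And>t. 0 \<le> t \<Longrightarrow> (z has_vector_derivative z' t) (at t within {0..})"
    and z': "\<And>t. 0 \<le> t \<Longrightarrow> (z' has_vector_derivative (- (\<omega>^2) *\<^sub>R z t - (2 * \<omega>) *\<^sub>R z' t)) (at t within {0..})"
  obtains K where "\<And>t. 0 \<le> t \<Longrightarrow> norm (z t) \<le> K" "\<And>t. 0 \<le> t \<Longrightarrow> norm (z' t) \<le> K"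
proof -
  define w where "w = z' 0 + \<omega> *\<^sub>R z 0"
  have e: "((\<lambda>t. exp (\<omega> * t)) has_real_derivative \<omega> * exp (\<omega> * t)) (at t within {0..})" for t
    by (auto intro!: derivative_eq_intros)
  \<comment> \<open>The left side is the derivative of
    \<open>exp (\<omega> * t) *\<^sub>R z t\<close>; being constant, it is the slope of that affine
    function.\<close>
  have 1: "exp (\<omega> * t) *\<^sub>R (z' t + \<omega> *\<^sub>R z t) = w" if "0 \<le> t" for t
  proof -
    have d: "((\<lambda>t. exp (\<omega> * t) *\<^sub>R (z' t + \<omega> *\<^sub>R z t)) has_vector_derivative 0) (at t within {0..})" if "0 \<le> t" for t
    proof -
      have a: "((\<lambda>t. z' t + \<omega> *\<^sub>R z t) has_vector_derivative (- (\<omega>^2) *\<^sub>R z t - (2 * \<omega>) *\<^sub>R z' t + \<omega> *\<^sub>R z' t)) (at t within {0..})"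
        using z[OF that] z'[OF that] by (auto intro!: derivative_eq_intros)
      have "((\<lambda>t. exp (\<omega> * t) *\<^sub>R (z' t + \<omega> *\<^sub>R z t)) has_vector_derivative
        (exp (\<omega> * t) *\<^sub>R (- (\<omega>^2) *\<^sub>R z t - (2 * \<omega>) *\<^sub>R z' t + \<omega> *\<^sub>R z' t) + (\<omega> * exp (\<omega> * t)) *\<^sub>R (z' t + \<omega> *\<^sub>R z t))) (at t within {0..})"
        by (rule has_vector_derivative_scaleR[OF e a])
      also have "exp (\<omega> * t) *\<^sub>R (- (\<omega>^2) *\<^sub>R z t - (2 * \<omega>) *\<^sub>R z' t + \<omega> *\<^sub>R z' t) + (\<omega> * exp (\<omega> * t)) *\<^sub>R (z' t + \<omega> *\<^sub>R z t)
        = exp (\<omega> * t) *\<^sub>R ((- (\<omega>^2) *\<^sub>R z t - (2 * \<omega>) *\<^sub>R z' t + \<omega> *\<^sub>R z' t) + \<omega> *\<^sub>R (z' t + \<omega> *\<^sub>R z t))"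
        by (simp add: scaleR_right_distrib mult.commute)
      also have "(- (\<omega>^2) *\<^sub>R z t - (2 * \<omega>) *\<^sub>R z' t + \<omega> *\<^sub>R z' t) + \<omega> *\<^sub>R (z' t + \<omega> *\<^sub>R z t) = 0"
        by (simp add: scaleR_right_distrib power2_eq_square scaleR_left_distrib[of \<omega> \<omega>, folded mult_2])
      finally show ?thesis by simp
    qed
    show ?thesis using vector_derivative_zero_constant[OF d that] by (simp add: w_def)
  qed
  have 2: "exp (\<omega> * t) *\<^sub>R z t - t *\<^sub>R w = z 0" if "0 \<le> t" for t
  proof -
    have d: "((\<lambda>t. exp (\<omega> * t) *\<^sub>R z t - t *\<^sub>R w) has_vector_derivative 0) (at t within {0..})" if "0 \<le> t" for t
    proof -
      have "((\<lambda>t. exp (\<omega> * t) *\<^sub>R z t) has_vector_derivative (exp (\<omega> * t) *\<^sub>R z' t + (\<omega> * exp (\<omega> * t)) *\<^sub>R z t)) (at t within {0..})"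
        by (rule has_vector_derivative_scaleR[OF e z[OF that]])
      moreover have "((\<lambda>t. t *\<^sub>R w) has_vector_derivative w) (at t within {0..})"
        by (auto intro!: derivative_eq_intros simp: has_vector_derivative_def)
      ultimately have "((\<lambda>t. exp (\<omega> * t) *\<^sub>R z t - t *\<^sub>R w) has_vector_derivative
         (exp (\<omega> * t) *\<^sub>R z' t + (\<omega> * exp (\<omega> * t)) *\<^sub>R z t - w)) (at t within {0..})"
        by (rule has_vector_derivative_diff)
      moreover have "exp (\<omega> * t) *\<^sub>R z' t + (\<omega> * exp (\<omega> * t)) *\<^sub>R z t - w = 0"
        using 1[OF that] by (simp add: scaleR_right_distrib mult.commute)
      ultimately show ?thesis by simp
    qed
    show ?thesis using vector_derivative_zero_constant[OF d that] by simp
  qed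
  have ex: "\<omega> * t \<le> exp (\<omega> * t)" "1 \<le> exp (\<omega> * t)" if "0 \<le> t" for t
  proof -
    have "0 \<le> \<omega> * t" using that \<omega> by simp
    then show "\<omega> * t \<le> exp (\<omega> * t)" "1 \<le> exp (\<omega> * t)" using exp_ge_add_one_self[of "\<omega> * t"] by linarith+
  qed
  \<comment> \<open>The affine growth is written as
    \<open>(\<omega> * t) * (norm w / \<omega>)\<close>, and
    \<open>\<omega> * t \<le> exp (\<omega> * t)\<close>.\<close>
  define K1 where "K1 = norm (z 0) + norm w / \<omega>"
  have b1: "norm (z t) \<le> K1" if "0 \<le> t" for t
  proof -
    have "exp (\<omega> * t) * norm (z t) = norm (z 0 + t *\<^sub>R w)"
      using 2[OF that] by (metis abs_exp_cancel add.commute diff_add_cancel norm_scaleR)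
    also have "\<dots> \<le> norm (z 0) + (\<omega> * t) * (norm w / \<omega>)" using \<omega> that by (intro norm_triangle_le) simp
    also have "\<dots> \<le> exp (\<omega> * t) * norm (z 0) + exp (\<omega> * t) * (norm w / \<omega>)"
      using ex[OF that] \<omega> by (intro add_mono mult_right_mono) (auto simp: mult_le_cancel_right1)
    also have "\<dots> = exp (\<omega> * t) * K1" by (simp add: K1_def algebra_simps)
    finally show ?thesis by simp
  qed
  have b2: "norm (z' t) \<le> norm w + \<omega> * K1" if "0 \<le> t" for t
  proof -
    have "exp (\<omega> * t) * norm (z' t + \<omega> *\<^sub>R z t) = norm w"
      using 1[OF that] by (metis abs_exp_cancel norm_scaleR)
    moreover have "norm (z' t + \<omega> *\<^sub>R z t) \<le> exp (\<omega> * t) * norm (z' t + \<omega> *\<^sub>R z t)"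
      using ex[OF that] by (simp add: mult_le_cancel_right1)
    ultimately have "norm (z' t + \<omega> *\<^sub>R z t) \<le> norm w" by simp
    moreover have "norm (\<omega> *\<^sub>R z t) \<le> \<omega> * K1" using b1[OF that] \<omega> by simp
    moreover have "norm (z' t) \<le> norm (z' t + \<omega> *\<^sub>R z t) + norm (\<omega> *\<^sub>R z t)"
      using norm_triangle_ineq4[of "z' t + \<omega> *\<^sub>R z t" "\<omega> *\<^sub>R z t"] by simp
    ultimately show ?thesis by linarith
  qed
  show ?thesis
    by (rule that[of "max K1 (norm w + \<omega> * K1)"]) (use b1 b2 in \<open>auto simp: le_max_iff_disj\<close>)
qed

section \<open>The Lyapunov function of the PID loop\<close>

text \<open>The last row reproduces the feedback \<open>ki x\<^sub>0 + kp x\<^sub>1 + kd x\<^sub>2\<close>; the other entries are the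
  ones for which all mixed terms cancel in the derivative of the form along the loop with the constant
  input gain \<open>b\<close>.\<close>

definition pid_form :: "real \<Rightarrow> real \<Rightarrow> real \<Rightarrow> real \<Rightarrow> 'b \<times> 'b \<times> 'b \<Rightarrow> 'b \<times> 'b \<times> 'b::euclidean_space" where
  "pid_form b ki kp kd = (\<lambda>(x0, x1, x2).
    ((2 * b * ki * kp) *\<^sub>R x0 + (2 * b * ki * kd) *\<^sub>R x1 + ki *\<^sub>R x2,
     (2 * b * ki * kd) *\<^sub>R x0 + (2 * b * kp * kd - ki) *\<^sub>R x1 + kp *\<^sub>R x2,
     ki *\<^sub>R x0 + kp *\<^sub>R x1 + kd *\<^sub>R x2))"

lemma bounded_linear_pid_form: "bounded_linear (pid_form b ki kp kd)"
proof -
  have "linear (pid_form b ki kp kd)"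
    by (rule linearI) (auto simp: pid_form_def algebra_simps)
  then show ?thesis by (rule linear_conv_bounded_linear[THEN iffD1])
qed

lemma pid_form_symmetric: "pid_form b ki kp kd x \<bullet> y = x \<bullet> pid_form b ki kp kd y"
  by (cases x; cases y) (simp add: pid_form_def inner_add_left inner_add_right inner_diff_left inner_diff_right algebra_simps)

section \<open>Coercivity of the form\<close>

lemma norm_triple_square: "(norm (x0, x1, x2))^2 = (norm x0)^2 + (norm x1)^2 + (norm x2)^2"
  by (simp add: norm_Pair)

text \<open>The constant \<open>q\<close> is the determinant over the trace, a lower bound for the
  smaller eigenvalue since the larger one is below the trace. After subtracting \<open>q\<close>
  from the diagonal the determinant is \<open>q^2\<close>, and completing the square shows that the
  rest is nonnegative.\<close>

lemma binary_form_coercive: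
  fixes x y :: "'b::real_inner"
  assumes "0 < q11" "q01^2 < q00 * q11"
  defines "q \<equiv> (q00 * q11 - q01^2) / (q00 + q11)"
  shows "0 < q" "q * ((norm x)^2 + (norm y)^2) \<le> q00 * (norm x)^2 + 2 * q01 * (x \<bullet> y) + q11 * (norm y)^2"
proof -
  have "0 < q00 * q11" using assms(2) zero_le_power2[of q01] by linarith
  then have q00: "0 < q00" using assms(1) by (simp add: zero_less_mult_iff)
  show q: "0 < q" using assms q00 by (simp add: q_def)
  have qe: "q * (q00 + q11) = q00 * q11 - q01^2" using assms q00 by (simp add: q_def)
  have "q * q11 < q00 * q11"
  proof -
    have "q * q11 < q * (q00 + q11)" using q q00 by simp
    then show ?thesis using qe zero_le_power2[of q01] by linarith
  qed
  then have r: "0 < q00 - q" using assms(1) by simp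
  have pr: "(q00 - q) * (q11 - q) - q01^2 = q^2" using qe by (simp add: algebra_simps power2_eq_square)
  have "0 \<le> (norm ((q00 - q) *\<^sub>R x + q01 *\<^sub>R y))^2 + q^2 * (norm y)^2" by simp
  also have "\<dots> = (q00 - q)^2 * (norm x)^2 + 2 * (q00 - q) * q01 * (x \<bullet> y) + (q01^2 + q^2) * (norm y)^2"
    unfolding norm_square_add_scaleR norm_scaleR power_mult_distrib power2_abs inner_scaleR_left by (simp add: algebra_simps)
  also have "\<dots> = (q00 - q) * ((q00 - q) * (norm x)^2 + 2 * q01 * (x \<bullet> y) + (q11 - q) * (norm y)^2)"
    unfolding pr[symmetric] by (simp add: algebra_simps power2_eq_square)
  finally have "0 \<le> (q00 - q) * (norm x)^2 + 2 * q01 * (x \<bullet> y) + (q11 - q) * (norm y)^2"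
    using r by (simp add: zero_le_mult_iff)
  then show "q * ((norm x)^2 + (norm y)^2) \<le> q00 * (norm x)^2 + 2 * q01 * (x \<bullet> y) + q11 * (norm y)^2"
    by (simp add: algebra_simps)
qed

lemma norm_square_sum3_le: "(norm (x + y + z))^2 \<le> 3 * ((norm x)^2 + (norm y)^2 + (norm z)^2)" for x y z :: "'b::real_inner"
proof -
  have "0 \<le> (norm (x - y))^2 + (norm (y - z))^2 + (norm (x - z))^2" by simp
  then show ?thesis
    unfolding power2_norm_eq_inner by (simp add: inner_add_left inner_add_right inner_diff_left inner_diff_right inner_commute algebra_simps)
qed

text \<open>Schur complement of the entry \<open>kd\<close>: \<open>kd\<close> times the form is the
  squared norm of the feedback \<open>s\<close> plus a form in the first two components, with
  coefficients \<open>q00\<close>, \<open>q01\<close> and \<open>q11\<close>. The two strict gain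
  inequalities make the latter positive.\<close>

lemma pid_form_coercive:
  fixes b ki kp kd :: real
  assumes "0 < b" "0 < ki" "0 < kp" "0 < kd" "2 * ki * kd < kp^2" "kp < b * kd^2"
  obtains p where "0 < p" "\<And>x :: 'b \<times> 'b \<times> 'b::euclidean_space. p * (norm x)^2 \<le> x \<bullet> pid_form b ki kp kd x"
proof -
  define q00 where "q00 = kd * (2 * b * ki * kp) - ki^2"
  define q01 where "q01 = kd * (2 * b * ki * kd) - ki * kp"
  define q11 where "q11 = kd * (2 * b * kp * kd - ki) - kp^2"
  have "q11 = 2 * kp * (b * kd^2 - kp) + (kp^2 - 2 * ki * kd) + ki * kd"
    by (simp add: q11_def algebra_simps power2_eq_square)
  moreover have "0 < 2 * kp * (b * kd^2 - kp)" "0 < ki * kd" using assms by simp_all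
  ultimately have q11: "0 < q11" using assms(5) by linarith
  \<comment> \<open>The determinant is arranged so that each summand is visibly positive: the
    factors \<open>b * kd^2 - kp\<close> and \<open>kp^2 - 2 * ki * kd\<close> are the two gain
    conditions.\<close>
  have "q00 * q11 - q01^2 = kd * (2 * b * ki * kp^2 * (b * kd^2 - kp) + 2 * b^2 * ki * kd^2 * (kp^2 - 2 * ki * kd) + ki^3)"
    by (simp add: q00_def q01_def q11_def algebra_simps power2_eq_square power3_eq_cube)
  also have "0 < \<dots>" using assms by (intro mult_pos_pos add_pos_pos) auto
  finally have det: "q01^2 < q00 * q11" by simp
  define q where "q = (q00 * q11 - q01^2) / (q00 + q11)"
  note bin = binary_form_coercive[OF q11 det, folded q_def]
  \<comment> \<open>From \<open>kd x2 = s - ki x0 - kp x1\<close> the norm of \<open>x2\<close> is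
    recovered; \<open>T\<close> dominates the three coefficients that result.\<close>
  define T where "T = 1 + 3 * (1 + ki^2 + kp^2) / kd^2"
  have T: "0 < T" "3 / kd^2 \<le> T" "1 + 3 / kd^2 * ki^2 \<le> T" "1 + 3 / kd^2 * kp^2 \<le> T"
    using assms(4) by (auto simp: T_def add_pos_pos divide_simps add_pos_nonneg)
  show ?thesis
  proof (rule that[of "min 1 q / (T * kd)"])
    show "0 < min 1 q / (T * kd)" using bin(1) T assms by simp
    fix x :: "'b \<times> 'b \<times> 'b"
    obtain x0 x1 x2 where x: "x = (x0, x1, x2)" by (cases x)
    define s where "s = ki *\<^sub>R x0 + kp *\<^sub>R x1 + kd *\<^sub>R x2"
    have V: "kd * (x \<bullet> pid_form b ki kp kd x) = (norm s)^2 + (q00 * (norm x0)^2 + 2 * q01 * (x0 \<bullet> x1) + q11 * (norm x1)^2)"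
      unfolding x s_def q00_def q01_def q11_def pid_form_def power2_norm_eq_inner
      by (simp add: inner_add_left inner_add_right inner_commute power2_eq_square algebra_simps)
    have "(norm (kd *\<^sub>R x2))^2 = (norm (s + (- ki) *\<^sub>R x0 + (- kp) *\<^sub>R x1))^2"
      by (simp add: s_def)
    also have "\<dots> \<le> 3 * ((norm s)^2 + (norm ((- ki) *\<^sub>R x0))^2 + (norm ((- kp) *\<^sub>R x1))^2)" by (rule norm_square_sum3_le)
    finally have "kd^2 * (norm x2)^2 \<le> 3 * ((norm s)^2 + ki^2 * (norm x0)^2 + kp^2 * (norm x1)^2)"
      by (simp add: power_mult_distrib)
    then have "(norm x2)^2 \<le> 3 / kd^2 * ((norm s)^2 + ki^2 * (norm x0)^2 + kp^2 * (norm x1)^2)"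
      using assms(4) by (simp add: field_simps)
    then have "(norm x)^2 \<le> (3 / kd^2) * (norm s)^2 + (1 + 3 / kd^2 * ki^2) * (norm x0)^2 + (1 + 3 / kd^2 * kp^2) * (norm x1)^2"
      unfolding x norm_triple_square by (simp add: distrib_left distrib_right mult.assoc)
    also have "\<dots> \<le> T * (norm s)^2 + T * (norm x0)^2 + T * (norm x1)^2"
      by (intro add_mono mult_right_mono T) auto
    finally have "min 1 q * (norm x)^2 \<le> min 1 q * (T * ((norm s)^2 + ((norm x0)^2 + (norm x1)^2)))"
      using bin(1) by (intro mult_left_mono) (auto simp: algebra_simps)
    also have "\<dots> = T * (min 1 q * (norm s)^2 + min 1 q * ((norm x0)^2 + (norm x1)^2))" by (simp add: algebra_simps)
    also have "\<dots> \<le> T * (1 * (norm s)^2 + q * ((norm x0)^2 + (norm x1)^2))"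
      using T by (intro mult_left_mono add_mono mult_right_mono) auto
    also have "\<dots> \<le> T * (kd * (x \<bullet> pid_form b ki kp kd x))"
      unfolding V using bin(2)[of x0 x1] T by (intro mult_left_mono) auto
    finally show "min 1 q / (T * kd) * (norm x)^2 \<le> x \<bullet> pid_form b ki kp kd x"
      using T assms(4) by (simp add: field_simps)
  qed
qed

text \<open>The product of the integral state with the Lipschitz term is absorbed by half of the integral
  state's dissipation, because both gain conditions force \<open>b kp, b kd > L1 + L2\<close>.\<close>

lemma pid_gain_margin:
  fixes b ki kp kd L1 L2 N1 N2 :: real
  assumes pos: "0 < b" "0 < ki" "0 < kp" "0 < kd" "0 < L1" "0 < L2" "0 < N1" "0 < N2"
    and g1: "(L1 + L2) * (kp + kd) / b + kd * N1^2 / b < kp^2 - 2 * ki * kd"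
    and g2: "(L1 + L2) * (kp + kd) / b + kd * N2^2 / b < kd^2 - kp / b"
  obtains \<mu> \<eta> where "0 < \<mu>" "0 < \<eta>" "\<And>a c e. 0 \<le> a \<Longrightarrow> 0 \<le> c \<Longrightarrow> 0 \<le> e \<Longrightarrow>
    2 * (ki * a + kp * c + kd * e) * (L1 * c + L2 * e) + 2 * kd * (1 + \<eta>) * (N1^2 * c^2 + N2^2 * e^2)
    \<le> 2 * b * (ki^2 * a^2 + (kp^2 - 2 * ki * kd) * c^2 + (kd^2 - kp / b) * e^2) - \<mu> * (a^2 + c^2 + e^2)"
proof -
  define l where "l = L1 + L2"
  have l: "0 < l" using pos by (simp add: l_def)
  have n: "0 \<le> kd * N1^2 / b" "0 \<le> kd * N2^2 / b" using pos by auto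
  have lp: "l / b \<le> kp"
  proof -
    have "l / b * kp \<le> l * (kp + kd) / b" using pos l by (simp add: divide_simps)
    also have "\<dots> \<le> kp * kp" using g1 n mult_pos_pos[OF pos(2) pos(4)] unfolding power2_eq_square l_def by linarith
    finally show ?thesis by (rule mult_right_le_imp_le) (rule pos)
  qed
  have ld: "l / b \<le> kd"
  proof -
    have "l / b * kd \<le> l * (kp + kd) / b" using pos l by (simp add: divide_simps)
    also have "\<dots> \<le> kd * kd" using g2 n divide_pos_pos[OF pos(3) pos(1)] unfolding power2_eq_square l_def by linarith
    finally show ?thesis by (rule mult_right_le_imp_le) (rule pos)
  qed
  \<comment> \<open>The slacks of the two gain conditions, multiplied by
    \<open>2 * b\<close>.\<close>
  define m1 where "m1 = 2 * b * (kp^2 - 2 * ki * kd) - 2 * l * (kp + kd) - 2 * kd * N1^2"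
  define m2 where "m2 = 2 * b * (kd^2 - kp / b) - 2 * l * (kp + kd) - 2 * kd * N2^2"
  have m1: "0 < m1"
  proof -
    have "b * ((L1 + L2) * (kp + kd) / b + kd * N1^2 / b) = (L1 + L2) * (kp + kd) + kd * N1^2"
      using pos by (simp add: field_simps)
    then show ?thesis using mult_strict_left_mono[OF g1 pos(1)] unfolding m1_def l_def by linarith
  qed
  have m2: "0 < m2"
  proof -
    have "b * ((L1 + L2) * (kp + kd) / b + kd * N2^2 / b) = (L1 + L2) * (kp + kd) + kd * N2^2"
      using pos by (simp add: field_simps)
    then show ?thesis using mult_strict_left_mono[OF g2 pos(1)] unfolding m2_def l_def by linarith
  qed
  \<comment> \<open>Half of each slack pays for the factor \<open>1 + \<eta>\<close> on the noise,
    which later makes room for the constant part of the noise coefficient; the other half goes into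
    \<open>\<mu>\<close>.\<close>
  define \<eta> where "\<eta> = min (m1 / (4 * kd * N1^2)) (m2 / (4 * kd * N2^2))"
  have \<eta>: "0 < \<eta>" using m1 m2 pos by (simp add: \<eta>_def)
  have e1: "2 * kd * \<eta> * N1^2 \<le> m1 / 2"
  proof -
    have "2 * kd * \<eta> * N1^2 \<le> 2 * kd * (m1 / (4 * kd * N1^2)) * N1^2"
      using pos by (intro mult_right_mono mult_left_mono) (auto simp: \<eta>_def)
    then show ?thesis using pos by simp
  qed
  have e2: "2 * kd * \<eta> * N2^2 \<le> m2 / 2"
  proof -
    have "2 * kd * \<eta> * N2^2 \<le> 2 * kd * (m2 / (4 * kd * N2^2)) * N2^2"
      using pos by (intro mult_right_mono mult_left_mono) (auto simp: \<eta>_def)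
    then show ?thesis using pos by simp
  qed
  \<comment> \<open>The first entry is half of the dissipation \<open>2 * b * ki^2\<close> of the
    integral state; the other half absorbs the product with the Lipschitz term.\<close>
  define \<mu> where "\<mu> = min (b * ki^2) (min (m1 / 2) (m2 / 2))"
  have \<mu>: "0 < \<mu>" "\<mu> \<le> b * ki^2" "\<mu> \<le> m1 / 2" "\<mu> \<le> m2 / 2" using m1 m2 pos by (auto simp: \<mu>_def)
  show ?thesis
  proof (rule that[OF \<mu>(1) \<eta>])
    fix a c e :: real assume ace: "0 \<le> a" "0 \<le> c" "0 \<le> e"
    define x where "x = L1 * c + L2 * e"
    have 1: "2 * (ki * a) * x \<le> b * ki^2 * a^2 + x^2 / b"
    proof -
      have "0 \<le> (b * (ki * a) - x)^2 / b" using pos by simp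
      also have "\<dots> = b * ki^2 * a^2 + x^2 / b - 2 * (ki * a) * x" using pos by (simp add: field_simps power2_eq_square)
      finally show ?thesis by simp
    qed
    have ce: "2 * c * e \<le> c^2 + e^2" using sum_squares_bound[of c e] by simp
    have 2: "x^2 \<le> l * (L1 * c^2 + L2 * e^2)"
    proof -
      have "L1 * L2 * (2 * c * e) \<le> L1 * L2 * (c^2 + e^2)" using pos by (intro mult_left_mono ce) auto
      then show ?thesis by (simp add: x_def l_def power2_eq_square algebra_simps)
    qed
    \<comment> \<open>The bound by \<open>kd\<close> is used for \<open>L1\<close> and the bound by
      \<open>kp\<close> for \<open>L2\<close>. The other pairing would produce
      \<open>3 * kp * L1 * c^2\<close>, which need not fit below
      \<open>2 * l * (kp + kd) * c^2\<close>.\<close>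
    have "x^2 / b \<le> l / b * (L1 * c^2 + L2 * e^2)" using 2 pos by (simp add: divide_right_mono)
    also have "\<dots> = l / b * (L1 * c^2) + l / b * (L2 * e^2)" by (simp add: distrib_left)
    also have "\<dots> \<le> kd * (L1 * c^2) + kp * (L2 * e^2)" using pos by (intro add_mono mult_right_mono lp ld) auto
    finally have 3: "x^2 / b \<le> kd * (L1 * c^2) + kp * (L2 * e^2)" .
    have 4: "2 * (kp * c + kd * e) * x \<le> 2 * kp * L1 * c^2 + 2 * kd * L2 * e^2 + (kp * L2 + kd * L1) * (c^2 + e^2)"
    proof -
      have "(kp * L2 + kd * L1) * (2 * c * e) \<le> (kp * L2 + kd * L1) * (c^2 + e^2)" using pos by (intro mult_left_mono ce) auto
      then show ?thesis by (simp add: x_def power2_eq_square algebra_simps)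
    qed
    have 5: "kd * (L1 * c^2) + kp * (L2 * e^2) + (2 * kp * L1 * c^2 + 2 * kd * L2 * e^2 + (kp * L2 + kd * L1) * (c^2 + e^2))
      \<le> 2 * l * (kp + kd) * (c^2 + e^2)"
    proof -
      have "0 \<le> (kp * L2 + 2 * kd * L2) * c^2 + (2 * kp * L1 + kd * L1) * e^2" using pos by simp
      then show ?thesis by (simp add: l_def algebra_simps)
    qed
    have 6: "2 * kd * (1 + \<eta>) * (N1^2 * c^2 + N2^2 * e^2) \<le> (2 * kd * N1^2 + m1 / 2) * c^2 + (2 * kd * N2^2 + m2 / 2) * e^2"
      using mult_right_mono[OF e1, of "c^2"] mult_right_mono[OF e2, of "e^2"] by (simp add: algebra_simps)
    have 7: "\<mu> * (a^2 + c^2 + e^2) \<le> b * ki^2 * a^2 + m1 / 2 * c^2 + m2 / 2 * e^2"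
      using mult_right_mono[OF \<mu>(2), of "a^2"] mult_right_mono[OF \<mu>(3), of "c^2"] mult_right_mono[OF \<mu>(4), of "e^2"]
      by (simp add: algebra_simps)
    have 8: "2 * b * (ki^2 * a^2 + (kp^2 - 2 * ki * kd) * c^2 + (kd^2 - kp / b) * e^2) =
      2 * b * ki^2 * a^2 + (m1 + 2 * l * (kp + kd) + 2 * kd * N1^2) * c^2 + (m2 + 2 * l * (kp + kd) + 2 * kd * N2^2) * e^2"
      by (simp add: m1_def m2_def algebra_simps)
    have "2 * (ki * a + kp * c + kd * e) * (L1 * c + L2 * e) = 2 * (ki * a) * x + 2 * (kp * c + kd * e) * x"
      by (simp add: x_def algebra_simps)
    then show "2 * (ki * a + kp * c + kd * e) * (L1 * c + L2 * e) + 2 * kd * (1 + \<eta>) * (N1^2 * c^2 + N2^2 * e^2)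
      \<le> 2 * b * (ki^2 * a^2 + (kp^2 - 2 * ki * kd) * c^2 + (kd^2 - kp / b) * e^2) - \<mu> * (a^2 + c^2 + e^2)"
      using 1 3 4 5 6 7 unfolding 8 by (simp add: algebra_simps)
  qed
qed

section \<open>The dissipation inequality of the scaled loop\<close>

lemma square_add_le:
  fixes x y \<eta> :: real
  assumes "0 < \<eta>"
  shows "(x + y)^2 \<le> (1 + \<eta>) * x^2 + (1 + 1 / \<eta>) * y^2"
proof -
  have "0 \<le> (\<eta> * x - y)^2 / \<eta>" using assms by simp
  also have "\<dots> = \<eta> * x^2 + y^2 / \<eta> - 2 * x * y" using assms by (simp add: field_simps power2_eq_square)
  finally show ?thesis by (simp add: algebra_simps power2_eq_square)
qed

text \<open>Pure algebra for arbitrary vectors. In the loop, \<open>\<Phi>\<close> is the change of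
  the drift caused by the control, \<open>\<Psi>\<close> the one caused by the state,
  \<open>q\<close> the bounded perturbation, \<open>w\<close> the motion of the shift and
  \<open>G\<close> the noise coefficient. After multiplication by \<epsilon> the terms governed by
  the gains are of order 1, while bounded perturbations keep a factor \<epsilon> and end up in
  \<open>C\<close>.\<close>

lemma pid_form_dissipative:
  fixes b ki kp kd L1 L2 N1 N2 G0 Q W :: real
  assumes pos: "0 < b" "0 < ki" "0 < kp" "0 < kd" "0 < L1" "0 < L2" "0 < N1" "0 < N2" "0 \<le> Q" "0 \<le> W"
    and g1: "(L1 + L2) * (kp + kd) / b + kd * N1^2 / b < kp^2 - 2 * ki * kd"
    and g2: "(L1 + L2) * (kp + kd) / b + kd * N2^2 / b < kd^2 - kp / b"
  obtains \<mu> C where "0 < \<mu>" "0 \<le> C"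
    "\<And>\<epsilon> (X0::'b::euclidean_space) X1 X2 \<Phi> \<Psi> q w (G::'b). \<lbrakk>0 < \<epsilon>; \<epsilon> \<le> 1;
      b / \<epsilon> * (norm (ki *\<^sub>R X0 + kp *\<^sub>R X1 + kd *\<^sub>R X2))^2 \<le> (ki *\<^sub>R X0 + kp *\<^sub>R X1 + kd *\<^sub>R X2) \<bullet> \<Phi>;
      norm \<Psi> \<le> L1 * (\<epsilon> * norm X1) + L2 * norm X2; norm q \<le> Q; norm w \<le> W;
      norm G \<le> N1 * (\<epsilon> * norm X1) + N2 * norm X2 + G0\<rbrakk> \<Longrightarrow>
      2 * ((X0, X1, X2) \<bullet> pid_form b ki kp kd ((1 / \<epsilon>) *\<^sub>R X1 - \<epsilon> *\<^sub>R w, (1 / \<epsilon>) *\<^sub>R X2, q - \<Phi> - \<Psi>))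
        + kd * (norm G)^2 \<le> C - \<mu> / \<epsilon> * (norm (X0, X1, X2))^2"
proof -
  obtain \<mu> \<eta> where \<mu>: "0 < \<mu>" and \<eta>: "0 < \<eta>" and margin: "\<And>a c e. 0 \<le> a \<Longrightarrow> 0 \<le> c \<Longrightarrow> 0 \<le> e \<Longrightarrow>
    2 * (ki * a + kp * c + kd * e) * (L1 * c + L2 * e) + 2 * kd * (1 + \<eta>) * (N1^2 * c^2 + N2^2 * e^2)
    \<le> 2 * b * (ki^2 * a^2 + (kp^2 - 2 * ki * kd) * c^2 + (kd^2 - kp / b) * e^2) - \<mu> * (a^2 + c^2 + e^2)"
    using pid_gain_margin[OF pos(1-8) g1 g2] by metis
  \<comment> \<open>A common coefficient for all terms linear in the state: the sum of the bounds of
    the individual ones.\<close>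
  define R where "R = 2 * W * (2 * b * ki * kp + 2 * b * ki * kd + ki) + 2 * Q * (ki + kp + kd)"
  have R: "0 \<le> R" using pos by (simp add: R_def)
  \<comment> \<open>The first summand is the cost of absorbing \<open>R\<close> times each of the
    three norms into \<open>\<mu> / 2\<close> times its square; this is why only
    \<open>\<mu> / 2\<close> survives. The second is the constant part of the noise.\<close>
  define C where "C = 3 * R^2 / (2 * \<mu>) + kd * (1 + 1 / \<eta>) * G0^2"
  have C: "0 \<le> C" using pos \<mu> \<eta> by (simp add: C_def)
  show ?thesis
  proof (rule that[of "\<mu> / 2" C])
    fix \<epsilon> and X0 X1 X2 \<Phi> \<Psi> q w G :: 'b
    assume \<epsilon>: "0 < \<epsilon>" "\<epsilon> \<le> 1"
      and \<Phi>: "b / \<epsilon> * (norm (ki *\<^sub>R X0 + kp *\<^sub>R X1 + kd *\<^sub>R X2))^2 \<le> (ki *\<^sub>R X0 + kp *\<^sub>R X1 + kd *\<^sub>R X2) \<bullet> \<Phi>"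
      and \<Psi>: "norm \<Psi> \<le> L1 * (\<epsilon> * norm X1) + L2 * norm X2" and q: "norm q \<le> Q" and w: "norm w \<le> W"
      and G: "norm G \<le> N1 * (\<epsilon> * norm X1) + N2 * norm X2 + G0"
    define a where "a = norm X0"
    define c where "c = norm X1"
    define e where "e = norm X2"
    have ace: "0 \<le> a" "0 \<le> c" "0 \<le> e" by (auto simp: a_def c_def e_def)
    have \<epsilon>c: "\<epsilon> * c \<le> c" using \<epsilon> ace by (simp add: mult_left_le_one_le)
    define s where "s = ki *\<^sub>R X0 + kp *\<^sub>R X1 + kd *\<^sub>R X2"
    define P0 where "P0 = (2 * b * ki * kp) *\<^sub>R X0 + (2 * b * ki * kd) *\<^sub>R X1 + ki *\<^sub>R X2"
    define P1 where "P1 = (2 * b * ki * kd) *\<^sub>R X0 + (2 * b * kp * kd - ki) *\<^sub>R X1 + kp *\<^sub>R X2"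
    have sn: "norm s \<le> ki * a + kp * c + kd * e"
      unfolding s_def a_def c_def e_def using pos by (intro norm_triangle_mono) auto
    have Pn: "norm P0 \<le> 2 * b * ki * kp * a + 2 * b * ki * kd * c + ki * e"
      unfolding P0_def a_def c_def e_def using pos by (intro norm_triangle_mono) auto
    have E: "(X0, X1, X2) \<bullet> pid_form b ki kp kd ((1 / \<epsilon>) *\<^sub>R X1 - \<epsilon> *\<^sub>R w, (1 / \<epsilon>) *\<^sub>R X2, q - \<Phi> - \<Psi>) =
      P0 \<bullet> ((1 / \<epsilon>) *\<^sub>R X1 - \<epsilon> *\<^sub>R w) + P1 \<bullet> ((1 / \<epsilon>) *\<^sub>R X2) + s \<bullet> (q - \<Phi> - \<Psi>)"
      unfolding pid_form_symmetric[symmetric] by (simp add: pid_form_def P0_def P1_def s_def)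
    have LV: "\<epsilon> * (2 * ((X0, X1, X2) \<bullet> pid_form b ki kp kd ((1 / \<epsilon>) *\<^sub>R X1 - \<epsilon> *\<^sub>R w, (1 / \<epsilon>) *\<^sub>R X2, q - \<Phi> - \<Psi>)))
      = 2 * (P0 \<bullet> X1 + P1 \<bullet> X2) - 2 * (\<epsilon> * (s \<bullet> \<Phi>)) - 2 * (\<epsilon> * (s \<bullet> \<Psi>)) - 2 * (\<epsilon> * (\<epsilon> * (P0 \<bullet> w))) + 2 * (\<epsilon> * (s \<bullet> q))"
      unfolding E using \<epsilon> by (simp add: inner_diff_right algebra_simps)
    have 1: "2 * (P0 \<bullet> X1 + P1 \<bullet> X2) - 2 * b * (norm s)^2 =
      - 2 * b * (ki^2 * a^2 + (kp^2 - 2 * ki * kd) * c^2 + (kd^2 - kp / b) * e^2)"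
      using pos(1) unfolding P0_def P1_def s_def a_def c_def e_def power2_norm_eq_inner
      by (simp add: inner_add_left inner_add_right inner_diff_left inner_diff_right inner_commute power2_eq_square algebra_simps)
    have 2: "b * (norm s)^2 \<le> \<epsilon> * (s \<bullet> \<Phi>)"
      using mult_left_mono[OF \<Phi>, of \<epsilon>] \<epsilon> by (simp add: s_def)
    have 3: "- 2 * (\<epsilon> * (s \<bullet> \<Psi>)) \<le> 2 * (ki * a + kp * c + kd * e) * (L1 * c + L2 * e)"
    proof -
      have "norm \<Psi> \<le> L1 * c + L2 * e"
        using \<Psi> mult_left_mono[OF \<epsilon>c less_imp_le[OF pos(5)]] unfolding c_def e_def by linarith
      then have "norm s * norm \<Psi> \<le> (ki * a + kp * c + kd * e) * (L1 * c + L2 * e)"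
        using sn pos ace by (intro mult_mono) auto
      then have "\<bar>s \<bullet> \<Psi>\<bar> \<le> (ki * a + kp * c + kd * e) * (L1 * c + L2 * e)"
        using Cauchy_Schwarz_ineq2[of s \<Psi>] by linarith
      moreover have "\<epsilon> * \<bar>s \<bullet> \<Psi>\<bar> \<le> \<bar>s \<bullet> \<Psi>\<bar>" using \<epsilon> by (simp add: mult_left_le_one_le)
      moreover have "- (\<epsilon> * (s \<bullet> \<Psi>)) \<le> \<epsilon> * \<bar>s \<bullet> \<Psi>\<bar>" using \<epsilon> by (simp add: abs_if)
      ultimately show ?thesis by linarith
    qed
    have 4: "- 2 * (\<epsilon> * (\<epsilon> * (P0 \<bullet> w))) \<le> \<epsilon> * (2 * W * (2 * b * ki * kp * a + 2 * b * ki * kd * c + ki * e))"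
    proof -
      have "norm P0 * norm w \<le> (2 * b * ki * kp * a + 2 * b * ki * kd * c + ki * e) * W"
        using Pn w pos ace by (intro mult_mono) auto
      then have "\<bar>P0 \<bullet> w\<bar> \<le> W * (2 * b * ki * kp * a + 2 * b * ki * kd * c + ki * e)"
        using Cauchy_Schwarz_ineq2[of P0 w] by (simp add: mult.commute)
      moreover have "\<epsilon> * \<bar>P0 \<bullet> w\<bar> \<le> \<bar>P0 \<bullet> w\<bar>" using \<epsilon> by (simp add: mult_left_le_one_le)
      moreover have "- (\<epsilon> * (P0 \<bullet> w)) \<le> \<epsilon> * \<bar>P0 \<bullet> w\<bar>" using \<epsilon> by (simp add: abs_if)
      ultimately have "- (\<epsilon> * (P0 \<bullet> w)) \<le> W * (2 * b * ki * kp * a + 2 * b * ki * kd * c + ki * e)" by linarith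
      from mult_left_mono[OF this, of "2 * \<epsilon>"] \<epsilon> show ?thesis by (simp add: algebra_simps)
    qed
    have 5: "2 * (\<epsilon> * (s \<bullet> q)) \<le> \<epsilon> * (2 * Q * (ki * a + kp * c + kd * e))"
    proof -
      have "norm s * norm q \<le> (ki * a + kp * c + kd * e) * Q" using sn q pos ace by (intro mult_mono) auto
      then have "s \<bullet> q \<le> Q * (ki * a + kp * c + kd * e)"
        using Cauchy_Schwarz_ineq2[of s q] by (simp add: mult.commute)
      from mult_left_mono[OF this, of "2 * \<epsilon>"] \<epsilon> show ?thesis by (simp add: algebra_simps)
    qed
    \<comment> \<open>Young's inequality produces \<epsilon> squared; one factor is dropped because
      \<open>\<epsilon> \<le> 1\<close>, and the one that stays cancels in the final division by
      \<epsilon>.\<close>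
    have y: "\<epsilon> * (R * x) \<le> \<mu> / 2 * x^2 + \<epsilon> * (R^2 / (2 * \<mu>))" if "0 \<le> x" for x
    proof -
      have "0 \<le> (\<mu> * x - \<epsilon> * R)^2 / (2 * \<mu>)" using \<mu> by simp
      also have "\<dots> = \<mu> / 2 * x^2 + \<epsilon> * \<epsilon> * (R^2 / (2 * \<mu>)) - \<epsilon> * (R * x)" using \<mu> by (simp add: field_simps power2_eq_square)
      also have "\<epsilon> * \<epsilon> * (R^2 / (2 * \<mu>)) \<le> \<epsilon> * (R^2 / (2 * \<mu>))"
        using \<epsilon> \<mu> by (intro mult_right_mono) (auto simp: mult_left_le_one_le)
      finally show ?thesis by simp
    qed
    have 6: "\<epsilon> * (2 * W * (2 * b * ki * kp * a + 2 * b * ki * kd * c + ki * e)) + \<epsilon> * (2 * Q * (ki * a + kp * c + kd * e))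
      \<le> \<mu> / 2 * (a^2 + c^2 + e^2) + \<epsilon> * (3 * R^2 / (2 * \<mu>))"
    proof -
      have "2 * W * (2 * b * ki * kp * a + 2 * b * ki * kd * c + ki * e) + 2 * Q * (ki * a + kp * c + kd * e) \<le> R * a + R * c + R * e"
      proof -
        have "0 \<le> (2 * W * (2 * b * ki * kd + ki) + 2 * Q * (kp + kd)) * a + (2 * W * (2 * b * ki * kp + ki) + 2 * Q * (ki + kd)) * c
          + (2 * W * (2 * b * ki * kp + 2 * b * ki * kd) + 2 * Q * (ki + kp)) * e" using pos ace by simp
        then show ?thesis by (simp add: R_def algebra_simps)
      qed
      from mult_left_mono[OF this, of \<epsilon>] \<epsilon> y[OF ace(1)] y[OF ace(2)] y[OF ace(3)] show ?thesis by (simp add: algebra_simps add_divide_distrib)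
    qed
    have 7: "\<epsilon> * (kd * (norm G)^2) \<le> 2 * kd * (1 + \<eta>) * (N1^2 * c^2 + N2^2 * e^2) + \<epsilon> * (kd * (1 + 1 / \<eta>) * G0^2)"
    proof -
      have "norm G \<le> (N1 * c + N2 * e) + G0"
        using G mult_left_mono[OF \<epsilon>c less_imp_le[OF pos(7)]] unfolding c_def e_def by linarith
      then have "(norm G)^2 \<le> ((N1 * c + N2 * e) + G0)^2" by (intro power_mono) auto
      also have "\<dots> \<le> (1 + \<eta>) * (N1 * c + N2 * e)^2 + (1 + 1 / \<eta>) * G0^2" by (rule square_add_le[OF \<eta>])
      also have "(1 + \<eta>) * (N1 * c + N2 * e)^2 \<le> (1 + \<eta>) * (2 * (N1^2 * c^2 + N2^2 * e^2))"
      proof (intro mult_left_mono)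
        show "(N1 * c + N2 * e)^2 \<le> 2 * (N1^2 * c^2 + N2^2 * e^2)"
          using sum_squares_bound[of "N1 * c" "N2 * e"] by (simp add: power2_sum power_mult_distrib)
      qed (use \<eta> in simp)
      finally have "\<epsilon> * (kd * (norm G)^2) \<le> \<epsilon> * (kd * ((1 + \<eta>) * (2 * (N1^2 * c^2 + N2^2 * e^2)) + (1 + 1 / \<eta>) * G0^2))"
        using \<epsilon> pos by (intro mult_left_mono) auto
      also have "\<dots> = \<epsilon> * (2 * kd * (1 + \<eta>) * (N1^2 * c^2 + N2^2 * e^2)) + \<epsilon> * (kd * (1 + 1 / \<eta>) * G0^2)" by (simp add: algebra_simps)
      also have "\<epsilon> * (2 * kd * (1 + \<eta>) * (N1^2 * c^2 + N2^2 * e^2)) \<le> 2 * kd * (1 + \<eta>) * (N1^2 * c^2 + N2^2 * e^2)"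
        using \<epsilon> pos \<eta> by (intro mult_left_le_one_le) auto
      finally show ?thesis by simp
    qed
    have n: "(norm (X0, X1, X2))^2 = a^2 + c^2 + e^2" by (simp add: norm_triple_square a_def c_def e_def)
    let ?LV = "2 * ((X0, X1, X2) \<bullet> pid_form b ki kp kd ((1 / \<epsilon>) *\<^sub>R X1 - \<epsilon> *\<^sub>R w, (1 / \<epsilon>) *\<^sub>R X2, q - \<Phi> - \<Psi>)) + kd * (norm G)^2"
    have "\<epsilon> * ?LV \<le> \<epsilon> * C - \<mu> / 2 * (a^2 + c^2 + e^2)"
      using LV 1 2 3 4 5 6 7 margin[OF ace] by (simp add: C_def distrib_left)
    then have "?LV \<le> (\<epsilon> * C - \<mu> / 2 * (a^2 + c^2 + e^2)) / \<epsilon>" using \<epsilon> by (simp add: pos_le_divide_eq mult.commute)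
    then show "?LV \<le> C - \<mu> / 2 / \<epsilon> * (norm (X0, X1, X2))^2"
      unfolding n using \<epsilon> by (simp add: diff_divide_distrib)
  qed (use \<mu> C in auto)
qed

section \<open>The closed loop\<close>

lemma has_vector_derivative_continuous_on:
  assumes "\<And>t. 0 \<le> t \<Longrightarrow> (h has_vector_derivative h' t) (at t within {0..})"
  shows "continuous_on {0..} h"
  unfolding continuous_on_eq_continuous_within using assms has_vector_derivative_continuous by fastforce

lemma integral_of_vector_derivative:
  fixes h :: "real \<Rightarrow> 'b::euclidean_space"
  assumes "\<And>t. 0 \<le> t \<Longrightarrow> (h has_vector_derivative h' t) (at t within {0..})" "0 \<le> t"
  shows "integral {0..t} h' = h t - h 0"
proof (rule integral_unique, rule fundamental_theorem_of_calculus)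
  fix s assume "s \<in> {0..t}"
  then show "(h has_vector_derivative h' s) (at s within {0..t})"
    by (intro has_vector_derivative_within_subset[OF assms(1)]) auto
qed (rule assms(2))

lemma integral_continuous_on_atLeast:
  fixes u :: "real \<Rightarrow> 'b::euclidean_space"
  assumes "continuous_on {0..} u"
  shows "continuous_on {0..} (\<lambda>t. integral {0..t} u)"
  by (rule has_vector_derivative_continuous_on) (rule integral_has_vector_derivative_atLeast[OF assms])

context brownian_motion
begin

lemma integral_adapted:
  fixes X :: "real \<Rightarrow> 'a \<Rightarrow> 'b::euclidean_space"
  assumes "0 \<le> t" "\<And>s. 0 \<le> s \<Longrightarrow> X s \<in> borel_measurable (F s)"
    and c: "\<And>\<omega>. \<omega> \<in> space M \<Longrightarrow> continuous_on {0..} (\<lambda>s. X s \<omega>)"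
  shows "(\<lambda>\<omega>. integral {0..t} (\<lambda>s. X s \<omega>)) \<in> borel_measurable (F t)"
proof -
  have "(\<lambda>(\<omega>, s). indicat_real {0..t} s *\<^sub>R X s \<omega>) \<in> borel_measurable (F t \<Otimes>\<^sub>M lborel)"
  proof (rule left_continuous_measurable[OF assms(1)])
    fix s assume "s \<in> {0..t}" then show "X s \<in> borel_measurable (F t)" using F_mono[OF assms(2)] by auto
  next
    fix \<omega> assume "\<omega> \<in> space (F t)"
    then show "left_continuous t (\<lambda>s. X s \<omega>)"
      unfolding left_continuous_def using continuous_on_imp_at_left[OF c] by (auto simp: space_F)
  qed
  then have "(\<lambda>\<omega>. LINT s|lborel. indicat_real {0..t} s *\<^sub>R X s \<omega>) \<in> borel_measurable (F t)"
    by (rule lborel.borel_measurable_lebesgue_integral)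
  moreover have "integral {0..t} (\<lambda>s. X s \<omega>) = (LINT s|lborel. indicat_real {0..t} s *\<^sub>R X s \<omega>)" if "\<omega> \<in> space M" for \<omega>
  proof -
    have "set_integrable lborel {0..t} (\<lambda>s. X s \<omega>)"
      by (intro borel_integrable_atLeastAtMost' continuous_on_subset[OF c[OF that]]) auto
    from set_borel_integral_eq_integral(2)[OF this] show ?thesis by (simp add: set_lebesgue_integral_def)
  qed
  ultimately show ?thesis by (subst measurable_cong) (auto simp: space_F)
qed

text \<open>The constant is explicit so that its independence of \<epsilon> and \<open>t\<close> is
  visible: the moment bound is the initial form plus \<open>C / \<alpha>\<close>, both at most a
  constant times \<epsilon>, and coercivity divides by \<open>p\<close>.\<close>

lemma pid_error_moment_bound:
  fixes f :: "'b \<times> 'b \<times> 'b \<Rightarrow> 'b::euclidean_space" and g :: "'b \<times> 'b \<Rightarrow> 'b" and v v' y y' y'' d :: "real \<Rightarrow> 'b"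
  assumes fc: "continuous_on UNIV f" and gc: "continuous_on UNIV g"
    and f_lip: "\<And>x1 x2 x1' x2' u. norm (f (x1, x2, u) - f (x1', x2', u)) \<le> L1 * norm (x1 - x1') + L2 * norm (x2 - x2')"
    and f_mono: "\<And>x1 x2 u u'. b * (norm (u - u'))^2 \<le> (u - u') \<bullet> (f (x1, x2, u) - f (x1, x2, u'))"
    and g_lip: "\<And>x1 x2 x1' x2'. norm (g (x1, x2) - g (x1', x2')) \<le> N1 * norm (x1 - x1') + N2 * norm (x2 - x2')"
    and y: "\<And>t. 0 \<le> t \<Longrightarrow> (y has_vector_derivative y' t) (at t within {0..})"
    and y': "\<And>t. 0 \<le> t \<Longrightarrow> (y' has_vector_derivative y'' t) (at t within {0..})" and y''c: "continuous_on {0..} y''"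
    and dc: "continuous_on {0..} d"
    and v: "\<And>t. 0 \<le> t \<Longrightarrow> (v has_vector_derivative v' t) (at t within {0..})" and v'c: "continuous_on {0..} v'"
    and v'b: "\<And>t. 0 \<le> t \<Longrightarrow> norm (v' t) \<le> ki * W"
    and qb: "\<And>t. 0 \<le> t \<Longrightarrow> norm (y'' t - f (y t, y' t, v t) - d t) \<le> Q"
    and gb: "\<And>t. 0 \<le> t \<Longrightarrow> norm (g (y t, y' t)) \<le> G0"
    and pos: "0 < b" "0 < ki" "0 < p" "0 < \<mu>" "0 \<le> C"
    and coercive: "\<And>x :: 'b \<times> 'b \<times> 'b. p * (norm x)^2 \<le> x \<bullet> pid_form b ki kp kd x"
    and diss: "\<And>\<epsilon> (X0::'b) X1 X2 \<Phi> \<Psi> q w (G::'b). \<lbrakk>0 < \<epsilon>; \<epsilon> \<le> 1;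
      b / \<epsilon> * (norm (ki *\<^sub>R X0 + kp *\<^sub>R X1 + kd *\<^sub>R X2))^2 \<le> (ki *\<^sub>R X0 + kp *\<^sub>R X1 + kd *\<^sub>R X2) \<bullet> \<Phi>;
      norm \<Psi> \<le> L1 * (\<epsilon> * norm X1) + L2 * norm X2; norm q \<le> Q; norm w \<le> W;
      norm G \<le> N1 * (\<epsilon> * norm X1) + N2 * norm X2 + G0\<rbrakk> \<Longrightarrow>
      2 * ((X0, X1, X2) \<bullet> pid_form b ki kp kd ((1 / \<epsilon>) *\<^sub>R X1 - \<epsilon> *\<^sub>R w, (1 / \<epsilon>) *\<^sub>R X2, q - \<Phi> - \<Psi>))
        + kd * (norm G)^2 \<le> C - \<mu> / \<epsilon> * (norm (X0, X1, X2))^2"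
    and \<epsilon>: "0 < \<epsilon>" "\<epsilon> \<le> 1"
    and sol: "closed_loop_solution M F B f g d y y' kp ki kd \<epsilon> (y 0) (y' 0) x1 x2"
    and t: "0 \<le> t"
  defines "K \<equiv> onorm (pid_form b ki kp kd :: 'b \<times> 'b \<times> 'b \<Rightarrow> _) + 1"
  defines "c \<equiv> (K * (norm (v 0) / ki)^2 + C * K / \<mu>) / p"
  shows "(\<integral>\<^sup>+\<omega>. ennreal ((norm (y t - x1 t \<omega>))^2) \<partial>M) \<le> ennreal (c * \<epsilon>^3)"
    "(\<integral>\<^sup>+\<omega>. ennreal ((norm (y' t - x2 t \<omega>))^2) \<partial>M) \<le> ennreal (c * \<epsilon>)"
proof -
  let ?P = "pid_form b ki kp kd :: 'b \<times> 'b \<times> 'b \<Rightarrow> 'b \<times> 'b \<times> 'b"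
  have "0 \<le> onorm ?P" by (rule onorm_pos_le[OF bounded_linear_pid_form])
  then have K: "0 < K" by (simp add: K_def)
  have quad_le: "x \<bullet> ?P x \<le> K * (norm x)^2" for x
  proof -
    have "x \<bullet> ?P x \<le> norm x * norm (?P x)" by (rule norm_cauchy_schwarz)
    also have "\<dots> \<le> norm x * (onorm ?P * norm x)" by (intro mult_left_mono onorm[OF bounded_linear_pid_form]) auto
    also have "\<dots> = onorm ?P * (norm x)^2" by (simp add: power2_eq_square)
    also have "\<dots> \<le> K * (norm x)^2" by (intro mult_right_mono) (auto simp: K_def)
    finally show ?thesis .
  qed
  have yc: "continuous_on {0..} y" "continuous_on {0..} y'" "continuous_on {0..} v"
    using has_vector_derivative_continuous_on y y' v by blast+
  have x1m: "x1 s \<in> borel_measurable (F s)" and x2m: "x2 s \<in> borel_measurable (F s)" if "0 \<le> s" for s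
    using sol that unfolding closed_loop_solution_def by auto
  have x1c: "continuous_on {0..} (\<lambda>s. x1 s \<omega>)" and x2c: "continuous_on {0..} (\<lambda>s. x2 s \<omega>)" if "\<omega> \<in> space M" for \<omega>
    using sol that unfolding closed_loop_solution_def by auto
  define E where "E s \<omega> = y s - x1 s \<omega>" for s \<omega>
  define E' where "E' s \<omega> = y' s - x2 s \<omega>" for s \<omega>
  define u where "u s \<omega> = pid_control kp ki kd \<epsilon> (\<lambda>v. y v - x1 v \<omega>) (\<lambda>v. y' v - x2 v \<omega>) s" for s \<omega>
  \<comment> \<open>The shift by \<open>(\<epsilon> / ki) *\<^sub>R v s\<close> is chosen so that
    \<open>ki *\<^sub>R X0\<close> contributes exactly \<open>- v\<close> to the control after
    division by \<epsilon>; the control error \<open>u - v\<close> is then linear in the scaled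
    state.\<close>
  define X0 where "X0 s \<omega> = (1 / \<epsilon>^2) *\<^sub>R integral {0..s} (\<lambda>r. E r \<omega>) - (\<epsilon> / ki) *\<^sub>R v s" for s \<omega>
  define z where "z s \<omega> = (X0 s \<omega>, (1 / \<epsilon>) *\<^sub>R E s \<omega>, E' s \<omega>)" for s \<omega>
  define A where "A s \<omega> = ((1 / \<epsilon>^2) *\<^sub>R E s \<omega> - (\<epsilon> / ki) *\<^sub>R v' s, (1 / \<epsilon>) *\<^sub>R E' s \<omega>,
    y'' s - f (x1 s \<omega>, x2 s \<omega>, u s \<omega>) - d s)" for s \<omega>
  define H where "H s \<omega> = g (x1 s \<omega>, x2 s \<omega>)" for s \<omega>
  \<comment> \<open>Noise enters only through \<open>x2\<close>, which occurs in the last component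
    with a minus sign.\<close>
  define L where "L x = (0 :: 'b, 0 :: 'b, - x)" for x :: 'b
  \<comment> \<open>The last two components are 0 because the reference starts at the initial
    position and velocity; the first is the shift alone.\<close>
  define z0 where "z0 = (- ((\<epsilon> / ki) *\<^sub>R v 0), 0 :: 'b, 0 :: 'b)"
  \<comment> \<open>The dissipation is given in terms of the squared norm; as the form is at most
    \<open>K\<close> times that, this is the rate in terms of the form.\<close>
  define \<alpha> where "\<alpha> = \<mu> / (\<epsilon> * K)"
  have u_eq: "u s \<omega> = (1 / \<epsilon>) *\<^sub>R (ki *\<^sub>R X0 s \<omega> + kp *\<^sub>R ((1 / \<epsilon>) *\<^sub>R E s \<omega>) + kd *\<^sub>R E' s \<omega>) + v s" for s \<omega>
    using \<epsilon>(1) pos(2) unfolding u_def pid_control_def X0_def E_def E'_def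
    by (simp add: algebra_simps power2_eq_square power3_eq_cube)
  have Ec: "continuous_on {0..} (\<lambda>s. E s \<omega>)" "continuous_on {0..} (\<lambda>s. E' s \<omega>)" if "\<omega> \<in> space M" for \<omega>
    unfolding E_def E'_def using x1c[OF that] x2c[OF that] yc by (auto intro: continuous_intros)
  have Em: "E s \<in> borel_measurable (F s)" "E' s \<in> borel_measurable (F s)" if "0 \<le> s" for s
    unfolding E_def[abs_def] E'_def[abs_def] using x1m[OF that] x2m[OF that] by auto
  have X0c: "continuous_on {0..} (\<lambda>s. X0 s \<omega>)" if "\<omega> \<in> space M" for \<omega>
    unfolding X0_def using Ec[OF that] yc by (intro continuous_intros integral_continuous_on_atLeast) auto
  have X0m: "X0 s \<in> borel_measurable (F s)" if "0 \<le> s" for s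
  proof -
    have [measurable]: "(\<lambda>\<omega>. integral {0..s} (\<lambda>r. E r \<omega>)) \<in> borel_measurable (F s)"
      by (rule integral_adapted[OF that Em(1) Ec(1)])
    show ?thesis unfolding X0_def[abs_def] by measurable
  qed
  have uc: "continuous_on {0..} (\<lambda>s. u s \<omega>)" if "\<omega> \<in> space M" for \<omega>
    unfolding u_eq using X0c[OF that] Ec[OF that] yc by (intro continuous_intros) auto
  have um: "u s \<in> borel_measurable (F s)" if "0 \<le> s" for s
    unfolding u_eq[abs_def] using X0m[OF that] Em[OF that] by measurable
  have [measurable]: "f \<in> borel_measurable borel" "g \<in> borel_measurable borel"
    using fc gc by (auto intro: borel_measurable_continuous_onI)
  have fxc: "continuous_on {0..} (\<lambda>s. f (x1 s \<omega>, x2 s \<omega>, u s \<omega>))" if "\<omega> \<in> space M" for \<omega>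
    by (rule continuous_on_compose2[OF fc]) (use x1c[OF that] x2c[OF that] uc[OF that] in \<open>auto intro!: continuous_intros\<close>)
  have Hc: "continuous_on {0..} (\<lambda>s. H s \<omega>)" if "\<omega> \<in> space M" for \<omega>
    unfolding H_def by (rule continuous_on_compose2[OF gc]) (use x1c[OF that] x2c[OF that] in \<open>auto intro!: continuous_intros\<close>)
  have Hm: "H s \<in> borel_measurable (F s)" if "0 \<le> s" for s
    unfolding H_def[abs_def] using x1m[OF that] x2m[OF that] by measurable
  have zc: "continuous_on {0..} (\<lambda>s. z s \<omega>)" if "\<omega> \<in> space M" for \<omega>
    unfolding z_def using X0c[OF that] Ec[OF that] by (intro continuous_intros) auto
  have zm: "z s \<in> borel_measurable (F s)" if "0 \<le> s" for s
    unfolding z_def[abs_def] using X0m[OF that] Em[OF that] by measurable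
  have Ac: "continuous_on {0..} (\<lambda>s. A s \<omega>)" if "\<omega> \<in> space M" for \<omega>
    unfolding A_def using Ec[OF that] v'c y''c fxc[OF that] dc by (intro continuous_intros) auto
  have Am: "A s \<in> borel_measurable (F s)" if "0 \<le> s" for s
    unfolding A_def[abs_def] using x1m[OF that] x2m[OF that] um[OF that] Em[OF that] by measurable
  have bL: "bounded_linear L"
    unfolding L_def[abs_def] by (intro bounded_linear_Pair bounded_linear_zero bounded_linear_minus bounded_linear_ident)
  have int: "h integrable_on {0..s}" if "continuous_on {0..} h" for h :: "real \<Rightarrow> 'c::euclidean_space" and s
    by (rule integrable_continuous_real) (rule continuous_on_subset[OF that], auto)
  have ito: "\<exists>J. has_ito_integral M F B s H J \<and> (AE \<omega> in M. z s \<omega> = z0 + integral {0..s} (\<lambda>r. A r \<omega>) + L (J \<omega>))" if s: "0 \<le> s" for s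
  proof -
    have e1: "AE \<omega> in M. x1 s \<omega> = y 0 + integral {0..s} (\<lambda>r. x2 r \<omega>)"
      using sol s unfolding closed_loop_solution_def by auto
    obtain J where J: "has_ito_integral M F B s H J"
      and e2: "AE \<omega> in M. x2 s \<omega> = y' 0 + integral {0..s} (\<lambda>r. f (x1 r \<omega>, x2 r \<omega>, u r \<omega>) + d r) + J \<omega>"
      using sol s unfolding closed_loop_solution_def H_def[abs_def] u_def by blast
    have "AE \<omega> in M. z s \<omega> = z0 + integral {0..s} (\<lambda>r. A r \<omega>) + L (J \<omega>)"
      using e1 e2 AE_space
    proof eventually_elim
      fix \<omega> assume e1: "x1 s \<omega> = y 0 + integral {0..s} (\<lambda>r. x2 r \<omega>)"
        and e2: "x2 s \<omega> = y' 0 + integral {0..s} (\<lambda>r. f (x1 r \<omega>, x2 r \<omega>, u r \<omega>) + d r) + J \<omega>" and \<omega>: "\<omega> \<in> space M"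
      note Ai = int[OF Ac[OF \<omega>]]
      have c0: "fst (integral {0..s} (\<lambda>r. A r \<omega>)) = (1 / \<epsilon>^2) *\<^sub>R integral {0..s} (\<lambda>r. E r \<omega>) - (\<epsilon> / ki) *\<^sub>R (v s - v 0)"
      proof -
        have "fst (integral {0..s} (\<lambda>r. A r \<omega>)) = integral {0..s} (\<lambda>r. (1 / \<epsilon>^2) *\<^sub>R E r \<omega> - (\<epsilon> / ki) *\<^sub>R v' r)"
          using integral_linear[OF Ai bounded_linear_fst] by (simp add: comp_def A_def)
        also have "\<dots> = integral {0..s} (\<lambda>r. (1 / \<epsilon>^2) *\<^sub>R E r \<omega>) - integral {0..s} (\<lambda>r. (\<epsilon> / ki) *\<^sub>R v' r)"
          by (intro Henstock_Kurzweil_Integration.integral_diff int continuous_intros Ec[OF \<omega>] v'c)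
        finally show ?thesis using integral_of_vector_derivative[OF v s] by simp
      qed
      have c1: "fst (snd (integral {0..s} (\<lambda>r. A r \<omega>))) = (1 / \<epsilon>) *\<^sub>R E s \<omega>"
      proof -
        have "fst (snd (integral {0..s} (\<lambda>r. A r \<omega>))) = integral {0..s} (\<lambda>r. (1 / \<epsilon>) *\<^sub>R (y' r - x2 r \<omega>))"
          using integral_linear[OF Ai bounded_linear_compose[OF bounded_linear_fst bounded_linear_snd]]
          by (simp add: comp_def A_def E'_def)
        also have "\<dots> = (1 / \<epsilon>) *\<^sub>R integral {0..s} (\<lambda>r. y' r - x2 r \<omega>)" by simp
        also have "integral {0..s} (\<lambda>r. y' r - x2 r \<omega>) = integral {0..s} y' - integral {0..s} (\<lambda>r. x2 r \<omega>)"
          by (intro Henstock_Kurzweil_Integration.integral_diff int yc x2c[OF \<omega>])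
        also have "\<dots> = E s \<omega>" using e1 integral_of_vector_derivative[OF y s] by (simp add: E_def)
        finally show ?thesis .
      qed
      have c2: "snd (snd (integral {0..s} (\<lambda>r. A r \<omega>))) = E' s \<omega> + J \<omega>"
      proof -
        have "snd (snd (integral {0..s} (\<lambda>r. A r \<omega>))) = integral {0..s} (\<lambda>r. y'' r - (f (x1 r \<omega>, x2 r \<omega>, u r \<omega>) + d r))"
          using integral_linear[OF Ai bounded_linear_compose[OF bounded_linear_snd bounded_linear_snd]]
          by (simp add: comp_def A_def diff_diff_eq)
        also have "\<dots> = integral {0..s} y'' - integral {0..s} (\<lambda>r. f (x1 r \<omega>, x2 r \<omega>, u r \<omega>) + d r)"
          by (intro Henstock_Kurzweil_Integration.integral_diff int continuous_intros y''c fxc[OF \<omega>] dc)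
        finally show ?thesis using e2 integral_of_vector_derivative[OF y' s] by (simp add: E'_def)
      qed
      show "z s \<omega> = z0 + integral {0..s} (\<lambda>r. A r \<omega>) + L (J \<omega>)"
        by (rule prod_eqI; (rule prod_eqI)?) (simp_all add: z_def z0_def L_def c0 c1 c2 X0_def scaleR_right_diff_distrib)
    qed
    then show ?thesis using J by blast
  qed
  have \<alpha>: "0 < \<alpha>" using \<epsilon> pos K by (simp add: \<alpha>_def)
  have dis: "2 * (z s \<omega> \<bullet> ?P (A s \<omega>)) + L (H s \<omega>) \<bullet> ?P (L (H s \<omega>)) \<le> C - \<alpha> * (z s \<omega> \<bullet> ?P (z s \<omega>))" if s: "0 \<le> s" for s \<omega>
  proof -
    define X1 where "X1 = (1 / \<epsilon>) *\<^sub>R E s \<omega>"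
    define X2 where "X2 = E' s \<omega>"
    define S where "S = ki *\<^sub>R X0 s \<omega> + kp *\<^sub>R X1 + kd *\<^sub>R X2"
    define \<Phi> where "\<Phi> = f (x1 s \<omega>, x2 s \<omega>, u s \<omega>) - f (x1 s \<omega>, x2 s \<omega>, v s)"
    define \<Psi> where "\<Psi> = f (x1 s \<omega>, x2 s \<omega>, v s) - f (y s, y' s, v s)"
    define q where "q = y'' s - f (y s, y' s, v s) - d s"
    define w where "w = (1 / ki) *\<^sub>R v' s"
    have nE: "norm (x1 s \<omega> - y s) = \<epsilon> * norm X1" "norm (x2 s \<omega> - y' s) = norm X2"
      using \<epsilon> by (auto simp: X1_def X2_def E_def E'_def norm_minus_commute)
    have "u s \<omega> - v s = (1 / \<epsilon>) *\<^sub>R S" by (simp add: u_eq S_def X1_def X2_def)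
    then have "b * ((norm S)^2 / \<epsilon>^2) \<le> (1 / \<epsilon>) * (S \<bullet> \<Phi>)"
      using f_mono[of "u s \<omega>" "v s" "x1 s \<omega>" "x2 s \<omega>"] \<epsilon> by (simp add: \<Phi>_def power_divide)
    from mult_left_mono[OF this, of \<epsilon>] have h1: "b / \<epsilon> * (norm S)^2 \<le> S \<bullet> \<Phi>"
      using \<epsilon> by (simp add: power2_eq_square)
    have h2: "norm \<Psi> \<le> L1 * (\<epsilon> * norm X1) + L2 * norm X2"
      using f_lip[of "x1 s \<omega>" "x2 s \<omega>" "v s" "y s" "y' s"] by (simp add: \<Psi>_def nE)
    have h3: "norm q \<le> Q" unfolding q_def by (rule qb[OF s])
    have h4: "norm w \<le> W" using v'b[OF s] pos(2) by (simp add: w_def divide_simps mult.commute)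
    have h5: "norm (H s \<omega>) \<le> N1 * (\<epsilon> * norm X1) + N2 * norm X2 + G0"
      using g_lip[of "x1 s \<omega>" "x2 s \<omega>" "y s" "y' s"] gb[OF s] norm_triangle_ineq2[of "H s \<omega>" "g (y s, y' s)"]
      by (simp add: H_def nE)
    have "A s \<omega> = ((1 / \<epsilon>) *\<^sub>R X1 - \<epsilon> *\<^sub>R w, (1 / \<epsilon>) *\<^sub>R X2, q - \<Phi> - \<Psi>)"
      by (simp add: A_def X1_def X2_def w_def q_def \<Phi>_def \<Psi>_def power2_eq_square)
    moreover have "z s \<omega> = (X0 s \<omega>, X1, X2)" by (simp add: z_def X1_def X2_def)
    moreover have "L (H s \<omega>) \<bullet> ?P (L (H s \<omega>)) = kd * (norm (H s \<omega>))^2"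
      by (simp add: L_def pid_form_def power2_norm_eq_inner)
    ultimately have "2 * (z s \<omega> \<bullet> ?P (A s \<omega>)) + L (H s \<omega>) \<bullet> ?P (L (H s \<omega>)) \<le> C - \<mu> / \<epsilon> * (norm (z s \<omega>))^2"
      using diss[OF \<epsilon> h1[unfolded S_def] h2 h3 h4 h5] by simp
    also have "\<dots> \<le> C - \<alpha> * (z s \<omega> \<bullet> ?P (z s \<omega>))"
    proof -
      have "\<alpha> * (z s \<omega> \<bullet> ?P (z s \<omega>)) \<le> \<alpha> * (K * (norm (z s \<omega>))^2)" using \<alpha> by (intro mult_left_mono quad_le) auto
      also have "\<dots> = \<mu> / \<epsilon> * (norm (z s \<omega>))^2" using K \<epsilon> by (simp add: \<alpha>_def)
      finally show ?thesis by simp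
    qed
    finally show ?thesis .
  qed
  interpret D: dissipative_ito_process M F B z A H L ?P z0 \<alpha> C
  proof (rule dissipative_ito_process.intro[OF brownian_motion_axioms], rule dissipative_ito_process_axioms.intro)
    show "0 \<le> x \<bullet> ?P x" for x
      using coercive[of x] pos(3) by (meson mult_nonneg_nonneg order_trans less_imp_le zero_le_power2)
  qed (rule zm Am Hm zc Ac Hc bL bounded_linear_pid_form pid_form_symmetric ito \<alpha> pos(5) dis; assumption)+
  \<comment> \<open>The form is of order \<epsilon> squared; one factor is given up to match the
    order of \<open>C / \<alpha>\<close>.\<close>
  have z0: "z0 \<bullet> ?P z0 \<le> \<epsilon> * (K * (norm (v 0) / ki)^2)"
  proof -
    have "z0 \<bullet> ?P z0 \<le> K * (\<epsilon> * (norm (v 0) / ki))^2"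
      using quad_le[of z0] \<epsilon> pos(2) by (simp add: z0_def norm_Pair)
    also have "\<dots> = (\<epsilon> * \<epsilon>) * (K * (norm (v 0) / ki)^2)" by (simp add: power2_eq_square)
    also have "\<dots> \<le> \<epsilon> * (K * (norm (v 0) / ki)^2)" using \<epsilon> K by (intro mult_right_mono) (auto simp: mult_left_le_one_le)
    finally show ?thesis .
  qed
  have c: "p * (c * \<epsilon>) = \<epsilon> * (K * (norm (v 0) / ki)^2) + C * K / \<mu> * \<epsilon>" "0 \<le> c"
  proof -
    have "p * c = K * (norm (v 0) / ki)^2 + C * K / \<mu>" using pos by (simp add: c_def)
    moreover have "p * (c * \<epsilon>) = (p * c) * \<epsilon>" by simp
    ultimately show "p * (c * \<epsilon>) = \<epsilon> * (K * (norm (v 0) / ki)^2) + C * K / \<mu> * \<epsilon>" by (simp only: distrib_left mult.commute)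
    show "0 \<le> c" using pos K by (simp add: c_def)
  qed
  have zb: "(\<integral>\<^sup>+\<omega>. ennreal ((norm (z t \<omega>))^2) \<partial>M) \<le> ennreal (c * \<epsilon>)"
  proof -
    have [measurable]: "z t \<in> borel_measurable M" by (rule F_imp_M[OF zm[OF t]])
    have "ennreal p * (\<integral>\<^sup>+\<omega>. ennreal ((norm (z t \<omega>))^2) \<partial>M) = (\<integral>\<^sup>+\<omega>. ennreal (p * (norm (z t \<omega>))^2) \<partial>M)"
      using pos(3) by (subst nn_integral_cmult[symmetric]) (auto simp: ennreal_mult')
    also have "\<dots> \<le> (\<integral>\<^sup>+\<omega>. ennreal (z t \<omega> \<bullet> ?P (z t \<omega>)) \<partial>M)"
      by (intro nn_integral_mono ennreal_leI coercive)
    also have "\<dots> \<le> ennreal (z0 \<bullet> ?P z0 + C / \<alpha>)" by (rule D.lyapunov_moment_bound[OF t])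
    also have "\<dots> \<le> ennreal (p * (c * \<epsilon>))"
      unfolding c using z0 by (intro ennreal_leI) (simp add: \<alpha>_def mult_ac)
    also have "\<dots> = ennreal p * ennreal (c * \<epsilon>)" using pos(3) by (simp add: ennreal_mult')
    finally show ?thesis using pos(3) by (simp add: ennreal_mult_le_mult_iff)
  qed
  have "(\<integral>\<^sup>+\<omega>. ennreal ((norm (y t - x1 t \<omega>))^2) \<partial>M) \<le> (\<integral>\<^sup>+\<omega>. ennreal (\<epsilon>^2) * ennreal ((norm (z t \<omega>))^2) \<partial>M)"
  proof (rule nn_integral_mono)
    fix \<omega>
    have "(norm (y t - x1 t \<omega>))^2 = \<epsilon>^2 * (norm ((1 / \<epsilon>) *\<^sub>R E t \<omega>))^2" using \<epsilon> by (simp add: E_def power_divide)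
    also have "\<dots> \<le> \<epsilon>^2 * (norm (z t \<omega>))^2" by (intro mult_left_mono) (simp_all add: z_def norm_triple_square)
    finally have "ennreal ((norm (y t - x1 t \<omega>))^2) \<le> ennreal (\<epsilon>^2 * (norm (z t \<omega>))^2)" by (rule ennreal_leI)
    then show "ennreal ((norm (y t - x1 t \<omega>))^2) \<le> ennreal (\<epsilon>^2) * ennreal ((norm (z t \<omega>))^2)" by (simp add: ennreal_mult')
  qed
  also have "\<dots> = ennreal (\<epsilon>^2) * (\<integral>\<^sup>+\<omega>. ennreal ((norm (z t \<omega>))^2) \<partial>M)"
    using F_imp_M[OF zm[OF t]] by (intro nn_integral_cmult) measurable
  also have "\<dots> \<le> ennreal (\<epsilon>^2) * ennreal (c * \<epsilon>)" by (intro mult_left_mono zb) auto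
  also have "\<dots> = ennreal (c * \<epsilon>^3)" by (simp add: ennreal_mult'[symmetric] power2_eq_square power3_eq_cube mult_ac)
  finally show "(\<integral>\<^sup>+\<omega>. ennreal ((norm (y t - x1 t \<omega>))^2) \<partial>M) \<le> ennreal (c * \<epsilon>^3)" .
  have "(\<integral>\<^sup>+\<omega>. ennreal ((norm (y' t - x2 t \<omega>))^2) \<partial>M) \<le> (\<integral>\<^sup>+\<omega>. ennreal ((norm (z t \<omega>))^2) \<partial>M)"
    by (intro nn_integral_mono ennreal_leI) (simp add: z_def norm_triple_square E'_def)
  then show "(\<integral>\<^sup>+\<omega>. ennreal ((norm (y' t - x2 t \<omega>))^2) \<partial>M) \<le> ennreal (c * \<epsilon>)" using zb by (rule order_trans)
qed

end

section \<open>The constants obtained from the hypotheses, and the conclusion\<close>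

theorem theorem3:
  fixes f :: "(real^'n) \<times> (real^'n) \<times> (real^'n) \<Rightarrow> real^'n"
    and g :: "(real^'n) \<times> (real^'n) \<Rightarrow> real^'n"
    and d d' r r' r'' y y' :: "real \<Rightarrow> real^'n"
    and L1 L2 N1 N2 b_low b_up ki kp kd kbar \<omega> :: real
    and x10 x20 :: "real^'n"
    and M :: "'a measure" and F :: "real \<Rightarrow> 'a measure" and B :: "real \<Rightarrow> 'a \<Rightarrow> real"
  assumes "L1 > 0" "L2 > 0" "N1 > 0" "N2 > 0" "0 < b_low" "b_low \<le> b_up"
    and "C1_map f" and "C1_map g"
    and d_C1: "\<forall>t\<ge>0. (d has_vector_derivative d' t) (at t within {0..})" "continuous_on {0..} d'"
    and r_C2: "\<forall>t\<ge>0. (r has_vector_derivative r' t) (at t within {0..})"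
      "\<forall>t\<ge>0. (r' has_vector_derivative r'' t) (at t within {0..})" "continuous_on {0..} r''"
    and A1_f: "\<forall>x1 x2 u. matrix_opnorm (jacobian (\<lambda>x. f (x, x2, u)) (at x1)) \<le> L1"
      "\<forall>x1 x2 u. matrix_opnorm (jacobian (\<lambda>x. f (x1, x, u)) (at x2)) \<le> L2"
    and A1_g: "\<forall>x1 x2. matrix_opnorm (jacobian (\<lambda>x. g (x, x2)) (at x1)) \<le> N1"
      "\<forall>x1 x2. matrix_opnorm (jacobian (\<lambda>x. g (x1, x)) (at x2)) \<le> N2"
    and A1_u: "\<forall>x1 x2 u. loewner_le (b_low *\<^sub>R mat 1) (jacobian (\<lambda>v. f (x1, x2, v)) (at u))"
      "\<forall>x1 x2 u. loewner_le (jacobian (\<lambda>v. f (x1, x2, v)) (at u)) (b_up *\<^sub>R mat 1)"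
    and A2: "bounded (r' ` {0..})" "bounded (d' ` {0..})"
    and A3: "bounded ((\<lambda>t. g (r t, r' t)) ` {0..})"
    and A4: "bounded (r'' ` {0..})"
    and "ki > 0" "kp > 0" "kd > 0"
    and "kbar = (L1 + L2) * (kp + kd) / b_low"
    and "kp^2 - 2 * ki * kd > kbar + kd * N1^2 / b_low"
    and "kd^2 - kp / b_low > kbar + kd * N2^2 / b_low"
    and "\<omega> > 0"
    and y_ode: "\<forall>t\<ge>0. (y has_vector_derivative y' t) (at t within {0..})"
      "\<forall>t\<ge>0. (y' has_vector_derivative
          (- (\<omega>^2) *\<^sub>R (y t - r t) - (2 * \<omega>) *\<^sub>R (y' t - r' t) + r'' t)) (at t within {0..})"
      "y 0 = x10" "y' 0 = x20"
    and "brownian_motion M F B"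
  shows "\<exists>c>0. \<forall>\<epsilon>. 0 < \<epsilon> \<and> \<epsilon> \<le> 1 \<longrightarrow>
    (\<forall>x1 x2. closed_loop_solution M F B f g d y y' kp ki kd \<epsilon> x10 x20 x1 x2 \<longrightarrow>
      (SUP t\<in>{0..}. \<integral>\<^sup>+ w. ennreal ((norm (y t - x1 t w))\<^sup>2) \<partial>M) \<le> ennreal (c * \<epsilon>^3) \<and>
      (SUP t\<in>{0..}. \<integral>\<^sup>+ w. ennreal ((norm (y' t - x2 t w))\<^sup>2) \<partial>M) \<le> ennreal (c * \<epsilon>))"
proof -
  interpret brownian_motion M F B by fact
  note pos = \<open>L1 > 0\<close> \<open>L2 > 0\<close> \<open>N1 > 0\<close> \<open>N2 > 0\<close> \<open>0 < b_low\<close> \<open>b_low \<le> b_up\<close> \<open>ki > 0\<close> \<open>kp > 0\<close> \<open>kd > 0\<close> \<open>\<omega> > 0\<close>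
  have f_diff: "f differentiable (at x)" and g_diff: "g differentiable (at x')" for x x'
    using C1_map_differentiable \<open>C1_map f\<close> \<open>C1_map g\<close> by blast+
  have fd1: "(\<lambda>x. f (x, x2, u)) differentiable (at x1)" and fd2: "(\<lambda>x. f (x1, x, u)) differentiable (at x2)"
    and fdu: "(\<lambda>u. f (x1, x2, u)) differentiable (at u)" for x1 x2 u
    by (rule differentiable_compose[OF f_diff]; auto intro!: derivative_intros simp: differentiable_Pair)+
  have gd1: "(\<lambda>x. g (x, x2)) differentiable (at x1)" and gd2: "(\<lambda>x. g (x1, x)) differentiable (at x2)" for x1 x2
    by (rule differentiable_compose[OF g_diff]; auto intro!: derivative_intros simp: differentiable_Pair)+
  have f_lip: "norm (f (x1, x2, u) - f (x1', x2', u)) \<le> L1 * norm (x1 - x1') + L2 * norm (x2 - x2')" for x1 x2 x1' x2' u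
  proof -
    have "norm (f (x1, x2, u) - f (x1', x2, u)) \<le> L1 * norm (x1 - x1')"
      using jacobian_lipschitz[OF fd1, of x2 u L1] A1_f(1) by blast
    moreover have "norm (f (x1', x2, u) - f (x1', x2', u)) \<le> L2 * norm (x2 - x2')"
      using jacobian_lipschitz[OF fd2, of x1' u L2] A1_f(2) by blast
    ultimately show ?thesis using norm_triangle_ineq[of "f (x1, x2, u) - f (x1', x2, u)" "f (x1', x2, u) - f (x1', x2', u)"] by simp
  qed
  have g_lip: "norm (g (x1, x2) - g (x1', x2')) \<le> N1 * norm (x1 - x1') + N2 * norm (x2 - x2')" for x1 x2 x1' x2'
  proof -
    have "norm (g (x1, x2) - g (x1', x2)) \<le> N1 * norm (x1 - x1')"
      using jacobian_lipschitz[OF gd1, of x2 N1] A1_g(1) by blast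
    moreover have "norm (g (x1', x2) - g (x1', x2')) \<le> N2 * norm (x2 - x2')"
      using jacobian_lipschitz[OF gd2, of x1' N2] A1_g(2) by blast
    ultimately show ?thesis using norm_triangle_ineq[of "g (x1, x2) - g (x1', x2)" "g (x1', x2) - g (x1', x2')"] by simp
  qed
  have f_mono: "b_low * (norm (u - u'))^2 \<le> (u - u') \<bullet> (f (x1, x2, u) - f (x1, x2, u'))" for x1 x2 u u'
    using jacobian_monotone[OF fdu, of b_low x1 x2] A1_u(1) by blast
  have f_lip_u: "norm (f (x1, x2, u) - f (x1, x2, u')) \<le> b_up * norm (u - u')" for x1 x2 u u'
  proof -
    have "matrix_opnorm (jacobian (\<lambda>v. f (x1, x2, v)) (at u)) \<le> b_up" for u
      using loewner_opnorm_le A1_u pos by fastforce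
    then show ?thesis using jacobian_lipschitz[OF fdu, of x1 x2 b_up] by blast
  qed
  obtain R1 where R1: "\<And>t. 0 \<le> t \<Longrightarrow> norm (r' t) \<le> R1" using A2(1) by (auto simp: bounded_iff)
  obtain D1 where D1: "\<And>t. 0 \<le> t \<Longrightarrow> norm (d' t) \<le> D1" using A2(2) by (auto simp: bounded_iff)
  obtain Gr where Gr: "\<And>t. 0 \<le> t \<Longrightarrow> norm (g (r t, r' t)) \<le> Gr" using A3 by (auto simp: bounded_iff)
  obtain R2 where R2: "\<And>t. 0 \<le> t \<Longrightarrow> norm (r'' t) \<le> R2" using A4 by (auto simp: bounded_iff)
  define y'' where "y'' t = - (\<omega>^2) *\<^sub>R (y t - r t) - (2 * \<omega>) *\<^sub>R (y' t - r' t) + r'' t" for t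
  have y: "(y has_vector_derivative y' t) (at t within {0..})" and y': "(y' has_vector_derivative y'' t) (at t within {0..})" if "0 \<le> t" for t
    using y_ode that by (auto simp: y''_def)
  have r: "(r has_vector_derivative r' t) (at t within {0..})" and r': "(r' has_vector_derivative r'' t) (at t within {0..})" if "0 \<le> t" for t
    using r_C2 that by auto
  have d: "(d has_vector_derivative d' t) (at t within {0..})" if "0 \<le> t" for t using d_C1 that by auto
  have cont: "continuous_on {0..} y" "continuous_on {0..} y'" "continuous_on {0..} r" "continuous_on {0..} r'" "continuous_on {0..} d"
    using has_vector_derivative_continuous_on y y' r r' d by blast+
  have y''c: "continuous_on {0..} y''"
    unfolding y''_def using cont r_C2(3) by (intro continuous_intros) auto
  \<comment> \<open>The reference equation feeds \<open>r''\<close> forward, so \<open>y - r\<close>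
    solves the homogeneous critically damped equation and the bounds on \<open>r'\<close> and
    \<open>r''\<close> carry over to \<open>y'\<close> and \<open>y''\<close>.\<close>
  obtain K where K: "\<And>t. 0 \<le> t \<Longrightarrow> norm (y t - r t) \<le> K" "\<And>t. 0 \<le> t \<Longrightarrow> norm (y' t - r' t) \<le> K"
  proof (rule critically_damped_bounded[OF pos(10), of "\<lambda>t. y t - r t" "\<lambda>t. y' t - r' t"])
    fix t :: real assume t: "0 \<le> t"
    show "((\<lambda>t. y t - r t) has_vector_derivative (y' t - r' t)) (at t within {0..})"
      by (intro has_vector_derivative_diff y r t)
    have "((\<lambda>t. y' t - r' t) has_vector_derivative (y'' t - r'' t)) (at t within {0..})"
      by (intro has_vector_derivative_diff y' r' t)
    then show "((\<lambda>t. y' t - r' t) has_vector_derivative (- (\<omega>^2) *\<^sub>R (y t - r t) - (2 * \<omega>) *\<^sub>R (y' t - r' t))) (at t within {0..})"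
      by (simp add: y''_def)
  qed blast
  define Y1 where "Y1 = R1 + K"
  define Y2 where "Y2 = \<omega>^2 * K + 2 * \<omega> * K + R2"
  have Y1: "norm (y' t) \<le> Y1" if "0 \<le> t" for t
    using norm_triangle_ineq[of "r' t" "y' t - r' t"] R1[OF that] K(2)[OF that] by (simp add: Y1_def)
  have Y2: "norm (y'' t) \<le> Y2" if "0 \<le> t" for t
  proof -
    have "norm (y'' t) \<le> norm (\<omega>^2 *\<^sub>R (y t - r t)) + norm ((2 * \<omega>) *\<^sub>R (y' t - r' t)) + norm (r'' t)"
      unfolding y''_def by (rule norm_triangle_le, rule add_right_mono, rule norm_triangle_le_diff) simp
    also have "\<dots> \<le> Y2"
      using K[OF that] R2[OF that] pos(10) unfolding Y2_def by (intro add_mono) (auto intro: mult_left_mono)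
    finally show ?thesis .
  qed
  \<comment> \<open>Only \<open>g (r, r')\<close> is assumed bounded; the Lipschitz bounds move it
    to \<open>g (y, y')\<close> because \<open>y - r\<close> and its derivative are bounded.\<close>
  define G0 where "G0 = Gr + N1 * K + N2 * K"
  have G0: "norm (g (y t, y' t)) \<le> G0" if "0 \<le> t" for t
  proof -
    have "norm (g (y t, y' t) - g (r t, r' t)) \<le> N1 * K + N2 * K"
      by (rule order_trans[OF g_lip]) (use K[OF that] pos in \<open>auto intro!: add_mono mult_left_mono\<close>)
    then show ?thesis
      using norm_triangle_ineq2[of "g (y t, y' t)" "g (r t, r' t)"] Gr[OF that] by (simp add: G0_def)
  qed
  have "\<exists>u. f (y t, y' t, u) = - d t" for t
    by (rule strongly_monotone_surj[OF pos(5,6)]) (use f_mono f_lip_u in auto)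
  then obtain ustar where ustar: "\<And>t. f (y t, y' t, ustar t) = - d t" by metis
  \<comment> \<open>The numerator bounds the rate at which the equation for \<open>ustar\<close>
    changes through \<open>d\<close>, \<open>y\<close> and \<open>y'\<close>; strong monotonicity
    divides it by \<open>b_low\<close>.\<close>
  define \<Lambda> where "\<Lambda> = (D1 + L1 * Y1 + L2 * Y2) / b_low"
  have ulip: "norm (ustar t - ustar s) \<le> \<Lambda> * \<bar>t - s\<bar>" if s: "0 \<le> s" and t: "0 \<le> t" for s t
  proof -
    let ?D = "ustar t - ustar s"
    define X where "X = f (y t, y' t, ustar t) - f (y t, y' t, ustar s)"
    have X: "X = - (d t - d s) - (f (y t, y' t, ustar s) - f (y s, y' s, ustar s))"
      by (simp add: X_def ustar)
    have "norm X \<le> norm (d t - d s) + norm (f (y t, y' t, ustar s) - f (y s, y' s, ustar s))"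
      unfolding X by (rule norm_triangle_le_diff) (simp add: norm_minus_commute)
    also have "\<dots> \<le> D1 * \<bar>t - s\<bar> + (L1 * (Y1 * \<bar>t - s\<bar>) + L2 * (Y2 * \<bar>t - s\<bar>))"
    proof (rule add_mono)
      show "norm (d t - d s) \<le> D1 * \<bar>t - s\<bar>" by (rule lipschitz_of_bounded_derivative[OF d D1 s t])
      show "norm (f (y t, y' t, ustar s) - f (y s, y' s, ustar s)) \<le> L1 * (Y1 * \<bar>t - s\<bar>) + L2 * (Y2 * \<bar>t - s\<bar>)"
        by (rule order_trans[OF f_lip])
          (use lipschitz_of_bounded_derivative[OF y Y1 s t] lipschitz_of_bounded_derivative[OF y' Y2 s t] pos
            in \<open>auto intro!: add_mono mult_left_mono\<close>)
    qed
    also have "\<dots> = b_low * (\<Lambda> * \<bar>t - s\<bar>)" using pos(5) by (simp add: \<Lambda>_def field_simps)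
    finally have Xn: "norm X \<le> b_low * (\<Lambda> * \<bar>t - s\<bar>)" .
    have "b_low * (norm ?D * norm ?D) \<le> ?D \<bullet> X"
      using f_mono[of "ustar t" "ustar s" "y t" "y' t"] by (simp add: X_def power2_eq_square)
    also have "\<dots> \<le> norm ?D * norm X" by (rule norm_cauchy_schwarz)
    also have "\<dots> \<le> norm ?D * (b_low * (\<Lambda> * \<bar>t - s\<bar>))" by (rule mult_left_mono[OF Xn]) simp
    finally have *: "(b_low * norm ?D) * norm ?D \<le> (b_low * norm ?D) * (\<Lambda> * \<bar>t - s\<bar>)" by (simp add: mult_ac)
    \<comment> \<open>The estimate has a factor \<open>norm ?D\<close> on both sides, which cancels
      only if it is nonzero.\<close>
    show ?thesis
    proof (cases "ustar t = ustar s")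
      case True
      have "0 \<le> b_low * (\<Lambda> * \<bar>t - s\<bar>)" using order_trans[OF norm_ge_zero Xn] .
      then show ?thesis using True pos(5) by (simp add: zero_le_mult_iff)
    next
      case False
      then have "0 < b_low * norm ?D" using pos(5) by simp
      then show ?thesis using * by (simp only: mult_le_cancel_left_pos)
    qed
  qed
  obtain v v' where v: "\<And>t. 0 \<le> t \<Longrightarrow> (v has_vector_derivative v' t) (at t within {0..})" "continuous_on {0..} v'"
    "\<And>t. 0 \<le> t \<Longrightarrow> norm (v' t) \<le> \<Lambda>" "\<And>t. 0 \<le> t \<Longrightarrow> norm (v t - ustar t) \<le> \<Lambda>"
    using lipschitz_smoothing[of ustar \<Lambda>] ulip by metis
  have \<Lambda>: "0 \<le> \<Lambda>" using order_trans[OF norm_ge_zero v(3)[of 0]] by simp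
  \<comment> \<open>\<open>f (y, y', ustar)\<close> cancels \<open>- d\<close> exactly. What remains
    is \<open>y''\<close> and the error of replacing \<open>ustar\<close> by \<open>v\<close>, at
    most \<open>b_up\<close> times the distance \<Lambda>.\<close>
  define Q where "Q = Y2 + b_up * \<Lambda>"
  have Q: "norm (y'' t - f (y t, y' t, v t) - d t) \<le> Q" if "0 \<le> t" for t
  proof -
    have "norm (f (y t, y' t, v t) - f (y t, y' t, ustar t)) \<le> b_up * \<Lambda>"
      by (rule order_trans[OF f_lip_u]) (use v(4)[OF that] pos in \<open>auto intro: mult_left_mono\<close>)
    moreover have eq: "y'' t - f (y t, y' t, v t) - d t = y'' t - (f (y t, y' t, v t) - f (y t, y' t, ustar t))"
      by (simp add: ustar)
    ultimately show ?thesis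
      using norm_triangle_ineq4[of "y'' t" "f (y t, y' t, v t) - f (y t, y' t, ustar t)"] Y2[OF that]
      unfolding eq Q_def by linarith
  qed
  have Q0: "0 \<le> Q" using order_trans[OF norm_ge_zero Q[of 0]] by simp
  define W where "W = \<Lambda> / ki"
  have W: "0 \<le> W" "ki * W = \<Lambda>" using \<Lambda> pos by (auto simp: W_def)
  have gain1: "(L1 + L2) * (kp + kd) / b_low + kd * N1^2 / b_low < kp^2 - 2 * ki * kd"
    and gain2: "(L1 + L2) * (kp + kd) / b_low + kd * N2^2 / b_low < kd^2 - kp / b_low"
    using assms by auto
  have k1: "2 * ki * kd < kp^2" "kp < b_low * kd^2"
  proof -
    have nn: "0 \<le> (L1 + L2) * (kp + kd) / b_low" "0 \<le> kd * N1^2 / b_low" "0 \<le> kd * N2^2 / b_low" using pos by auto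
    show "2 * ki * kd < kp^2" using gain1 nn by linarith
    have "kp / b_low < kd^2" using gain2 nn by linarith
    then show "kp < b_low * kd^2" using pos by (simp add: divide_simps mult.commute)
  qed
  obtain p where p: "0 < p" "\<And>x :: (real^'n) \<times> (real^'n) \<times> (real^'n). p * (norm x)^2 \<le> x \<bullet> pid_form b_low ki kp kd x"
    using pid_form_coercive[OF pos(5,7,8,9) k1] by blast
  show ?thesis
  proof (rule pid_form_dissipative[where 'b="real^'n", OF pos(5,7,8,9,1,2,3,4) Q0 W(1) gain1 gain2, of G0])
    fix \<mu> C :: real
    assume \<mu>: "0 < \<mu>" and C: "0 \<le> C"
      and diss: "\<And>\<epsilon> (X0::real^'n) X1 X2 \<Phi> \<Psi> q w (G::real^'n). \<lbrakk>0 < \<epsilon>; \<epsilon> \<le> 1;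
      b_low / \<epsilon> * (norm (ki *\<^sub>R X0 + kp *\<^sub>R X1 + kd *\<^sub>R X2))^2 \<le> (ki *\<^sub>R X0 + kp *\<^sub>R X1 + kd *\<^sub>R X2) \<bullet> \<Phi>;
      norm \<Psi> \<le> L1 * (\<epsilon> * norm X1) + L2 * norm X2; norm q \<le> Q; norm w \<le> W;
      norm G \<le> N1 * (\<epsilon> * norm X1) + N2 * norm X2 + G0\<rbrakk> \<Longrightarrow>
      2 * ((X0, X1, X2) \<bullet> pid_form b_low ki kp kd ((1 / \<epsilon>) *\<^sub>R X1 - \<epsilon> *\<^sub>R w, (1 / \<epsilon>) *\<^sub>R X2, q - \<Phi> - \<Psi>))
        + kd * (norm G)^2 \<le> C - \<mu> / \<epsilon> * (norm (X0, X1, X2))^2"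
    have v'b: "\<And>t. 0 \<le> t \<Longrightarrow> norm (v' t) \<le> ki * W" using v(3) W(2) by simp
    \<comment> \<open>All ingredients, namely \<open>v\<close>, \<open>p\<close>,
      \<open>\<mu>\<close>, \<open>C\<close> and the norm of the form, have been fixed before any
      \<epsilon> is chosen.\<close>
    define c where "c = ((onorm (pid_form b_low ki kp kd :: (real^'n) \<times> (real^'n) \<times> (real^'n) \<Rightarrow> _) + 1) * (norm (v 0) / ki)^2
      + C * (onorm (pid_form b_low ki kp kd :: (real^'n) \<times> (real^'n) \<times> (real^'n) \<Rightarrow> _) + 1) / \<mu>) / p"
    note bound = pid_error_moment_bound[OF C1_map_continuous_on[OF \<open>C1_map f\<close>] C1_map_continuous_on[OF \<open>C1_map g\<close>]
        f_lip f_mono g_lip y y' y''c cont(5) v(1,2) v'b Q G0 pos(5,7) p(1) \<mu> C p(2) diss,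
        unfolded y_ode(3,4), folded c_def]
    \<comment> \<open>The witness \<open>\<bar>c\<bar> + 1\<close> is positive and at least
      \<open>c\<close>, whatever the sign of \<open>c\<close>.\<close>
    show ?thesis
    proof (intro exI[of _ "\<bar>c\<bar> + 1"] conjI allI impI)
      fix \<epsilon> x1 x2
      assume \<epsilon>: "0 < \<epsilon> \<and> \<epsilon> \<le> 1" and sol: "closed_loop_solution M F B f g d y y' kp ki kd \<epsilon> x10 x20 x1 x2"
      have "c * \<epsilon>^3 \<le> (\<bar>c\<bar> + 1) * \<epsilon>^3" "c * \<epsilon> \<le> (\<bar>c\<bar> + 1) * \<epsilon>"
        using \<epsilon> by (auto intro!: mult_right_mono)
      note le = this[THEN ennreal_leI]
      show "(SUP t\<in>{0..}. \<integral>\<^sup>+ w. ennreal ((norm (y t - x1 t w))\<^sup>2) \<partial>M) \<le> ennreal ((\<bar>c\<bar> + 1) * \<epsilon>^3)"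
        by (intro SUP_least order_trans[OF bound(1) le(1)]) (use \<epsilon> sol in auto)
      show "(SUP t\<in>{0..}. \<integral>\<^sup>+ w. ennreal ((norm (y' t - x2 t w))\<^sup>2) \<partial>M) \<le> ennreal ((\<bar>c\<bar> + 1) * \<epsilon>)"
        by (intro SUP_least order_trans[OF bound(2) le(2)]) (use \<epsilon> sol in auto)
    qed simp
  qed
qed

end
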